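(* Let $\mathcal{A}$ be an abelian subcategory of a triangulated category $\mathcal{T}$, and let $\mathcal{C}$ be an additive category. Suppose that $(L,E,R)$ is a fully faithful adjunction triple with $E\colon\mathcal{A}\to\mathcal{C}$ and $L,R\colon\mathcal{C}\to\mathcal{A}$. Then there exists a functor $C\colon\mathcal{C}\to\mathcal{A}$ such that the following statements hold: (1) The functor $C$ is fully faithful, preserves monomorphisms and epimorphisms, and reflects short exact sequences. It is exact if and only if its essential image is a Serre subcategory of $\mathcal{A}$. (2) The essential images $L\mathcal{C}$, $R\mathcal{C}$ and $C\mathcal{C}$ are extension closed in $\mathcal{A}$. (3) If $\mathcal{A}$ is a codistinguished abelian subcategory of $\mathcal{T}$, then the essential images $L\mathcal{C}$, $R\mathcal{C}$ and $C\mathcal{C}$ are codistinguished abelian subcategories of $\mathcal{T}$.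
   Context: Conventions: a subcategory is a full subcategory closed under isomorphisms; an additive subcategory of an additive category is a full subcategory (closed under isomorphisms) whose inclusion is additive. An abelian subcategory of a triangulated category is an additive subcategory which is an abelian category. An adjunction triple $(L,E,R)$ means $L$ is left adjoint to $E$ and $E$ is left adjoint to $R$. It is called fully faithful if $L$ or (equivalently) $R$ is fully faithful. In this situation the additive category $\mathcal{C}$ is automatically abelian. A functor $F\colon\mathcal{C}\to\mathcal{A}$ between abelian categories reflects short exact sequences if, whenever $0\to Fx\xrightarrow{Ff}Fy\xrightarrow{Fg}Fz\to0$ is a short exact sequence in $\mathcal{A}$, the sequence $0\to x\xrightarrow{f}y\xrightarrow{g}z\to0$ is a short exact sequence in $\mathcal{C}$. An additive subcategory $\mathcal{A}$ of a triangulated category $\mathcal{T}$ (with suspension $\Sigma$) is a codistinguished abelian subcategory of $\mathcal{T}$ if it is abelian and, for every distinguished triangle $a\xrightarrow{f}b\xrightarrow{g}c\to\Sigma a$ in $\mathcal{T}$ with $a,b,c$ in $\mathcal{A}$, the sequence $0\to a\xrightarrow{f}b\xrightarrow{g}c\to 0$ is a short exact sequence in $\mathcal{A}$. *)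

theory Defs
  imports "HOL-Algebra.Group"
begin

section \<open>Categories\<close>

text \<open>
  Following the style of HOL-Algebra, a category is a record with explicit carriers, and the axioms
  are collected in a locale. \<open>g \<cdot> f\<close> is ``\<open>g\<close> after \<open>f\<close>'', meaningful only if \<open>Cod f = Dom g\<close>.
\<close>

record ('o, 'm) cat =
  Obj :: "'o set"
  Arr :: "'m set"
  Dom :: "'m \<Rightarrow> 'o"
  Cod :: "'m \<Rightarrow> 'o"
  Idn :: "'o \<Rightarrow> 'm"
  Comp :: "'m \<Rightarrow> 'm \<Rightarrow> 'm" (infixl \<open>\<cdot>\<index>\<close> 70)

definition homset :: "('o, 'm, 'z) cat_scheme \<Rightarrow> 'o \<Rightarrow> 'o \<Rightarrow> 'm set" where
  "homset C x y = {f \<in> Arr C. Dom C f = x \<and> Cod C f = y}"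

locale category =
  fixes C :: "('o, 'm, 'z) cat_scheme" (structure)
  assumes dom_closed: "f \<in> Arr C \<Longrightarrow> Dom C f \<in> Obj C"
    and cod_closed: "f \<in> Arr C \<Longrightarrow> Cod C f \<in> Obj C"
    and idn_hom: "x \<in> Obj C \<Longrightarrow> Idn C x \<in> homset C x x"
    and comp_hom: "f \<in> homset C x y \<Longrightarrow> g \<in> homset C y z \<Longrightarrow> g \<cdot> f \<in> homset C x z"
    and idn_left: "f \<in> homset C x y \<Longrightarrow> Idn C y \<cdot> f = f"
    and idn_right: "f \<in> homset C x y \<Longrightarrow> f \<cdot> Idn C x = f"
    and comp_assoc: "f \<in> homset C w x \<Longrightarrow> g \<in> homset C x y \<Longrightarrow> h \<in> homset C y z \<Longrightarrow>
      h \<cdot> (g \<cdot> f) = (h \<cdot> g) \<cdot> f"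

definition monomorphism :: "('o, 'm, 'z) cat_scheme \<Rightarrow> 'm \<Rightarrow> bool" where
  "monomorphism C f \<longleftrightarrow> f \<in> Arr C \<and>
     (\<forall>g\<in>Arr C. \<forall>h\<in>Arr C. Dom C g = Dom C h \<and> Cod C g = Dom C f \<and> Cod C h = Dom C f \<and>
        f \<cdot>\<^bsub>C\<^esub> g = f \<cdot>\<^bsub>C\<^esub> h \<longrightarrow> g = h)"

definition epimorphism :: "('o, 'm, 'z) cat_scheme \<Rightarrow> 'm \<Rightarrow> bool" where
  "epimorphism C f \<longleftrightarrow> f \<in> Arr C \<and>
     (\<forall>g\<in>Arr C. \<forall>h\<in>Arr C. Cod C g = Cod C h \<and> Dom C g = Cod C f \<and> Dom C h = Cod C f \<and>
        g \<cdot>\<^bsub>C\<^esub> f = h \<cdot>\<^bsub>C\<^esub> f \<longrightarrow> g = h)"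

definition isomorphism :: "('o, 'm, 'z) cat_scheme \<Rightarrow> 'm \<Rightarrow> bool" where
  "isomorphism C f \<longleftrightarrow> f \<in> Arr C \<and>
     (\<exists>g\<in>homset C (Cod C f) (Dom C f).
        g \<cdot>\<^bsub>C\<^esub> f = Idn C (Dom C f) \<and> f \<cdot>\<^bsub>C\<^esub> g = Idn C (Cod C f))"

definition isomorphic :: "('o, 'm, 'z) cat_scheme \<Rightarrow> 'o \<Rightarrow> 'o \<Rightarrow> bool" where
  "isomorphic C x y \<longleftrightarrow> (\<exists>f\<in>homset C x y. isomorphism C f)"

definition zero_object :: "('o, 'm, 'z) cat_scheme \<Rightarrow> 'o \<Rightarrow> bool" where
  "zero_object C x \<longleftrightarrow> x \<in> Obj C \<and>
     (\<forall>y\<in>Obj C. (\<exists>!f. f \<in> homset C x y) \<and> (\<exists>!f. f \<in> homset C y x))"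

definition closed_under_iso :: "('o, 'm, 'z) cat_scheme \<Rightarrow> 'o set \<Rightarrow> bool" where
  "closed_under_iso C S \<longleftrightarrow> (\<forall>x\<in>S. \<forall>y\<in>Obj C. isomorphic C x y \<longrightarrow> y \<in> S)"

text \<open>
  Full subcategories are given by their sets of objects. All operations, including any in
  extensions of the record such as the addition of arrows, are inherited.
\<close>

definition full_subcat :: "('o, 'm, 'z) cat_scheme \<Rightarrow> 'o set \<Rightarrow> ('o, 'm, 'z) cat_scheme" where
  "full_subcat C S = C\<lparr>Obj := S, Arr := {f \<in> Arr C. Dom C f \<in> S \<and> Cod C f \<in> S}\<rparr>"


section \<open>Functors and adjunctions\<close>

record ('o1, 'm1, 'o2, 'm2) fctr =
  FObj :: "'o1 \<Rightarrow> 'o2"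
  FArr :: "'m1 \<Rightarrow> 'm2"

definition is_functor ::
  "('o1, 'm1, 'y) cat_scheme \<Rightarrow> ('o2, 'm2, 'z) cat_scheme \<Rightarrow> ('o1, 'm1, 'o2, 'm2) fctr \<Rightarrow> bool" where
  "is_functor C D F \<longleftrightarrow>
     (\<forall>x\<in>Obj C. FObj F x \<in> Obj D) \<and>
     (\<forall>f\<in>Arr C. FArr F f \<in> homset D (FObj F (Dom C f)) (FObj F (Cod C f))) \<and>
     (\<forall>x\<in>Obj C. FArr F (Idn C x) = Idn D (FObj F x)) \<and>
     (\<forall>f\<in>Arr C. \<forall>g\<in>Arr C. Cod C f = Dom C g \<longrightarrow>
        FArr F (g \<cdot>\<^bsub>C\<^esub> f) = FArr F g \<cdot>\<^bsub>D\<^esub> FArr F f)"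

definition id_fctr :: "('o, 'm, 'o, 'm) fctr" where
  "id_fctr = \<lparr>FObj = (\<lambda>x. x), FArr = (\<lambda>f. f)\<rparr>"

definition comp_fctr ::
  "('o2, 'm2, 'o3, 'm3) fctr \<Rightarrow> ('o1, 'm1, 'o2, 'm2) fctr \<Rightarrow> ('o1, 'm1, 'o3, 'm3) fctr" where
  "comp_fctr G F = \<lparr>FObj = FObj G \<circ> FObj F, FArr = FArr G \<circ> FArr F\<rparr>"

definition naturally_isomorphic ::
  "('o1, 'm1, 'y) cat_scheme \<Rightarrow> ('o2, 'm2, 'z) cat_scheme \<Rightarrow>
   ('o1, 'm1, 'o2, 'm2) fctr \<Rightarrow> ('o1, 'm1, 'o2, 'm2) fctr \<Rightarrow> bool" where
  "naturally_isomorphic C D F G \<longleftrightarrow>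
     (\<exists>\<eta>. (\<forall>x\<in>Obj C. \<eta> x \<in> homset D (FObj F x) (FObj G x) \<and> isomorphism D (\<eta> x)) \<and>
          (\<forall>f\<in>Arr C. \<eta> (Cod C f) \<cdot>\<^bsub>D\<^esub> FArr F f = FArr G f \<cdot>\<^bsub>D\<^esub> \<eta> (Dom C f)))"

definition equivalence ::
  "('o1, 'm1, 'y) cat_scheme \<Rightarrow> ('o2, 'm2, 'z) cat_scheme \<Rightarrow> ('o1, 'm1, 'o2, 'm2) fctr \<Rightarrow> bool" where
  "equivalence C D F \<longleftrightarrow> is_functor C D F \<and>
     (\<exists>G. is_functor D C G \<and>
          naturally_isomorphic C C (comp_fctr G F) id_fctr \<and>
          naturally_isomorphic D D (comp_fctr F G) id_fctr)"

definition fully_faithful ::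
  "('o1, 'm1, 'y) cat_scheme \<Rightarrow> ('o2, 'm2, 'z) cat_scheme \<Rightarrow> ('o1, 'm1, 'o2, 'm2) fctr \<Rightarrow> bool" where
  "fully_faithful C D F \<longleftrightarrow>
     (\<forall>x\<in>Obj C. \<forall>y\<in>Obj C.
        bij_betw (FArr F) (homset C x y) (homset D (FObj F x) (FObj F y)))"

definition essential_image ::
  "('o1, 'm1, 'y) cat_scheme \<Rightarrow> ('o2, 'm2, 'z) cat_scheme \<Rightarrow> ('o1, 'm1, 'o2, 'm2) fctr \<Rightarrow> 'o2 set" where
  "essential_image C D F = {y \<in> Obj D. \<exists>x\<in>Obj C. isomorphic D (FObj F x) y}"

definition preserves_monos ::
  "('o1, 'm1, 'y) cat_scheme \<Rightarrow> ('o2, 'm2, 'z) cat_scheme \<Rightarrow> ('o1, 'm1, 'o2, 'm2) fctr \<Rightarrow> bool" where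
  "preserves_monos C D F \<longleftrightarrow> (\<forall>f. monomorphism C f \<longrightarrow> monomorphism D (FArr F f))"

definition preserves_epis ::
  "('o1, 'm1, 'y) cat_scheme \<Rightarrow> ('o2, 'm2, 'z) cat_scheme \<Rightarrow> ('o1, 'm1, 'o2, 'm2) fctr \<Rightarrow> bool" where
  "preserves_epis C D F \<longleftrightarrow> (\<forall>f. epimorphism C f \<longrightarrow> epimorphism D (FArr F f))"

text \<open>
  \<open>left_adjoint C D F G\<close> says that \<open>F : C \<rightarrow> D\<close> is left adjoint to \<open>G : D \<rightarrow> C\<close>: there are bijections
  \<open>\<phi> x y : Hom (F x, y) \<rightarrow> Hom (x, G y)\<close> natural in \<open>x\<close> and \<open>y\<close>.
\<close>

definition left_adjoint ::
  "('o1, 'm1, 'y) cat_scheme \<Rightarrow> ('o2, 'm2, 'z) cat_scheme \<Rightarrow>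
   ('o1, 'm1, 'o2, 'm2) fctr \<Rightarrow> ('o2, 'm2, 'o1, 'm1) fctr \<Rightarrow> bool" where
  "left_adjoint C D F G \<longleftrightarrow> is_functor C D F \<and> is_functor D C G \<and>
     (\<exists>\<phi>.
        (\<forall>x\<in>Obj C. \<forall>y\<in>Obj D.
           bij_betw (\<phi> x y) (homset D (FObj F x) y) (homset C x (FObj G y))) \<and>
        (\<forall>u\<in>Arr C. \<forall>v\<in>Arr D. \<forall>f\<in>homset D (FObj F (Cod C u)) (Dom D v).
           \<phi> (Dom C u) (Cod D v) ((v \<cdot>\<^bsub>D\<^esub> f) \<cdot>\<^bsub>D\<^esub> FArr F u) =
           (FArr G v \<cdot>\<^bsub>C\<^esub> \<phi> (Cod C u) (Dom D v) f) \<cdot>\<^bsub>C\<^esub> u))"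

text \<open>Here \<open>E : A \<rightarrow> C\<close> and \<open>L, R : C \<rightarrow> A\<close>, with \<open>L\<close> left adjoint and \<open>R\<close> right adjoint to \<open>E\<close>.\<close>

definition adjunction_triple ::
  "('o1, 'm1, 'y) cat_scheme \<Rightarrow> ('o2, 'm2, 'z) cat_scheme \<Rightarrow> ('o2, 'm2, 'o1, 'm1) fctr \<Rightarrow>
   ('o1, 'm1, 'o2, 'm2) fctr \<Rightarrow> ('o2, 'm2, 'o1, 'm1) fctr \<Rightarrow> bool" where
  "adjunction_triple A C L E R \<longleftrightarrow> left_adjoint C A L E \<and> left_adjoint A C E R"

definition ff_adjunction_triple ::
  "('o1, 'm1, 'y) cat_scheme \<Rightarrow> ('o2, 'm2, 'z) cat_scheme \<Rightarrow> ('o2, 'm2, 'o1, 'm1) fctr \<Rightarrow>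
   ('o1, 'm1, 'o2, 'm2) fctr \<Rightarrow> ('o2, 'm2, 'o1, 'm1) fctr \<Rightarrow> bool" where
  "ff_adjunction_triple A C L E R \<longleftrightarrow>
     adjunction_triple A C L E R \<and> (fully_faithful C A L \<or> fully_faithful C A R)"


section \<open>Additive and abelian categories\<close>

text \<open>
  \<open>Add\<close> is meaningful only on parallel arrows. The zero arrows are part of the data, so that each
  Hom-set becomes a HOL-Algebra group, written multiplicatively there.
\<close>

record ('o, 'm) addcat = "('o, 'm) cat" +
  Add :: "'m \<Rightarrow> 'm \<Rightarrow> 'm"
  Zer :: "'o \<Rightarrow> 'o \<Rightarrow> 'm"

definition hom_group :: "('o, 'm, 'z) addcat_scheme \<Rightarrow> 'o \<Rightarrow> 'o \<Rightarrow> 'm monoid" where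
  "hom_group C x y = \<lparr>carrier = homset C x y, monoid.mult = Add C, one = Zer C x y\<rparr>"

definition neg_arr :: "('o, 'm, 'z) addcat_scheme \<Rightarrow> 'm \<Rightarrow> 'm" where
  "neg_arr C f = inv\<^bsub>hom_group C (Dom C f) (Cod C f)\<^esub> f"

locale preadditive_category = category C
  for C :: "('o, 'm, 'z) addcat_scheme" (structure) +
  assumes hom_comm_group: "x \<in> Obj C \<Longrightarrow> y \<in> Obj C \<Longrightarrow> comm_group (hom_group C x y)"
    and comp_add_left: "f \<in> homset C x y \<Longrightarrow> g \<in> homset C y z \<Longrightarrow> g' \<in> homset C y z \<Longrightarrow>
      Add C g g' \<cdot> f = Add C (g \<cdot> f) (g' \<cdot> f)"
    and comp_add_right: "f \<in> homset C x y \<Longrightarrow> f' \<in> homset C x y \<Longrightarrow> g \<in> homset C y z \<Longrightarrow>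
      g \<cdot> Add C f f' = Add C (g \<cdot> f) (g \<cdot> f')"

definition is_biproduct ::
  "('o, 'm, 'z) addcat_scheme \<Rightarrow> 'o \<Rightarrow> 'o \<Rightarrow> 'o \<Rightarrow> 'm \<Rightarrow> 'm \<Rightarrow> 'm \<Rightarrow> 'm \<Rightarrow> bool" where
  "is_biproduct C x y b i j p q \<longleftrightarrow> b \<in> Obj C \<and>
     i \<in> homset C x b \<and> j \<in> homset C y b \<and> p \<in> homset C b x \<and> q \<in> homset C b y \<and>
     p \<cdot>\<^bsub>C\<^esub> i = Idn C x \<and> q \<cdot>\<^bsub>C\<^esub> j = Idn C y \<and>
     q \<cdot>\<^bsub>C\<^esub> i = Zer C x y \<and> p \<cdot>\<^bsub>C\<^esub> j = Zer C y x \<and>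
     Add C (i \<cdot>\<^bsub>C\<^esub> p) (j \<cdot>\<^bsub>C\<^esub> q) = Idn C b"

locale additive_category = preadditive_category C
  for C :: "('o, 'm, 'z) addcat_scheme" (structure) +
  assumes ex_zero_object: "\<exists>z. zero_object C z"
    and ex_biproduct: "x \<in> Obj C \<Longrightarrow> y \<in> Obj C \<Longrightarrow> \<exists>b i j p q. is_biproduct C x y b i j p q"

definition additive_functor ::
  "('o1, 'm1, 'y) addcat_scheme \<Rightarrow> ('o2, 'm2, 'z) addcat_scheme \<Rightarrow>
   ('o1, 'm1, 'o2, 'm2) fctr \<Rightarrow> bool" where
  "additive_functor C D F \<longleftrightarrow> is_functor C D F \<and>
     (\<forall>f\<in>Arr C. \<forall>g\<in>Arr C. Dom C f = Dom C g \<and> Cod C f = Cod C g \<longrightarrow>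
        FArr F (Add C f g) = Add D (FArr F f) (FArr F g))"

definition is_kernel :: "('o, 'm, 'z) addcat_scheme \<Rightarrow> 'm \<Rightarrow> 'm \<Rightarrow> bool" where
  "is_kernel C k f \<longleftrightarrow> k \<in> Arr C \<and> f \<in> Arr C \<and> Cod C k = Dom C f \<and>
     f \<cdot>\<^bsub>C\<^esub> k = Zer C (Dom C k) (Cod C f) \<and>
     (\<forall>h\<in>Arr C. Cod C h = Dom C f \<and> f \<cdot>\<^bsub>C\<^esub> h = Zer C (Dom C h) (Cod C f) \<longrightarrow>
        (\<exists>!u. u \<in> homset C (Dom C h) (Dom C k) \<and> k \<cdot>\<^bsub>C\<^esub> u = h))"

definition is_cokernel :: "('o, 'm, 'z) addcat_scheme \<Rightarrow> 'm \<Rightarrow> 'm \<Rightarrow> bool" where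
  "is_cokernel C c f \<longleftrightarrow> c \<in> Arr C \<and> f \<in> Arr C \<and> Dom C c = Cod C f \<and>
     c \<cdot>\<^bsub>C\<^esub> f = Zer C (Dom C f) (Cod C c) \<and>
     (\<forall>h\<in>Arr C. Dom C h = Cod C f \<and> h \<cdot>\<^bsub>C\<^esub> f = Zer C (Dom C f) (Cod C h) \<longrightarrow>
        (\<exists>!u. u \<in> homset C (Cod C c) (Cod C h) \<and> u \<cdot>\<^bsub>C\<^esub> c = h))"

locale abelian_category = additive_category C
  for C :: "('o, 'm, 'z) addcat_scheme" (structure) +
  assumes ex_kernel: "f \<in> Arr C \<Longrightarrow> \<exists>k. is_kernel C k f"
    and ex_cokernel: "f \<in> Arr C \<Longrightarrow> \<exists>c. is_cokernel C c f"
    and mono_normal: "monomorphism C f \<Longrightarrow> \<exists>g. is_kernel C f g"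
    and epi_normal: "epimorphism C f \<Longrightarrow> \<exists>g. is_cokernel C f g"

text \<open>\<open>0 \<rightarrow> a \<rightarrow> b \<rightarrow> c \<rightarrow> 0\<close> with the arrows \<open>f : a \<rightarrow> b\<close> and \<open>g : b \<rightarrow> c\<close>.\<close>

definition short_exact :: "('o, 'm, 'z) addcat_scheme \<Rightarrow> 'm \<Rightarrow> 'm \<Rightarrow> bool" where
  "short_exact C f g \<longleftrightarrow> is_kernel C f g \<and> is_cokernel C g f"

definition exact_functor ::
  "('o1, 'm1, 'y) addcat_scheme \<Rightarrow> ('o2, 'm2, 'z) addcat_scheme \<Rightarrow>
   ('o1, 'm1, 'o2, 'm2) fctr \<Rightarrow> bool" where
  "exact_functor C D F \<longleftrightarrow> additive_functor C D F \<and>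
     (\<forall>f g. short_exact C f g \<longrightarrow> short_exact D (FArr F f) (FArr F g))"

definition reflects_short_exact ::
  "('o1, 'm1, 'y) addcat_scheme \<Rightarrow> ('o2, 'm2, 'z) addcat_scheme \<Rightarrow>
   ('o1, 'm1, 'o2, 'm2) fctr \<Rightarrow> bool" where
  "reflects_short_exact C D F \<longleftrightarrow>
     (\<forall>f\<in>Arr C. \<forall>g\<in>Arr C. Cod C f = Dom C g \<and> short_exact D (FArr F f) (FArr F g) \<longrightarrow>
        short_exact C f g)"

definition extension_closed :: "('o, 'm, 'z) addcat_scheme \<Rightarrow> 'o set \<Rightarrow> bool" where
  "extension_closed A S \<longleftrightarrow>
     (\<forall>f g. short_exact A f g \<and> Dom A f \<in> S \<and> Cod A g \<in> S \<longrightarrow> Cod A f \<in> S)"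

definition serre_subcategory :: "('o, 'm, 'z) addcat_scheme \<Rightarrow> 'o set \<Rightarrow> bool" where
  "serre_subcategory A S \<longleftrightarrow> S \<subseteq> Obj A \<and> S \<noteq> {} \<and>
     (\<forall>f g. short_exact A f g \<longrightarrow> (Cod A f \<in> S \<longleftrightarrow> Dom A f \<in> S \<and> Cod A g \<in> S))"

text \<open>
  A full subcategory inherits the addition of arrows, so its inclusion functor is additive as soon
  as the subcategory is an additive category.
\<close>

definition additive_subcategory :: "('o, 'm, 'z) addcat_scheme \<Rightarrow> 'o set \<Rightarrow> bool" where
  "additive_subcategory C S \<longleftrightarrow>
     S \<subseteq> Obj C \<and> closed_under_iso C S \<and> additive_category (full_subcat C S)"

definition abelian_subcategory :: "('o, 'm, 'z) addcat_scheme \<Rightarrow> 'o set \<Rightarrow> bool" where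
  "abelian_subcategory C S \<longleftrightarrow> additive_subcategory C S \<and> abelian_category (full_subcat C S)"


section \<open>Triangulated categories\<close>

record ('o, 'm) tricat = "('o, 'm) addcat" +
  Susp :: "('o, 'm, 'o, 'm) fctr"
  Dist :: "('m \<times> 'm \<times> 'm) set"

definition triangle :: "('o, 'm, 'z) tricat_scheme \<Rightarrow> 'm \<Rightarrow> 'm \<Rightarrow> 'm \<Rightarrow> bool" where
  "triangle T f g h \<longleftrightarrow> f \<in> Arr T \<and> g \<in> Arr T \<and> h \<in> Arr T \<and>
     Cod T f = Dom T g \<and> Cod T g = Dom T h \<and> Cod T h = FObj (Susp T) (Dom T f)"

definition triangle_morphism ::
  "('o, 'm, 'z) tricat_scheme \<Rightarrow> 'm \<times> 'm \<times> 'm \<Rightarrow> 'm \<times> 'm \<times> 'm \<Rightarrow> 'm \<Rightarrow> 'm \<Rightarrow> 'm \<Rightarrow> bool" where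
  "triangle_morphism T = (\<lambda>(f, g, h) (f', g', h') u v w.
     u \<in> homset T (Dom T f) (Dom T f') \<and>
     v \<in> homset T (Dom T g) (Dom T g') \<and>
     w \<in> homset T (Dom T h) (Dom T h') \<and>
     v \<cdot>\<^bsub>T\<^esub> f = f' \<cdot>\<^bsub>T\<^esub> u \<and> w \<cdot>\<^bsub>T\<^esub> g = g' \<cdot>\<^bsub>T\<^esub> v \<and> FArr (Susp T) u \<cdot>\<^bsub>T\<^esub> h = h' \<cdot>\<^bsub>T\<^esub> w)"

locale triangulated_category = additive_category T
  for T :: "('o, 'm, 'z) tricat_scheme" (structure) +
  assumes susp_additive: "additive_functor T T (Susp T)"
    and susp_equivalence: "equivalence T T (Susp T)"
    and dist_triangle: "(f, g, h) \<in> Dist T \<Longrightarrow> triangle T f g h"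
    and dist_iso: "(f, g, h) \<in> Dist T \<Longrightarrow> triangle T f' g' h' \<Longrightarrow>
      triangle_morphism T (f, g, h) (f', g', h') u v w \<Longrightarrow>
      isomorphism T u \<Longrightarrow> isomorphism T v \<Longrightarrow> isomorphism T w \<Longrightarrow> (f', g', h') \<in> Dist T"
    and dist_idn: "x \<in> Obj T \<Longrightarrow> zero_object T z \<Longrightarrow>
      (Idn T x, Zer T x z, Zer T z (FObj (Susp T) x)) \<in> Dist T"
    and dist_completion: "f \<in> Arr T \<Longrightarrow> \<exists>g h. (f, g, h) \<in> Dist T"
    and dist_rotation: "triangle T f g h \<Longrightarrow>
      (f, g, h) \<in> Dist T \<longleftrightarrow> (g, h, neg_arr T (FArr (Susp T) f)) \<in> Dist T"
    and dist_morphism: "(f, g, h) \<in> Dist T \<Longrightarrow> (f', g', h') \<in> Dist T \<Longrightarrow>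
      u \<in> homset T (Dom T f) (Dom T f') \<Longrightarrow> v \<in> homset T (Cod T f) (Cod T f') \<Longrightarrow>
      v \<cdot> f = f' \<cdot> u \<Longrightarrow> \<exists>w. triangle_morphism T (f, g, h) (f', g', h') u v w"
    and octahedral: "(f, i, i') \<in> Dist T \<Longrightarrow> (g, j, j') \<in> Dist T \<Longrightarrow> Cod T f = Dom T g \<Longrightarrow>
      (g \<cdot> f, k, k') \<in> Dist T \<Longrightarrow>
      \<exists>u v. (u, v, FArr (Susp T) i \<cdot> j') \<in> Dist T \<and>
        u \<in> homset T (Cod T i) (Cod T k) \<and> v \<in> homset T (Cod T k) (Cod T j) \<and>
        u \<cdot> i = k \<cdot> g \<and> k' \<cdot> u = i' \<and> v \<cdot> k = j \<and> j' \<cdot> v = FArr (Susp T) f \<cdot> k'"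

definition codistinguished_abelian_subcategory :: "('o, 'm, 'z) tricat_scheme \<Rightarrow> 'o set \<Rightarrow> bool" where
  "codistinguished_abelian_subcategory T S \<longleftrightarrow> abelian_subcategory T S \<and>
     (\<forall>f g h. (f, g, h) \<in> Dist T \<and> Dom T f \<in> S \<and> Cod T f \<in> S \<and> Cod T g \<in> S \<longrightarrow>
        short_exact (full_subcat T S) f g)"

end

(*
  The unit of the adjunction L -| E is invertible iff the counit of E -| R is, so L and R are both
  sections of E up to natural isomorphism. Let M x be the image of the canonical arrow L x -> R x (the
  functor C of the theorem). Then E M x = x and E is faithful on the arrows out of and into M x, which
  makes M fully faithful. An object a lies in the essential image of L iff the counit L E a -> a is
  invertible, and in that of M iff this counit is epi and the unit a -> R E a is mono. These conditions
  pass to extensions, because E preserves kernels and cokernels and L preserves cokernels. If M is exact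
  and 0 -> a -> b -> c -> 0 is exact with b in the image of M, then comparing it with its image under
  M E splits M E a -> a. If conversely the image of M is a Serre subcategory, the cokernel of M f for a
  mono f lies in it, hence comes from C and agrees with M of the cokernel of f. Finally, the essential
  image of a fully faithful functor on an abelian category is abelian, and short exactness is inherited
  by full subcategories, whence the codistinguished claim. Statements about R, quotients and
  epimorphisms follow from those about L, subobjects and monomorphisms in the opposite categories.
*)
theory Submission
  imports Defs
begin

section \<open>Categories and duality\<close>

text \<open>The triple consists of bare functors and \<open>C\<close> is merely additive, so
  everything exact about them has to be produced. \<open>E\<close> preserves zero arrows because the
  adjunction makes \<open>Idn\<close> and \<open>Zer\<close> agree on the image of a zero object;
  fully faithful functors preserve sums by means of biproducts; a kernel in \<open>C\<close> is
  \<open>E\<close> of a kernel in \<open>A\<close>. Membership in an essential image is rephrased as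
  a condition on the object alone (an arrow of \<open>A\<close> attached to it is mono, epi or
  both). Such conditions can be chased through a short exact sequence by testing which arrows are
  killed, with no five lemma or snake lemma. The delicate point is that \<open>L\<close> is only
  right exact: injectivity of \<open>L (E f)\<close> is first extracted from naturality of the
  counit. Preserving monomorphisms and epimorphisms leaves only exactness in the middle open for
  \<open>M\<close>, and this is what the Serre condition decides. Duality acts on whole locales:
  their assumptions are self-dual once \<open>L\<close> and \<open>R\<close> as well as unit and
  counit are exchanged, and an image factorisation keeps \<open>M\<close> and swaps its two
  halves.\<close>

lemma in_homset [simp]: "f \<in> homset C x y \<longleftrightarrow> f \<in> Arr C \<and> Dom C f = x \<and> Cod C f = y"
  by (simp add: homset_def)

text \<open>Only the fields of an additive category survive, so the opposite of any extended record
  has the plain type. Functor records need no opposite of their own: the same pair of maps serves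
  between the opposite categories.\<close>

definition op_cat :: "('o, 'm, 'z) addcat_scheme \<Rightarrow> ('o, 'm) addcat" where
  "op_cat C = \<lparr>Obj = Obj C, Arr = Arr C, Dom = Cod C, Cod = Dom C, Idn = Idn C,
     Comp = (\<lambda>g f. f \<cdot>\<^bsub>C\<^esub> g), Add = Add C, Zer = (\<lambda>x y. Zer C y x)\<rparr>"

lemma op_cat_simps [simp]:
  "Obj (op_cat C) = Obj C" "Arr (op_cat C) = Arr C" "Dom (op_cat C) = Cod C"
  "Cod (op_cat C) = Dom C" "Idn (op_cat C) = Idn C" "g \<cdot>\<^bsub>op_cat C\<^esub> f = f \<cdot>\<^bsub>C\<^esub> g"
  "Add (op_cat C) = Add C" "Zer (op_cat C) x y = Zer C y x"
  by (simp_all add: op_cat_def)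

lemma homset_op: "homset (op_cat C) x y = homset C y x"
  by (auto simp: homset_def)

lemma mono_op [simp]: "monomorphism (op_cat C) f \<longleftrightarrow> epimorphism C f"
  by (auto simp: monomorphism_def epimorphism_def)

lemma epi_op [simp]: "epimorphism (op_cat C) f \<longleftrightarrow> monomorphism C f"
  by (auto simp: monomorphism_def epimorphism_def)

lemma is_kernel_op [simp]: "is_kernel (op_cat C) k f \<longleftrightarrow> is_cokernel C k f"
  by (simp add: is_kernel_def is_cokernel_def homset_op conj_commute)

lemma is_cokernel_op [simp]: "is_cokernel (op_cat C) k f \<longleftrightarrow> is_kernel C k f"
  by (simp add: is_kernel_def is_cokernel_def homset_op)

lemma short_exact_op [simp]: "short_exact (op_cat C) f g \<longleftrightarrow> short_exact C g f"
  by (auto simp: short_exact_def)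

lemma zero_object_op [simp]: "zero_object (op_cat C) z \<longleftrightarrow> zero_object C z"
  by (auto simp: zero_object_def homset_op)

lemma isomorphism_op [simp]: "isomorphism (op_cat C) f \<longleftrightarrow> isomorphism C f"
  by (auto simp: isomorphism_def homset_op)

lemma is_functor_op: "is_functor (op_cat C) (op_cat D) F \<longleftrightarrow> is_functor C D F"
  by (auto simp: is_functor_def homset_op)

text \<open>Naming the inverse allows it to enter calculations and to be a locale parameter.\<close>

definition inverse_arrows :: "('o, 'm, 'z) cat_scheme \<Rightarrow> 'm \<Rightarrow> 'm \<Rightarrow> bool" where
  "inverse_arrows C f g \<longleftrightarrow> f \<in> Arr C \<and> g \<in> Arr C \<and> Dom C g = Cod C f \<and> Cod C g = Dom C f \<and>
     g \<cdot>\<^bsub>C\<^esub> f = Idn C (Dom C f) \<and> f \<cdot>\<^bsub>C\<^esub> g = Idn C (Cod C f)"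

lemma isomorphism_iff: "isomorphism C f \<longleftrightarrow> (\<exists>g. inverse_arrows C f g)"
  by (auto simp: isomorphism_def inverse_arrows_def)

lemma inverse_arrows_sym: "inverse_arrows C f g \<Longrightarrow> inverse_arrows C g f"
  by (auto simp: inverse_arrows_def)

lemma inverse_arrows_op: "inverse_arrows (op_cat C) f g \<longleftrightarrow> inverse_arrows C g f"
  by (auto simp: inverse_arrows_def)

section \<open>Composition, cancellation and inverse arrows in a category\<close>

context category
begin

lemma comp_simps [simp]:
  assumes "f \<in> Arr C" "g \<in> Arr C" "Cod C f = Dom C g"
  shows "g \<cdot> f \<in> Arr C" "Dom C (g \<cdot> f) = Dom C f" "Cod C (g \<cdot> f) = Cod C g"
  using comp_hom[of f "Dom C f" "Cod C f" g "Cod C g"] assms by simp_all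

lemma obj_simps [simp]: "f \<in> Arr C \<Longrightarrow> Dom C f \<in> Obj C" "f \<in> Arr C \<Longrightarrow> Cod C f \<in> Obj C"
  by (simp_all add: dom_closed cod_closed)

lemma idn_simps [simp]:
  assumes "x \<in> Obj C"
  shows "Idn C x \<in> Arr C" "Dom C (Idn C x) = x" "Cod C (Idn C x) = x"
  using idn_hom[OF assms] by simp_all

lemma idn_comp [simp]: "f \<in> Arr C \<Longrightarrow> Cod C f = x \<Longrightarrow> Idn C x \<cdot> f = f"
  using idn_left[of f "Dom C f" x] by simp

lemma comp_idn [simp]: "f \<in> Arr C \<Longrightarrow> Dom C f = x \<Longrightarrow> f \<cdot> Idn C x = f"
  using idn_right[of f x "Cod C f"] by simp

lemma assoc [simp]:
  "f \<in> Arr C \<Longrightarrow> g \<in> Arr C \<Longrightarrow> h \<in> Arr C \<Longrightarrow> Cod C f = Dom C g \<Longrightarrow> Cod C g = Dom C h \<Longrightarrow>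
    (h \<cdot> g) \<cdot> f = h \<cdot> (g \<cdot> f)"
  using comp_assoc by simp

text \<open>The simplifier nests composites to the right, which hides \<open>g \<cdot> f\<close>
  inside \<open>g \<cdot> (f \<cdot> l)\<close>. This is the equation composed with
  \<open>l\<close>, in the nested form that then occurs.\<close>

lemma reassoc:
  assumes "g \<cdot> f = h \<cdot> k" "f \<in> Arr C" "g \<in> Arr C" "Cod C f = Dom C g"
    "h \<in> Arr C" "k \<in> Arr C" "Cod C k = Dom C h" "l \<in> Arr C" "Cod C l = Dom C f" "Cod C l = Dom C k"
  shows "g \<cdot> (f \<cdot> l) = h \<cdot> (k \<cdot> l)"
  using assms by (metis assoc)

lemma reassoc1:
  assumes "g \<cdot> f = h" "f \<in> Arr C" "g \<in> Arr C" "Cod C f = Dom C g" "l \<in> Arr C" "Cod C l = Dom C f"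
  shows "g \<cdot> (f \<cdot> l) = h \<cdot> l"
  using assms by (metis assoc)

lemma inverse_cancel:
  "inverse_arrows C f g \<Longrightarrow> h \<in> Arr C \<Longrightarrow> Cod C h = Dom C f \<Longrightarrow> g \<cdot> (f \<cdot> h) = h"
  by (subst reassoc1[where h = "Idn C (Dom C f)"]) (auto simp: inverse_arrows_def)

lemma inverse_cancel':
  "inverse_arrows C f g \<Longrightarrow> h \<in> Arr C \<Longrightarrow> Cod C h = Dom C g \<Longrightarrow> f \<cdot> (g \<cdot> h) = h"
  by (simp add: inverse_cancel inverse_arrows_sym)

lemma mono_arr: "monomorphism C f \<Longrightarrow> f \<in> Arr C"
  by (simp add: monomorphism_def)

lemma epi_arr: "epimorphism C f \<Longrightarrow> f \<in> Arr C"
  by (simp add: epimorphism_def)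

lemma mono_cancel:
  "monomorphism C f \<Longrightarrow> f \<cdot> g = f \<cdot> h \<Longrightarrow> g \<in> Arr C \<Longrightarrow> h \<in> Arr C \<Longrightarrow> Dom C g = Dom C h \<Longrightarrow>
    Cod C g = Dom C f \<Longrightarrow> Cod C h = Dom C f \<Longrightarrow> g = h"
  by (simp add: monomorphism_def)

lemma epi_cancel:
  "epimorphism C f \<Longrightarrow> g \<cdot> f = h \<cdot> f \<Longrightarrow> g \<in> Arr C \<Longrightarrow> h \<in> Arr C \<Longrightarrow> Cod C g = Cod C h \<Longrightarrow>
    Dom C g = Cod C f \<Longrightarrow> Dom C h = Cod C f \<Longrightarrow> g = h"
  by (simp add: epimorphism_def)

lemma monoI:
  assumes "f \<in> Arr C"
    "\<And>g h. g \<in> Arr C \<Longrightarrow> h \<in> Arr C \<Longrightarrow> Dom C g = Dom C h \<Longrightarrow> Cod C g = Dom C f \<Longrightarrow>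
      Cod C h = Dom C f \<Longrightarrow> f \<cdot> g = f \<cdot> h \<Longrightarrow> g = h"
  shows "monomorphism C f"
  using assms unfolding monomorphism_def by blast

lemma mono_comp:
  assumes "monomorphism C f" "monomorphism C g" "Cod C f = Dom C g"
  shows "monomorphism C (g \<cdot> f)"
proof (rule monoI)
  show "g \<cdot> f \<in> Arr C" using assms by (simp add: mono_arr)
next
  fix h k assume hk: "h \<in> Arr C" "k \<in> Arr C" "Dom C h = Dom C k" "Cod C h = Dom C (g \<cdot> f)"
      "Cod C k = Dom C (g \<cdot> f)" "(g \<cdot> f) \<cdot> h = (g \<cdot> f) \<cdot> k"
  then have "g \<cdot> (f \<cdot> h) = g \<cdot> (f \<cdot> k)" using assms by (simp add: mono_arr)
  then have "f \<cdot> h = f \<cdot> k"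
    by (rule mono_cancel[OF assms(2)]) (use assms hk in \<open>simp_all add: mono_arr\<close>)
  then show "h = k"
    by (rule mono_cancel[OF assms(1)]) (use assms hk in \<open>simp_all add: mono_arr\<close>)
qed

lemma mono_of_comp:
  assumes "monomorphism C (g \<cdot> f)" "f \<in> Arr C" "g \<in> Arr C" "Cod C f = Dom C g"
  shows "monomorphism C f"
proof (rule monoI)
  fix h k assume hk: "h \<in> Arr C" "k \<in> Arr C" "Dom C h = Dom C k" "Cod C h = Dom C f"
      "Cod C k = Dom C f" "f \<cdot> h = f \<cdot> k"
  show "h = k"
    by (rule mono_cancel[OF assms(1)]) (use assms hk in \<open>simp_all\<close>)
qed fact

lemma iso_mono: "inverse_arrows C f g \<Longrightarrow> monomorphism C f"
proof (rule monoI)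
  fix h k assume i: "inverse_arrows C f g" and hk: "h \<in> Arr C" "k \<in> Arr C" "Dom C h = Dom C k"
    "Cod C h = Dom C f" "Cod C k = Dom C f" "f \<cdot> h = f \<cdot> k"
  show "h = k"
    using hk inverse_cancel[OF i] by metis
qed (simp add: inverse_arrows_def)

lemma idn_mono: "x \<in> Obj C \<Longrightarrow> monomorphism C (Idn C x)"
  by (rule monoI) simp_all

lemma inverse_arrows_comp:
  assumes "inverse_arrows C f f'" "inverse_arrows C g g'" "Cod C f = Dom C g"
  shows "inverse_arrows C (g \<cdot> f) (f' \<cdot> g')"
  using assms inverse_cancel[OF assms(1)] inverse_cancel'[OF assms(1)]
    inverse_cancel[OF assms(2)] inverse_cancel'[OF assms(2)]
  by (simp add: inverse_arrows_def)

lemma inverse_arrows_idn: "x \<in> Obj C \<Longrightarrow> inverse_arrows C (Idn C x) (Idn C x)"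
  by (simp add: inverse_arrows_def)

text \<open>Both \<open>f \<cdot> (g \<cdot> f)\<close> and \<open>f \<cdot> Idn C (Dom C f)\<close>
  equal \<open>f\<close>, and the mono \<open>f\<close> cancels.\<close>

lemma mono_split_iso:
  assumes "monomorphism C f" "g \<in> Arr C" "Dom C g = Cod C f" "Cod C g = Dom C f"
    and "f \<cdot> g = Idn C (Cod C f)"
  shows "inverse_arrows C f g"
proof -
  have f: "f \<in> Arr C" using assms(1) by (rule mono_arr)
  have "f \<cdot> (g \<cdot> f) = f \<cdot> Idn C (Dom C f)"
    using reassoc1[OF assms(5), of f] f assms by simp
  then have "g \<cdot> f = Idn C (Dom C f)"
    by (rule mono_cancel[OF assms(1)]) (use f assms in \<open>simp_all\<close>)
  then show ?thesis using f assms by (simp add: inverse_arrows_def)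
qed

lemma isomorphic_iff:
  "isomorphic C x y \<longleftrightarrow> (\<exists>f g. inverse_arrows C f g \<and> Dom C f = x \<and> Cod C f = y)"
proof -
  have "inverse_arrows C f g \<Longrightarrow> f \<in> Arr C" for f g by (simp add: inverse_arrows_def)
  then show ?thesis unfolding isomorphic_def isomorphism_iff homset_def by blast
qed

lemma isomorphicI: "inverse_arrows C f g \<Longrightarrow> isomorphic C (Dom C f) (Cod C f)"
  unfolding isomorphic_iff by blast

lemma isomorphicE:
  assumes "isomorphic C x y"
  obtains f g where "inverse_arrows C f g" "f \<in> Arr C" "g \<in> Arr C" "Dom C f = x" "Cod C f = y"
    "Dom C g = y" "Cod C g = x"
proof -
  obtain f g where "inverse_arrows C f g" "Dom C f = x" "Cod C f = y"
    using assms unfolding isomorphic_iff by blast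
  then show ?thesis using that[of f g] by (simp add: inverse_arrows_def)
qed

lemma isomorphic_trans:
  assumes "isomorphic C x y" "isomorphic C y z"
  shows "isomorphic C x z"
proof -
  obtain f f' where f: "inverse_arrows C f f'" "f \<in> Arr C" "Dom C f = x" "Cod C f = y"
    using isomorphicE[OF assms(1)] by metis
  obtain g g' where g: "inverse_arrows C g g'" "g \<in> Arr C" "Dom C g = y" "Cod C g = z"
    using isomorphicE[OF assms(2)] by metis
  show ?thesis
    using isomorphicI[OF inverse_arrows_comp[OF f(1) g(1)]] f(2-) g(2-) by simp
qed

lemma isomorphic_refl: "x \<in> Obj C \<Longrightarrow> isomorphic C x x"
  using isomorphicI[OF inverse_arrows_idn] by simp

end

lemma category_op: "category C \<Longrightarrow> category (op_cat C)"
proof -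
  assume "category C"
  then interpret category C .
  show ?thesis by unfold_locales simp_all
qed

section \<open>Preadditive categories: zero arrows, differences, kernels and cokernels\<close>

context preadditive_category
begin

lemma cat_op: "category (op_cat C)"
  by (rule category_op) unfold_locales

lemma epiI:
  assumes "f \<in> Arr C"
    "\<And>g h. g \<in> Arr C \<Longrightarrow> h \<in> Arr C \<Longrightarrow> Cod C g = Cod C h \<Longrightarrow> Dom C g = Cod C f \<Longrightarrow>
      Dom C h = Cod C f \<Longrightarrow> g \<cdot> f = h \<cdot> f \<Longrightarrow> g = h"
  shows "epimorphism C f"
  using assms unfolding epimorphism_def by blast

lemma epi_comp: "epimorphism C f \<Longrightarrow> epimorphism C g \<Longrightarrow> Cod C f = Dom C g \<Longrightarrow> epimorphism C (g \<cdot> f)"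
  using category.mono_comp[OF cat_op, of g f] by simp

lemma epi_of_comp:
  "epimorphism C (g \<cdot> f) \<Longrightarrow> f \<in> Arr C \<Longrightarrow> g \<in> Arr C \<Longrightarrow> Cod C f = Dom C g \<Longrightarrow> epimorphism C g"
  using category.mono_of_comp[OF cat_op, of f g] by simp

lemma iso_epi: "inverse_arrows C f g \<Longrightarrow> epimorphism C f"
  using category.iso_mono[OF cat_op, of f g] by (simp add: inverse_arrows_op inverse_arrows_sym)

lemma add_simps [simp]:
  assumes "f \<in> Arr C" "g \<in> Arr C" "Dom C f = Dom C g" "Cod C f = Cod C g"
  shows "Add C f g \<in> Arr C" "Dom C (Add C f g) = Dom C g" "Cod C (Add C f g) = Cod C g"
proof -
  interpret comm_group "hom_group C (Dom C g) (Cod C g)"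
    using assms by (intro hom_comm_group) simp_all
  show "Add C f g \<in> Arr C" "Dom C (Add C f g) = Dom C g" "Cod C (Add C f g) = Cod C g"
    using m_closed[of f g] assms by (simp_all add: hom_group_def)
qed

lemma zer_simps [simp]:
  assumes "x \<in> Obj C" "y \<in> Obj C"
  shows "Zer C x y \<in> Arr C" "Dom C (Zer C x y) = x" "Cod C (Zer C x y) = y"
proof -
  interpret comm_group "hom_group C x y"
    using assms by (intro hom_comm_group) simp_all
  show "Zer C x y \<in> Arr C" "Dom C (Zer C x y) = x" "Cod C (Zer C x y) = y"
    using one_closed by (simp_all add: hom_group_def)
qed

lemma add_zer [simp]:
  assumes "f \<in> Arr C" "Dom C f = x" "Cod C f = y"
  shows "Add C f (Zer C x y) = f" "Add C (Zer C x y) f = f"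
proof -
  interpret comm_group "hom_group C x y"
    using assms by (intro hom_comm_group) auto
  show "Add C f (Zer C x y) = f" "Add C (Zer C x y) f = f"
    using r_one[of f] l_one[of f] assms by (simp_all add: hom_group_def)
qed

lemma add_self_zer:
  assumes "f \<in> Arr C" "Add C f f = f"
  shows "f = Zer C (Dom C f) (Cod C f)"
proof -
  interpret comm_group "hom_group C (Dom C f) (Cod C f)"
    using assms by (intro hom_comm_group) auto
  show ?thesis
    using l_cancel_one[of f f] assms by (simp add: hom_group_def)
qed

lemma comp_add [simp]:
  "f \<in> Arr C \<Longrightarrow> g \<in> Arr C \<Longrightarrow> h \<in> Arr C \<Longrightarrow> Dom C g = Dom C h \<Longrightarrow> Cod C g = Cod C h \<Longrightarrow>
    Cod C g = Dom C f \<Longrightarrow> f \<cdot> Add C g h = Add C (f \<cdot> g) (f \<cdot> h)"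
  using comp_add_right[of g "Dom C g" "Cod C g" h f] by simp

lemma add_comp [simp]:
  "f \<in> Arr C \<Longrightarrow> g \<in> Arr C \<Longrightarrow> h \<in> Arr C \<Longrightarrow> Dom C g = Dom C h \<Longrightarrow> Cod C g = Cod C h \<Longrightarrow>
    Dom C g = Cod C f \<Longrightarrow> Add C g h \<cdot> f = Add C (g \<cdot> f) (h \<cdot> f)"
  using comp_add_left[of f "Dom C f" "Cod C f" g _ h] by simp

lemma zer_comp [simp]:
  assumes "f \<in> Arr C" "Cod C f = y" "z \<in> Obj C"
  shows "Zer C y z \<cdot> f = Zer C (Dom C f) z"
proof -
  have y: "y \<in> Obj C" using assms by auto
  have "Add C (Zer C y z \<cdot> f) (Zer C y z \<cdot> f) = Add C (Zer C y z) (Zer C y z) \<cdot> f"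
    using assms y by (subst add_comp) simp_all
  also have "\<dots> = Zer C y z \<cdot> f" using assms y by (subst add_zer) simp_all
  finally show ?thesis using add_self_zer[of "Zer C y z \<cdot> f"] assms y by simp
qed

lemma comp_zer [simp]:
  assumes "f \<in> Arr C" "Dom C f = y" "x \<in> Obj C"
  shows "f \<cdot> Zer C x y = Zer C x (Cod C f)"
proof -
  have y: "y \<in> Obj C" using assms by auto
  have "Add C (f \<cdot> Zer C x y) (f \<cdot> Zer C x y) = f \<cdot> Add C (Zer C x y) (Zer C x y)"
    using assms y by (subst comp_add) simp_all
  also have "\<dots> = f \<cdot> Zer C x y" using assms y by (subst add_zer) simp_all
  finally show ?thesis using add_self_zer[of "f \<cdot> Zer C x y"] assms y by simp
qed

text \<open>The arrow \<open>d\<close> is f minus g, recorded only through what it kills on either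
  side; this is all that kernel arguments ask of a difference.\<close>

lemma ex_difference:
  assumes "f \<in> Arr C" "g \<in> Arr C" "Dom C f = x" "Dom C g = x" "Cod C f = y" "Cod C g = y"
  obtains d where "d \<in> Arr C" "Dom C d = x" "Cod C d = y"
    "\<And>k. k \<in> Arr C \<Longrightarrow> Cod C k = x \<Longrightarrow> d \<cdot> k = Zer C (Dom C k) y \<longleftrightarrow> f \<cdot> k = g \<cdot> k"
    "\<And>k. k \<in> Arr C \<Longrightarrow> Dom C k = y \<Longrightarrow> k \<cdot> d = Zer C x (Cod C k) \<longleftrightarrow> k \<cdot> f = k \<cdot> g"
proof -
  have xy: "x \<in> Obj C" "y \<in> Obj C" using assms by auto
  interpret G: comm_group "hom_group C x y" using xy by (rule hom_comm_group)
  define n where "n = inv\<^bsub>hom_group C x y\<^esub> g"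
  have n: "n \<in> Arr C" "Dom C n = x" "Cod C n = y" "Add C n g = Zer C x y"
    using G.inv_closed[of g] G.l_inv[of g] assms by (simp_all add: hom_group_def n_def)
  have n': "Add C g n = Zer C x y"
    using G.r_inv[of g] assms by (simp add: hom_group_def n_def)
  \<comment> \<open>Right cancellation in the Hom-group: \<open>r\<close> also has \<open>q\<close>
    as its negative.\<close>
  have key: "Add C p q = Zer C u v \<longleftrightarrow> p = r"
    if "p \<in> Arr C" "q \<in> Arr C" "r \<in> Arr C" "Dom C p = u" "Dom C q = u" "Dom C r = u"
      "Cod C p = v" "Cod C q = v" "Cod C r = v" "Add C r q = Zer C u v" for p q r u v
  proof -
    interpret H: comm_group "hom_group C u v" using that by (intro hom_comm_group) auto
    show ?thesis using H.right_cancel[of q p r] that by (simp add: hom_group_def)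
  qed
  show ?thesis
  proof (rule that[of "Add C f n"])
    fix k assume k: "k \<in> Arr C" "Cod C k = x"
    have "Add C (g \<cdot> k) (n \<cdot> k) = Add C g n \<cdot> k" using k n assms by (subst add_comp) simp_all
    also have "\<dots> = Zer C (Dom C k) y" using k n' xy by simp
    finally show "Add C f n \<cdot> k = Zer C (Dom C k) y \<longleftrightarrow> f \<cdot> k = g \<cdot> k"
      using k n assms by (subst add_comp, simp_all) (rule key, simp_all)
  next
    fix k assume k: "k \<in> Arr C" "Dom C k = y"
    have "Add C (k \<cdot> g) (k \<cdot> n) = k \<cdot> Add C g n" using k n assms by (subst comp_add) simp_all
    also have "\<dots> = Zer C x (Cod C k)" using k n' xy by simp
    finally show "k \<cdot> Add C f n = Zer C x (Cod C k) \<longleftrightarrow> k \<cdot> f = k \<cdot> g"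
      using k n assms by (subst comp_add, simp_all) (rule key, simp_all)
  qed (use n assms in simp_all)
qed

lemma mono_zeroI:
  assumes f: "f \<in> Arr C"
    and 0: "\<And>h. h \<in> Arr C \<Longrightarrow> Cod C h = Dom C f \<Longrightarrow> f \<cdot> h = Zer C (Dom C h) (Cod C f) \<Longrightarrow>
      h = Zer C (Dom C h) (Dom C f)"
  shows "monomorphism C f"
proof (rule monoI)
  fix g h assume gh: "g \<in> Arr C" "h \<in> Arr C" "Dom C g = Dom C h" "Cod C g = Dom C f"
    "Cod C h = Dom C f" "f \<cdot> g = f \<cdot> h"
  obtain d where d: "d \<in> Arr C" "Dom C d = Dom C h" "Cod C d = Dom C f"
    "\<And>k. k \<in> Arr C \<Longrightarrow> Cod C k = Dom C h \<Longrightarrow> d \<cdot> k = Zer C (Dom C k) (Dom C f) \<longleftrightarrow> g \<cdot> k = h \<cdot> k"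
    "\<And>k. k \<in> Arr C \<Longrightarrow> Dom C k = Dom C f \<Longrightarrow> k \<cdot> d = Zer C (Dom C h) (Cod C k) \<longleftrightarrow> k \<cdot> g = k \<cdot> h"
    using ex_difference[of g h "Dom C h" "Dom C f"] gh by metis
  have "f \<cdot> d = Zer C (Dom C h) (Cod C f)" using d(5)[of f] f gh by simp
  then have "d = Zer C (Dom C h) (Dom C f)" using 0[of d] d(1-3) by simp
  then show "g = h" using d(4)[of "Idn C (Dom C h)"] d(1,2) gh by simp
qed (rule f)

lemma kernelD:
  assumes "is_kernel C k f"
  shows "k \<in> Arr C" "f \<in> Arr C" "Cod C k = Dom C f" "f \<cdot> k = Zer C (Dom C k) (Cod C f)"
  using assms by (simp_all add: is_kernel_def)

lemma kernel_factor:
  assumes "is_kernel C k f" "h \<in> Arr C" "Cod C h = Dom C f" "f \<cdot> h = Zer C (Dom C h) (Cod C f)"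
  obtains u where "u \<in> Arr C" "Dom C u = Dom C h" "Cod C u = Dom C k" "k \<cdot> u = h"
proof -
  obtain u where "u \<in> homset C (Dom C h) (Dom C k)" "k \<cdot> u = h"
    using assms unfolding is_kernel_def by metis
  then show ?thesis using that[of u] by simp
qed

lemma kernel_mono:
  assumes "is_kernel C k f"
  shows "monomorphism C k"
proof (rule monoI)
  fix g h assume gh: "g \<in> Arr C" "h \<in> Arr C" "Dom C g = Dom C h" "Cod C g = Dom C k"
    "Cod C h = Dom C k" "k \<cdot> g = k \<cdot> h"
  have univ: "\<forall>h\<in>Arr C. Cod C h = Dom C f \<and> f \<cdot> h = Zer C (Dom C h) (Cod C f) \<longrightarrow>
      (\<exists>!u. u \<in> homset C (Dom C h) (Dom C k) \<and> k \<cdot> u = h)"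
    using assms unfolding is_kernel_def by blast
  have "f \<cdot> (k \<cdot> h) = Zer C (Dom C k) (Cod C f) \<cdot> h"
    using kernelD[OF assms] gh by (intro reassoc1) simp_all
  then have "\<exists>!u. u \<in> homset C (Dom C h) (Dom C k) \<and> k \<cdot> u = k \<cdot> h"
    using bspec[OF univ, of "k \<cdot> h"] gh kernelD[OF assms] by simp
  then show "g = h" using gh by auto
qed (use kernelD[OF assms] in simp)

lemma kernelI:
  assumes "monomorphism C k" "f \<in> Arr C" "Cod C k = Dom C f" "f \<cdot> k = Zer C (Dom C k) (Cod C f)"
    and u: "\<And>h. h \<in> Arr C \<Longrightarrow> Cod C h = Dom C f \<Longrightarrow> f \<cdot> h = Zer C (Dom C h) (Cod C f) \<Longrightarrow>
      \<exists>u\<in>Arr C. Dom C u = Dom C h \<and> Cod C u = Dom C k \<and> k \<cdot> u = h"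
  shows "is_kernel C k f"
  unfolding is_kernel_def
proof (intro conjI ballI impI)
  fix h assume h: "h \<in> Arr C" "Cod C h = Dom C f \<and> f \<cdot> h = Zer C (Dom C h) (Cod C f)"
  then obtain v where v: "v \<in> Arr C" "Dom C v = Dom C h" "Cod C v = Dom C k" "k \<cdot> v = h"
    using u by blast
  show "\<exists>!u. u \<in> homset C (Dom C h) (Dom C k) \<and> k \<cdot> u = h"
  proof (rule ex1I[of _ v])
    fix u assume u: "u \<in> homset C (Dom C h) (Dom C k) \<and> k \<cdot> u = h"
    show "u = v" by (rule mono_cancel[OF assms(1)]) (use u v in simp_all)
  qed (use v in simp)
qed (use assms in \<open>simp_all add: mono_arr\<close>)

text \<open>A kernel can be carried along isomorphisms of its source and of the source of
  \<open>f\<close>, and composing \<open>f\<close> with a mono \<open>b\<close> does not change what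
  is killed. This one lemma moves kernels both into a dense target category and from
  \<open>A\<close> to \<open>C\<close>.\<close>

lemma kernel_transport:
  assumes k: "is_kernel C k f" and a: "inverse_arrows C a a'" and w: "inverse_arrows C w w'"
    and b: "monomorphism C b" and t: "Cod C a = Dom C f" "Cod C w = Dom C k" "Dom C b = Cod C f"
  shows "is_kernel C (a' \<cdot> (k \<cdot> w)) (b \<cdot> (f \<cdot> a))"
proof (rule kernelI)
  note kD = kernelD[OF k]
  have aD: "a \<in> Arr C" "a' \<in> Arr C" "Dom C a' = Cod C a" "Cod C a' = Dom C a"
    and wD: "w \<in> Arr C" "w' \<in> Arr C" "Dom C w' = Cod C w" "Cod C w' = Dom C w"
    using a w by (simp_all add: inverse_arrows_def)
  note bA = mono_arr[OF b]
  note ty = kD(1-3) aD wD bA t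
  have "monomorphism C (k \<cdot> w)"
    using kernel_mono[OF k] iso_mono[OF w] t by (simp add: mono_comp)
  then show "monomorphism C (a' \<cdot> (k \<cdot> w))"
    by (rule mono_comp) (use iso_mono[OF inverse_arrows_sym[OF a]] ty in simp_all)
  show "b \<cdot> (f \<cdot> a) \<in> Arr C" "Cod C (a' \<cdot> (k \<cdot> w)) = Dom C (b \<cdot> (f \<cdot> a))"
    using ty by simp_all
  show "(b \<cdot> (f \<cdot> a)) \<cdot> (a' \<cdot> (k \<cdot> w)) = Zer C (Dom C (a' \<cdot> (k \<cdot> w))) (Cod C (b \<cdot> (f \<cdot> a)))"
    using ty reassoc1[OF kD(4), of w] by (simp add: inverse_cancel'[OF a])
  fix h assume h: "h \<in> Arr C" "Cod C h = Dom C (b \<cdot> (f \<cdot> a))"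
    and 0: "(b \<cdot> (f \<cdot> a)) \<cdot> h = Zer C (Dom C h) (Cod C (b \<cdot> (f \<cdot> a)))"
  have "b \<cdot> (f \<cdot> (a \<cdot> h)) = b \<cdot> Zer C (Dom C h) (Cod C f)"
    using h 0 ty by simp
  then have "f \<cdot> (a \<cdot> h) = Zer C (Dom C h) (Cod C f)"
    by (rule mono_cancel[OF b]) (use h ty in \<open>simp_all\<close>)
  then obtain u where u: "u \<in> Arr C" "Dom C u = Dom C h" "Cod C u = Dom C k" "k \<cdot> u = a \<cdot> h"
    using kernel_factor[OF k, of "a \<cdot> h"] h ty by auto
  show "\<exists>u\<in>Arr C. Dom C u = Dom C h \<and> Cod C u = Dom C (a' \<cdot> (k \<cdot> w)) \<and> (a' \<cdot> (k \<cdot> w)) \<cdot> u = h"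
    using u ty h by (intro bexI[of _ "w' \<cdot> u"]) (simp_all add: inverse_cancel'[OF w] inverse_cancel[OF a])
qed

end

lemma preadditive_category_op:
  assumes "preadditive_category C"
  shows "preadditive_category (op_cat C)"
proof -
  interpret preadditive_category C by fact
  interpret O: category "op_cat C" by (rule cat_op)
  have "hom_group (op_cat C) x y = hom_group C y x" for x y
    by (simp add: hom_group_def homset_op)
  then show ?thesis
    by (intro preadditive_category.intro preadditive_category_axioms.intro O.category_axioms)
      (simp_all add: hom_comm_group)
qed

context preadditive_category
begin

lemma pre_op: "preadditive_category (op_cat C)"
  by (rule preadditive_category_op) unfold_locales

lemma epi_zeroI:
  assumes f: "f \<in> Arr C"
    and 0: "\<And>h. h \<in> Arr C \<Longrightarrow> Dom C h = Cod C f \<Longrightarrow> h \<cdot> f = Zer C (Dom C f) (Cod C h) \<Longrightarrow>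
      h = Zer C (Cod C f) (Cod C h)"
  shows "epimorphism C f"
  using preadditive_category.mono_zeroI[OF pre_op, of f] f 0 by simp

lemma cokernelD:
  assumes "is_cokernel C c f"
  shows "c \<in> Arr C" "f \<in> Arr C" "Dom C c = Cod C f" "c \<cdot> f = Zer C (Dom C f) (Cod C c)"
  using assms by (simp_all add: is_cokernel_def)

lemma cokernel_factor:
  assumes "is_cokernel C c f" "h \<in> Arr C" "Dom C h = Cod C f" "h \<cdot> f = Zer C (Dom C f) (Cod C h)"
  obtains u where "u \<in> Arr C" "Dom C u = Cod C c" "Cod C u = Cod C h" "u \<cdot> c = h"
proof -
  obtain u where "u \<in> homset C (Cod C c) (Cod C h)" "u \<cdot> c = h"
    using assms unfolding is_cokernel_def by metis
  then show ?thesis using that[of u] by simp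
qed

lemma cokernel_epi: "is_cokernel C c f \<Longrightarrow> epimorphism C c"
  using preadditive_category.kernel_mono[OF pre_op, of c f] by simp

lemma cokernelI:
  assumes "epimorphism C c" "f \<in> Arr C" "Dom C c = Cod C f" "c \<cdot> f = Zer C (Dom C f) (Cod C c)"
    and u: "\<And>h. h \<in> Arr C \<Longrightarrow> Dom C h = Cod C f \<Longrightarrow> h \<cdot> f = Zer C (Dom C f) (Cod C h) \<Longrightarrow>
      \<exists>u\<in>Arr C. Dom C u = Cod C c \<and> Cod C u = Cod C h \<and> u \<cdot> c = h"
  shows "is_cokernel C c f"
proof -
  have "\<exists>u\<in>Arr C. Cod C u = Cod C h \<and> Dom C u = Cod C c \<and> u \<cdot> c = h"
    if "h \<in> Arr C" "Dom C h = Cod C f" "h \<cdot> f = Zer C (Dom C f) (Cod C h)" for h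
    using u[OF that] by blast
  then show ?thesis
    using preadditive_category.kernelI[OF pre_op, of c f] assms(1-4) by simp
qed

text \<open>The equational form can be carried over by a functor that respects identities and zero
  arrows.\<close>

lemma zero_object_iff: "z \<in> Obj C \<Longrightarrow> zero_object C z \<longleftrightarrow> Idn C z = Zer C z z"
proof
  assume z: "z \<in> Obj C" and i: "Idn C z = Zer C z z"
  have 1: "f = Zer C z y" if "f \<in> Arr C" "Dom C f = z" "Cod C f = y" for f y
    using that i z comp_idn[of f z] by (metis comp_zer)
  have 2: "f = Zer C y z" if "f \<in> Arr C" "Dom C f = y" "Cod C f = z" for f y
    using that i z idn_comp[of f z] by (metis zer_comp)
  show "zero_object C z"
    unfolding zero_object_def
  proof (intro conjI ballI z)
    fix y assume y: "y \<in> Obj C"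
    show "\<exists>!f. f \<in> homset C z y" using 1 y z by (intro ex1I[of _ "Zer C z y"]) auto
    show "\<exists>!f. f \<in> homset C y z" using 2 y z by (intro ex1I[of _ "Zer C y z"]) auto
  qed
next
  assume "z \<in> Obj C" "zero_object C z"
  then have "\<exists>!f. f \<in> homset C z z" by (auto simp: zero_object_def)
  then show "Idn C z = Zer C z z" using \<open>z \<in> Obj C\<close> by auto
qed

end

lemma additive_category_op:
  assumes "additive_category C"
  shows "additive_category (op_cat C)"
proof -
  interpret additive_category C by fact
  interpret O: preadditive_category "op_cat C" by (rule pre_op)
  have "is_biproduct (op_cat C) x y b p q i j" if "is_biproduct C x y b i j p q" for x y b i j p q
    using that by (simp add: is_biproduct_def homset_op)
  then show ?thesis
    using ex_zero_object ex_biproduct by unfold_locales (simp, metis op_cat_simps(1))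
qed

lemma abelian_category_op:
  assumes "abelian_category C"
  shows "abelian_category (op_cat C)"
proof -
  interpret abelian_category C by fact
  interpret O: additive_category "op_cat C" by (rule additive_category_op) unfold_locales
  show ?thesis
    using ex_kernel ex_cokernel mono_normal epi_normal by unfold_locales simp_all
qed

section \<open>Abelian categories: normality and image factorisation\<close>

context abelian_category
begin

lemma ab_op: "abelian_category (op_cat C)"
  by (rule abelian_category_op) unfold_locales

text \<open>\<open>f\<close> is a kernel of some \<open>g\<close>, and \<open>g\<close> factors
  through the cokernel \<open>c\<close>; whatever \<open>c\<close> kills is therefore killed by
  \<open>g\<close> and factors through \<open>f\<close>.\<close>

lemma mono_kernel_of_cokernel:
  assumes "monomorphism C f" "is_cokernel C c f"
  shows "is_kernel C f c"
proof (rule kernelI)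
  note cD = cokernelD[OF assms(2)]
  fix h assume h: "h \<in> Arr C" "Cod C h = Dom C c" "c \<cdot> h = Zer C (Dom C h) (Cod C c)"
  obtain g where g: "is_kernel C f g" using mono_normal[OF assms(1)] by blast
  note gD = kernelD[OF g]
  obtain t where t: "t \<in> Arr C" "Dom C t = Cod C c" "Cod C t = Cod C g" "t \<cdot> c = g"
    using cokernel_factor[OF assms(2), of g] gD by auto
  have "g \<cdot> h = t \<cdot> (c \<cdot> h)" using t(1-3) h cD unfolding t(4)[symmetric] by simp
  also have "\<dots> = Zer C (Dom C h) (Cod C g)" using t(1-3) h by simp
  finally obtain u where "u \<in> Arr C" "Dom C u = Dom C h" "Cod C u = Dom C f" "f \<cdot> u = h"
    using kernel_factor[OF g, of h] h gD cD by auto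
  then show "\<exists>u\<in>Arr C. Dom C u = Dom C h \<and> Cod C u = Dom C f \<and> f \<cdot> u = h" by auto
qed (use assms cokernelD[OF assms(2)] in auto)

text \<open>If \<open>f\<close> is a kernel of \<open>g\<close>, then \<open>g \<cdot> f\<close> is
  zero, hence so is \<open>g\<close> as \<open>f\<close> is epi. The identity is then killed by
  \<open>g\<close> and factors through \<open>f\<close>, which splits \<open>f\<close>.\<close>

lemma mono_epi_iso:
  assumes "monomorphism C f" "epimorphism C f"
  shows "isomorphism C f"
proof -
  note f = mono_arr[OF assms(1)]
  obtain g where g: "is_kernel C f g" using mono_normal[OF assms(1)] by blast
  note gD = kernelD[OF g]
  have "g \<cdot> f = Zer C (Cod C f) (Cod C g) \<cdot> f" using gD by simp
  then have "g = Zer C (Cod C f) (Cod C g)" by (rule epi_cancel[OF assms(2)]) (use gD in \<open>simp_all\<close>)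
  then have "g \<cdot> Idn C (Cod C f) = Zer C (Cod C f) (Cod C g)" using gD by simp
  then obtain u where "u \<in> Arr C" "Dom C u = Cod C f" "Cod C u = Dom C f" "f \<cdot> u = Idn C (Cod C f)"
    using kernel_factor[OF g, of "Idn C (Cod C f)"] gD by auto
  then show ?thesis using mono_split_iso[OF assms(1)] isomorphism_iff by metis
qed

text \<open>The image is the kernel \<open>m\<close> of the cokernel of \<open>f\<close>. That
  \<open>e\<close> is epi rests on minimality: if \<open>e\<close> factored through a subobject
  \<open>k\<close> of the image, the normal mono \<open>m \<cdot> k\<close> would be a kernel of
  some \<open>t\<close> with \<open>t \<cdot> f\<close> zero, and such a \<open>t\<close> kills
  \<open>m\<close> as well.\<close>

lemma epi_mono_factorization:
  assumes f: "f \<in> Arr C"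
  obtains e m where "epimorphism C e" "monomorphism C m" "Dom C e = Dom C f" "Cod C e = Dom C m"
    "Cod C m = Cod C f" "m \<cdot> e = f"
proof -
  obtain c where c: "is_cokernel C c f" using ex_cokernel[OF f] by blast
  note cD = cokernelD[OF c]
  obtain m where m: "is_kernel C m c" using ex_kernel cD by blast
  note mD = kernelD[OF m]
  obtain e where e: "e \<in> Arr C" "Dom C e = Dom C f" "Cod C e = Dom C m" "m \<cdot> e = f"
    using kernel_factor[OF m, of f] cD mD by auto
  have "epimorphism C e"
  proof (rule epiI)
    fix g h assume gh: "g \<in> Arr C" "h \<in> Arr C" "Cod C g = Cod C h" "Dom C g = Cod C e"
      "Dom C h = Cod C e" "g \<cdot> e = h \<cdot> e"
    obtain d where d: "d \<in> Arr C" "Dom C d = Cod C e" "Cod C d = Cod C h"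
      "\<And>k. k \<in> Arr C \<Longrightarrow> Cod C k = Cod C e \<Longrightarrow> d \<cdot> k = Zer C (Dom C k) (Cod C h) \<longleftrightarrow> g \<cdot> k = h \<cdot> k"
      using ex_difference[of g h "Cod C e" "Cod C h"] gh by metis
    \<comment> \<open>\<open>k\<close> is the equaliser of \<open>g\<close> and \<open>h\<close>;
      the aim is a right inverse of \<open>k\<close>.\<close>
    obtain k where k: "is_kernel C k d" using ex_kernel d(1) by blast
    note kD = kernelD[OF k]
    have "d \<cdot> e = Zer C (Dom C e) (Cod C d)" using d(3) d(4)[of e] gh e by simp
    then obtain e' where e': "e' \<in> Arr C" "Dom C e' = Dom C e" "Cod C e' = Dom C k" "k \<cdot> e' = e"
      using kernel_factor[OF k, of e] e d(2) by auto
    have mk: "monomorphism C (m \<cdot> k)"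
      by (rule mono_comp) (use kernel_mono[OF m] kernel_mono[OF k] kD d e in simp_all)
    obtain t where t: "is_kernel C (m \<cdot> k) t" using mono_normal[OF mk] by blast
    note tD = kernelD[OF t]
    have ty: "m \<in> Arr C" "k \<in> Arr C" "Cod C k = Dom C m" using mD kD d e by simp_all
    have f': "(m \<cdot> k) \<cdot> e' = f" using ty e' e by simp
    have "t \<cdot> f = Zer C (Dom C f) (Cod C t)"
      using reassoc1[OF tD(4), of e'] tD e' ty f' e by simp
    then obtain s where s: "s \<in> Arr C" "Dom C s = Cod C c" "Cod C s = Cod C t" "s \<cdot> c = t"
      using cokernel_factor[OF c, of t] tD ty mD cD by auto
    \<comment> \<open>\<open>t\<close> factors through the cokernel of \<open>f\<close>, so it
      vanishes on \<open>m\<close> and \<open>m\<close> factors back through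
      \<open>m \<cdot> k\<close>.\<close>
    have "t \<cdot> m = s \<cdot> (c \<cdot> m)" using s(1-3) mD unfolding s(4)[symmetric] by simp
    also have "\<dots> = Zer C (Dom C m) (Cod C t)" using s mD by simp
    finally obtain r where r: "r \<in> Arr C" "Dom C r = Dom C m" "Cod C r = Dom C k" "(m \<cdot> k) \<cdot> r = m"
      using kernel_factor[OF t, of m] ty tD by auto
    then have "m \<cdot> (k \<cdot> r) = m \<cdot> Idn C (Dom C m)" using ty by simp
    then have kr: "k \<cdot> r = Idn C (Dom C m)"
      by (rule mono_cancel[OF kernel_mono[OF m]]) (use r ty in \<open>simp_all\<close>)
    have "g \<cdot> k = h \<cdot> k" using d(4)[of k] kD d(2,3) by simp
    then have "g \<cdot> (k \<cdot> r) = h \<cdot> (k \<cdot> r)" using reassoc[of g k h k r] gh r ty e by simp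
    then show "g = h" using kr gh e by simp
  qed (use e in simp)
  then show ?thesis using that[of e m] kernel_mono[OF m] e mD cD by simp
qed

end


section \<open>Fully faithful functors\<close>

locale functor_between = C: category C + D: category D
  for C :: "('o1, 'm1, 'y) cat_scheme" (structure) and D :: "('o2, 'm2, 'z) cat_scheme" (structure) +
  fixes F :: "('o1, 'm1, 'o2, 'm2) fctr"
  assumes is_functor: "is_functor C D F"
begin

lemma obj_closed [simp]: "x \<in> Obj C \<Longrightarrow> FObj F x \<in> Obj D"
  using is_functor by (simp add: is_functor_def)

lemma arr_simps [simp]:
  assumes "f \<in> Arr C"
  shows "FArr F f \<in> Arr D" "Dom D (FArr F f) = FObj F (Dom C f)" "Cod D (FArr F f) = FObj F (Cod C f)"
  using is_functor assms by (simp_all add: is_functor_def)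

lemma arr_idn [simp]: "x \<in> Obj C \<Longrightarrow> FArr F (Idn C x) = Idn D (FObj F x)"
  using is_functor by (simp add: is_functor_def)

lemma arr_comp [simp]:
  "f \<in> Arr C \<Longrightarrow> g \<in> Arr C \<Longrightarrow> Cod C f = Dom C g \<Longrightarrow>
    FArr F (g \<cdot>\<^bsub>C\<^esub> f) = FArr F g \<cdot>\<^bsub>D\<^esub> FArr F f"
  using is_functor by (simp add: is_functor_def)

lemma arr_inverse: "inverse_arrows C f g \<Longrightarrow> inverse_arrows D (FArr F f) (FArr F g)"
  unfolding inverse_arrows_def
  by (metis C.obj_simps arr_comp arr_idn arr_simps)

end

text \<open>The target is only preadditive because it will also be the full subcategory on an
  essential image, whose zero object and biproducts still have to be found.\<close>

locale ff_additive = functor_between C D F + C: additive_category C + D: preadditive_category D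
  for C :: "('o1, 'm1, 'y) addcat_scheme" (structure)
    and D :: "('o2, 'm2, 'z) addcat_scheme" (structure)
    and F :: "('o1, 'm1, 'o2, 'm2) fctr" +
  assumes ff: "fully_faithful C D F"
begin

lemma faithful:
  assumes "FArr F f = FArr F g" "f \<in> Arr C" "g \<in> Arr C" "Dom C f = Dom C g" "Cod C f = Cod C g"
  shows "f = g"
proof -
  have "inj_on (FArr F) (homset C (Dom C g) (Cod C g))"
    using ff assms by (auto simp: fully_faithful_def bij_betw_def)
  then show ?thesis using assms by (auto dest: inj_onD)
qed

lemma full:
  assumes "h \<in> Arr D" "Dom D h = FObj F x" "Cod D h = FObj F y" "x \<in> Obj C" "y \<in> Obj C"
  obtains f where "f \<in> Arr C" "Dom C f = x" "Cod C f = y" "FArr F f = h"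
proof -
  have "FArr F ` homset C x y = homset D (FObj F x) (FObj F y)"
    using ff assms by (auto simp: fully_faithful_def bij_betw_def)
  then have "h \<in> FArr F ` homset C x y" using assms by simp
  then show ?thesis using that by auto
qed

text \<open>Fullness lifts the zero endomorphism of \<open>F z\<close> to an endomorphism of
  \<open>z\<close>, and the only one is the identity.\<close>

lemma zero_obj_idn:
  assumes "zero_object C z"
  shows "Idn D (FObj F z) = Zer D (FObj F z) (FObj F z)"
proof -
  have z: "z \<in> Obj C" using assms by (simp add: zero_object_def)
  obtain t where t: "t \<in> Arr C" "Dom C t = z" "Cod C t = z" "FArr F t = Zer D (FObj F z) (FObj F z)"
    using full[of "Zer D (FObj F z) (FObj F z)" z z] z by auto
  have "t = Idn C z"
  proof -
    have "\<exists>!f. f \<in> homset C z z" using assms z by (simp add: zero_object_def)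
    moreover have "t \<in> homset C z z" "Idn C z \<in> homset C z z" using t z by simp_all
    ultimately show ?thesis by blast
  qed
  then show ?thesis using t(4) z by simp
qed

lemma arr_zer [simp]:
  assumes "x \<in> Obj C" "y \<in> Obj C"
  shows "FArr F (Zer C x y) = Zer D (FObj F x) (FObj F y)"
proof -
  obtain z where z: "zero_object C z" using C.ex_zero_object by blast
  then have zO: "z \<in> Obj C" by (simp add: zero_object_def)
  have 0: "FArr F (Zer C z y) = Zer D (FObj F z) (FObj F y)"
    using D.comp_idn[of "FArr F (Zer C z y)" "FObj F z"] assms zO
    by (simp add: zero_obj_idn[OF z])
  have "Zer C x y = Zer C z y \<cdot> Zer C x z" using assms zO by simp
  then have "FArr F (Zer C x y) = FArr F (Zer C z y) \<cdot>\<^bsub>D\<^esub> FArr F (Zer C x z)"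
    using assms zO arr_comp[of "Zer C x z" "Zer C z y"] by simp
  then show ?thesis using 0 assms zO by simp
qed

text \<open>
  The sum of parallel arrows is the composite \<open>(f p + g q) (i + j)\<close> through a biproduct of the
  source with itself, and \<open>F\<close> preserves \<open>i + j\<close> because the latter is determined by its two projections.
\<close>

lemma arr_add [simp]:
  assumes fg: "f \<in> Arr C" "g \<in> Arr C" "Dom C f = Dom C g" "Cod C f = Cod C g"
  shows "FArr F (Add C f g) = Add D (FArr F f) (FArr F g)"
proof -
  let ?x = "Dom C g"
  have x: "?x \<in> Obj C" using fg by simp
  obtain b i j p q where "is_biproduct C ?x ?x b i j p q" using C.ex_biproduct[OF x x] by blast
  then have b: "b \<in> Obj C" "i \<in> Arr C" "Dom C i = ?x" "Cod C i = b" "j \<in> Arr C" "Dom C j = ?x"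
    "Cod C j = b" "p \<in> Arr C" "Dom C p = b" "Cod C p = ?x" "q \<in> Arr C" "Dom C q = b" "Cod C q = ?x"
    and pi: "p \<cdot> i = Idn C ?x" and qj: "q \<cdot> j = Idn C ?x"
    and qi: "q \<cdot> i = Zer C ?x ?x" and pj: "p \<cdot> j = Zer C ?x ?x"
    and id: "Add C (i \<cdot> p) (j \<cdot> q) = Idn C b"
    by (simp_all add: is_biproduct_def)
  have eq: "r = s" if rs: "r \<in> Arr C" "s \<in> Arr C" "Dom C r = y" "Dom C s = y" "Cod C r = b" "Cod C s = b"
    and e: "p \<cdot> r = p \<cdot> s" "q \<cdot> r = q \<cdot> s" for r s y
  proof -
    have "r = Add C (i \<cdot> p) (j \<cdot> q) \<cdot> r" using rs id by simp
    also have "\<dots> = Add C (i \<cdot> (p \<cdot> r)) (j \<cdot> (q \<cdot> r))" using rs b by (subst C.add_comp) simp_all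
    also have "\<dots> = Add C (i \<cdot> p) (j \<cdot> q) \<cdot> s" using rs b e by (subst C.add_comp) simp_all
    also have "\<dots> = s" using rs id by simp
    finally show ?thesis .
  qed
  let ?w = "Add D (FArr F i) (FArr F j)"
  obtain r where r: "r \<in> Arr C" "Dom C r = ?x" "Cod C r = b" "FArr F r = ?w"
    using full[of ?w ?x b] b x by auto
  have Fpi: "FArr F p \<cdot>\<^bsub>D\<^esub> FArr F i = Idn D (FObj F ?x)" "FArr F q \<cdot>\<^bsub>D\<^esub> FArr F j = Idn D (FObj F ?x)"
    "FArr F q \<cdot>\<^bsub>D\<^esub> FArr F i = Zer D (FObj F ?x) (FObj F ?x)"
    "FArr F p \<cdot>\<^bsub>D\<^esub> FArr F j = Zer D (FObj F ?x) (FObj F ?x)"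
    using arr_comp[of i p] arr_comp[of j q] arr_comp[of i q] arr_comp[of j p] pi qj qi pj b x by simp_all
  have pr: "p \<cdot> r = Idn C ?x"
  proof (rule faithful)
    have "FArr F (p \<cdot> r) = FArr F p \<cdot>\<^bsub>D\<^esub> ?w" using r b by simp
    also have "\<dots> = Idn D (FObj F ?x)" using b x Fpi by (subst D.comp_add) simp_all
    finally show "FArr F (p \<cdot> r) = FArr F (Idn C ?x)" using x by simp
  qed (use b r x in simp_all)
  have qr: "q \<cdot> r = Idn C ?x"
  proof (rule faithful)
    have "FArr F (q \<cdot> r) = FArr F q \<cdot>\<^bsub>D\<^esub> ?w" using r b by simp
    also have "\<dots> = Idn D (FObj F ?x)" using b x Fpi by (subst D.comp_add) simp_all
    finally show "FArr F (q \<cdot> r) = FArr F (Idn C ?x)" using x by simp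
  qed (use b r x in simp_all)
  have ij: "r = Add C i j"
  proof (rule eq)
    have "p \<cdot> Add C i j = Idn C ?x" using b x pi pj by (subst C.comp_add) simp_all
    then show "p \<cdot> r = p \<cdot> Add C i j" using pr by simp
    have "q \<cdot> Add C i j = Idn C ?x" using b x qi qj by (subst C.comp_add) simp_all
    then show "q \<cdot> r = q \<cdot> Add C i j" using qr by simp
  qed (use b r in simp_all)
  let ?t = "Add C (f \<cdot> p) (g \<cdot> q)"
  have t: "?t \<in> Arr C" "Dom C ?t = b" "Cod C ?t = Cod C g" using b fg by simp_all
  have ti: "?t \<cdot> i = f" using b fg x by (subst C.add_comp) (simp_all add: pi qi)
  have tj: "?t \<cdot> j = g" using b fg x by (subst C.add_comp) (simp_all add: pj qj)
  have "Add C f g = ?t \<cdot> Add C i j" using t b ti tj by (subst C.comp_add) simp_all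
  then have "FArr F (Add C f g) = FArr F ?t \<cdot>\<^bsub>D\<^esub> ?w" using r ij t by simp
  also have "\<dots> = Add D (FArr F ?t \<cdot>\<^bsub>D\<^esub> FArr F i) (FArr F ?t \<cdot>\<^bsub>D\<^esub> FArr F j)"
    using t b by (subst D.comp_add) simp_all
  also have "\<dots> = Add D (FArr F f) (FArr F g)"
    using arr_comp[of i ?t] arr_comp[of j ?t] t b ti tj by simp
  finally show ?thesis .
qed

lemma additive: "additive_functor C D F"
  by (simp add: additive_functor_def is_functor)

text \<open>The factorisation found in \<open>D\<close> joins objects coming from \<open>C\<close>,
  so fullness lifts it; all equations come back by faithfulness.\<close>

lemma reflects_kernel:
  assumes k: "is_kernel D (FArr F k) (FArr F f)" and ty: "k \<in> Arr C" "f \<in> Arr C" "Cod C k = Dom C f"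
  shows "is_kernel C k f"
proof (rule C.kernelI)
  show "monomorphism C k"
  proof (rule C.monoI)
    fix g h assume gh: "g \<in> Arr C" "h \<in> Arr C" "Dom C g = Dom C h" "Cod C g = Dom C k"
      "Cod C h = Dom C k" "k \<cdot> g = k \<cdot> h"
    have "FArr F k \<cdot>\<^bsub>D\<^esub> FArr F g = FArr F k \<cdot>\<^bsub>D\<^esub> FArr F h"
      using gh ty arr_comp[of g k] arr_comp[of h k] by simp
    then have "FArr F g = FArr F h"
      by (rule D.mono_cancel[OF D.kernel_mono[OF k]]) (use gh ty in simp_all)
    then show "g = h" by (rule faithful) (use gh in simp_all)
  qed fact
  show "f \<cdot> k = Zer C (Dom C k) (Cod C f)"
    by (rule faithful) (use D.kernelD[OF k] ty in simp_all)
  fix h assume h: "h \<in> Arr C" "Cod C h = Dom C f" "f \<cdot> h = Zer C (Dom C h) (Cod C f)"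
  have "FArr F f \<cdot>\<^bsub>D\<^esub> FArr F h = Zer D (FObj F (Dom C h)) (FObj F (Cod C f))"
    using h ty arr_comp[of h f] by simp
  then obtain u where u: "u \<in> Arr D" "Dom D u = FObj F (Dom C h)" "Cod D u = FObj F (Dom C k)"
    "FArr F k \<cdot>\<^bsub>D\<^esub> u = FArr F h"
    using D.kernel_factor[OF k, of "FArr F h"] h ty by auto
  obtain v where v: "v \<in> Arr C" "Dom C v = Dom C h" "Cod C v = Dom C k" "FArr F v = u"
    using full[of u "Dom C h" "Dom C k"] u h ty by auto
  have "k \<cdot> v = h" by (rule faithful) (use u v h ty in simp_all)
  then show "\<exists>u\<in>Arr C. Dom C u = Dom C h \<and> Cod C u = Dom C k \<and> k \<cdot> u = h" using v by blast
qed (use ty in simp_all)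

end

lemma fully_faithful_op: "fully_faithful (op_cat C) (op_cat D) F \<longleftrightarrow> fully_faithful C D F"
  by (auto simp: fully_faithful_def homset_op)

context ff_additive
begin

lemma op: "ff_additive (op_cat C) (op_cat D) F"
  by (intro ff_additive.intro functor_between.intro additive_category_op C.pre_op D.pre_op C.cat_op D.cat_op
      functor_between_axioms.intro ff_additive_axioms.intro)
    (unfold_locales, simp_all add: is_functor_op is_functor fully_faithful_op ff)

lemma reflects_cokernel:
  "is_cokernel D (FArr F c) (FArr F f) \<Longrightarrow> c \<in> Arr C \<Longrightarrow> f \<in> Arr C \<Longrightarrow> Dom C c = Cod C f \<Longrightarrow>
    is_cokernel C c f"
  using ff_additive.reflects_kernel[OF op, of c f] by simp

lemma reflects_short_exact: "reflects_short_exact C D F"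
  by (simp add: reflects_short_exact_def short_exact_def reflects_kernel reflects_cokernel)

end

section \<open>Transport of abelian structure along a fully faithful dense functor\<close>

locale ff_dense = ff_additive +
  assumes dense: "y \<in> Obj D \<Longrightarrow> \<exists>x\<in>Obj C. isomorphic D (FObj F x) y"
begin

lemma dense_iso:
  assumes "y \<in> Obj D"
  obtains x a a' where "x \<in> Obj C" "inverse_arrows D a a'" "a \<in> Arr D" "a' \<in> Arr D"
    "Dom D a = FObj F x" "Cod D a = y" "Dom D a' = y" "Cod D a' = FObj F x"
  using dense[OF assms] D.isomorphicE by metis

text \<open>Biproducts are given by equations, which \<open>F\<close> respects; conjugating with the
  isomorphisms \<open>a\<close> and \<open>b\<close> moves the biproduct from \<open>F x\<close> and
  \<open>F y\<close> to the given objects.\<close>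

lemma additive_target: "additive_category D"
proof unfold_locales
  obtain z where z: "zero_object C z" using C.ex_zero_object by blast
  then have "z \<in> Obj C" by (simp add: zero_object_def)
  then have "zero_object D (FObj F z)" by (simp add: D.zero_object_iff zero_obj_idn[OF z])
  then show "\<exists>z. zero_object D z" by blast
next
  fix x' y' assume x': "x' \<in> Obj D" and y': "y' \<in> Obj D"
  obtain x a a' where a: "x \<in> Obj C" "inverse_arrows D a a'" "a \<in> Arr D" "a' \<in> Arr D"
    "Dom D a = FObj F x" "Cod D a = x'" "Dom D a' = x'" "Cod D a' = FObj F x"
    using dense_iso[OF x'] .
  obtain y b b' where b: "y \<in> Obj C" "inverse_arrows D b b'" "b \<in> Arr D" "b' \<in> Arr D"
    "Dom D b = FObj F y" "Cod D b = y'" "Dom D b' = y'" "Cod D b' = FObj F y"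
    using dense_iso[OF y'] .
  obtain w i j p q where bp: "is_biproduct C x y w i j p q" using C.ex_biproduct a(1) b(1) by blast
  have ty: "w \<in> Obj C" "i \<in> Arr C" "Dom C i = x" "Cod C i = w" "j \<in> Arr C" "Dom C j = y" "Cod C j = w"
    "p \<in> Arr C" "Dom C p = w" "Cod C p = x" "q \<in> Arr C" "Dom C q = w" "Cod C q = y"
    using bp by (simp_all add: is_biproduct_def)
  have eqs: "p \<cdot> i = Idn C x" "q \<cdot> j = Idn C y" "q \<cdot> i = Zer C x y" "p \<cdot> j = Zer C y x"
    "Add C (i \<cdot> p) (j \<cdot> q) = Idn C w"
    using bp by (simp_all add: is_biproduct_def)
  have Fe: "FArr F p \<cdot>\<^bsub>D\<^esub> FArr F i = Idn D (FObj F x)" "FArr F q \<cdot>\<^bsub>D\<^esub> FArr F j = Idn D (FObj F y)"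
    "FArr F q \<cdot>\<^bsub>D\<^esub> FArr F i = Zer D (FObj F x) (FObj F y)"
    "FArr F p \<cdot>\<^bsub>D\<^esub> FArr F j = Zer D (FObj F y) (FObj F x)"
    "Add D (FArr F i \<cdot>\<^bsub>D\<^esub> FArr F p) (FArr F j \<cdot>\<^bsub>D\<^esub> FArr F q) = Idn D (FObj F w)"
    using eqs[THEN arg_cong, of "FArr F"] ty a(1) b(1) by simp_all
  note re = D.reassoc1[OF Fe(1)] D.reassoc1[OF Fe(2)] D.reassoc1[OF Fe(3)] D.reassoc1[OF Fe(4)]
    D.inverse_cancel[OF a(2)] D.inverse_cancel[OF b(2)]
  have "is_biproduct D x' y' (FObj F w) (FArr F i \<cdot>\<^bsub>D\<^esub> a') (FArr F j \<cdot>\<^bsub>D\<^esub> b') (a \<cdot>\<^bsub>D\<^esub> FArr F p) (b \<cdot>\<^bsub>D\<^esub> FArr F q)"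
    unfolding is_biproduct_def
    using ty a(1,3-) b(1,3-) x' y' a(2)[unfolded inverse_arrows_def] b(2)[unfolded inverse_arrows_def]
    by (simp add: re Fe)
  then show "\<exists>b i j p q. is_biproduct D x' y' b i j p q" by blast
qed

text \<open>Conjugation by isomorphisms at both ends turns an arrow of \<open>D\<close> into one
  between objects in the image, and fullness lifts that one. No quasi-inverse functor has to be
  chosen.\<close>

lemma arr_rep:
  assumes f: "f \<in> Arr D"
  obtains u a a' b b' where "u \<in> Arr C" "inverse_arrows D a a'" "a \<in> Arr D" "a' \<in> Arr D"
    "Dom D a = FObj F (Dom C u)" "Cod D a = Dom D f" "Dom D a' = Dom D f" "Cod D a' = FObj F (Dom C u)"
    "inverse_arrows D b b'" "b \<in> Arr D" "b' \<in> Arr D"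
    "Dom D b = FObj F (Cod C u)" "Cod D b = Cod D f" "Dom D b' = Cod D f" "Cod D b' = FObj F (Cod C u)"
    "b \<cdot>\<^bsub>D\<^esub> (FArr F u \<cdot>\<^bsub>D\<^esub> a') = f"
proof -
  obtain x a a' where a: "x \<in> Obj C" "inverse_arrows D a a'" "a \<in> Arr D" "a' \<in> Arr D"
    "Dom D a = FObj F x" "Cod D a = Dom D f" "Dom D a' = Dom D f" "Cod D a' = FObj F x"
    using dense_iso[OF D.obj_simps(1)[OF f]] .
  obtain y b b' where b: "y \<in> Obj C" "inverse_arrows D b b'" "b \<in> Arr D" "b' \<in> Arr D"
    "Dom D b = FObj F y" "Cod D b = Cod D f" "Dom D b' = Cod D f" "Cod D b' = FObj F y"
    using dense_iso[OF D.obj_simps(2)[OF f]] .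
  obtain u where u: "u \<in> Arr C" "Dom C u = x" "Cod C u = y" "FArr F u = b' \<cdot>\<^bsub>D\<^esub> (f \<cdot>\<^bsub>D\<^esub> a)"
    using full[of "b' \<cdot>\<^bsub>D\<^esub> (f \<cdot>\<^bsub>D\<^esub> a)" x y] a b f by auto
  have "a \<cdot>\<^bsub>D\<^esub> a' = Idn D (Dom D f)" using a(2,6) by (simp add: inverse_arrows_def)
  then have "b \<cdot>\<^bsub>D\<^esub> (FArr F u \<cdot>\<^bsub>D\<^esub> a') = f"
    using a b f unfolding u(4) by (simp add: D.inverse_cancel'[OF b(2)])
  then show ?thesis using that[OF u(1) a(2-4) _ a(6,7) _ b(2-4)] a b u by simp
qed

text \<open>A test arrow may start anywhere in \<open>D\<close>; composing it with an isomorphism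
  \<open>s\<close> from some \<open>F w\<close> makes it liftable to \<open>C\<close>, and
  \<open>s\<close> is cancelled at the end.\<close>

lemma preserves_mono:
  assumes "monomorphism C u"
  shows "monomorphism D (FArr F u)"
proof (rule D.mono_zeroI)
  note uA = C.mono_arr[OF assms]
  fix h assume h: "h \<in> Arr D" "Cod D h = Dom D (FArr F u)"
    "FArr F u \<cdot>\<^bsub>D\<^esub> h = Zer D (Dom D h) (Cod D (FArr F u))"
  obtain w s s' where s: "w \<in> Obj C" "inverse_arrows D s s'" "s \<in> Arr D" "s' \<in> Arr D"
    "Dom D s = FObj F w" "Cod D s = Dom D h" "Dom D s' = Dom D h" "Cod D s' = FObj F w"
    using dense_iso[OF D.obj_simps(1)[OF h(1)]] .
  obtain v where v: "v \<in> Arr C" "Dom C v = w" "Cod C v = Dom C u" "FArr F v = h \<cdot>\<^bsub>D\<^esub> s"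
    using full[of "h \<cdot>\<^bsub>D\<^esub> s" w "Dom C u"] s h uA by auto
  have "u \<cdot> v = u \<cdot> Zer C w (Dom C u)"
    by (rule faithful) (use D.reassoc1[OF h(3), of s] v h s uA in simp_all)
  then have "v = Zer C w (Dom C u)" by (rule C.mono_cancel[OF assms]) (use v uA s in simp_all)
  then have "h \<cdot>\<^bsub>D\<^esub> s = Zer D (Dom D h) (FObj F (Dom C u)) \<cdot>\<^bsub>D\<^esub> s" using v s uA h by simp
  then have "h = Zer D (Dom D h) (FObj F (Dom C u))"
    by (rule D.epi_cancel[OF D.iso_epi[OF s(2)]]) (use h s uA in simp_all)
  then show "h = Zer D (Dom D h) (Dom D (FArr F u))" using uA by simp
qed (use C.mono_arr[OF assms] in simp)

lemma preserves_kernel: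
  assumes "is_kernel C k u"
  shows "is_kernel D (FArr F k) (FArr F u)"
proof (rule D.kernelI)
  note kD = C.kernelD[OF assms]
  show "monomorphism D (FArr F k)" using preserves_mono C.kernel_mono[OF assms] .
  show "FArr F u \<cdot>\<^bsub>D\<^esub> FArr F k = Zer D (Dom D (FArr F k)) (Cod D (FArr F u))"
    using arr_comp[of k u] kD by simp
  fix h assume h: "h \<in> Arr D" "Cod D h = Dom D (FArr F u)"
    "FArr F u \<cdot>\<^bsub>D\<^esub> h = Zer D (Dom D h) (Cod D (FArr F u))"
  obtain w s s' where s: "w \<in> Obj C" "inverse_arrows D s s'" "s \<in> Arr D" "s' \<in> Arr D"
    "Dom D s = FObj F w" "Cod D s = Dom D h" "Dom D s' = Dom D h" "Cod D s' = FObj F w"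
    using dense_iso[OF D.obj_simps(1)[OF h(1)]] .
  obtain v where v: "v \<in> Arr C" "Dom C v = w" "Cod C v = Dom C u" "FArr F v = h \<cdot>\<^bsub>D\<^esub> s"
    using full[of "h \<cdot>\<^bsub>D\<^esub> s" w "Dom C u"] s h kD by auto
  have "u \<cdot> v = Zer C w (Cod C u)"
    by (rule faithful) (use D.reassoc1[OF h(3), of s] v h s kD in simp_all)
  then obtain t where t: "t \<in> Arr C" "Dom C t = w" "Cod C t = Dom C k" "k \<cdot> t = v"
    using C.kernel_factor[OF assms, of v] v by auto
  have "FArr F k \<cdot>\<^bsub>D\<^esub> FArr F t = h \<cdot>\<^bsub>D\<^esub> s" using arr_comp[of t k] t v kD by simp
  from D.reassoc[OF this, of s'] have "FArr F k \<cdot>\<^bsub>D\<^esub> (FArr F t \<cdot>\<^bsub>D\<^esub> s') = h"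
    using t kD s h s(2)[unfolded inverse_arrows_def] by simp
  then show "\<exists>u\<in>Arr D. Dom D u = Dom D h \<and> Cod D u = Dom D (FArr F k) \<and> FArr F k \<cdot>\<^bsub>D\<^esub> u = h"
    using t kD s by (intro bexI[of _ "FArr F t \<cdot>\<^bsub>D\<^esub> s'"]) simp_all
qed (use C.kernelD[OF assms] in simp_all)

lemma ex_kernel_target:
  assumes "abelian_category C" "f \<in> Arr D"
  shows "\<exists>k. is_kernel D k f"
proof -
  interpret C: abelian_category C by fact
  obtain u a a' b b' where *: "u \<in> Arr C" "inverse_arrows D a a'" "a \<in> Arr D" "a' \<in> Arr D"
    "Dom D a = FObj F (Dom C u)" "Cod D a = Dom D f" "Dom D a' = Dom D f" "Cod D a' = FObj F (Dom C u)"
    "inverse_arrows D b b'" "b \<in> Arr D" "b' \<in> Arr D"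
    "Dom D b = FObj F (Cod C u)" "Cod D b = Cod D f" "Dom D b' = Cod D f" "Cod D b' = FObj F (Cod C u)"
    "b \<cdot>\<^bsub>D\<^esub> (FArr F u \<cdot>\<^bsub>D\<^esub> a') = f"
    using arr_rep[OF assms(2)] .
  obtain k where k: "is_kernel C k u" using C.ex_kernel *(1) by blast
  note kD = C.kernelD[OF k]
  have "is_kernel D (a \<cdot>\<^bsub>D\<^esub> (FArr F k \<cdot>\<^bsub>D\<^esub> Idn D (FObj F (Dom C k)))) (b \<cdot>\<^bsub>D\<^esub> (FArr F u \<cdot>\<^bsub>D\<^esub> a'))"
    by (rule D.kernel_transport[OF preserves_kernel[OF k] inverse_arrows_sym[OF *(2)]
          D.inverse_arrows_idn D.iso_mono[OF *(9)]]) (use * kD in simp_all)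
  then show ?thesis using *(16) by auto
qed

text \<open>Up to isomorphisms \<open>f\<close> is \<open>F u\<close>. Faithfulness makes
  \<open>u\<close> mono, so \<open>u\<close> is a kernel in \<open>C\<close>, and this kernel is
  carried to \<open>D\<close> and conjugated back.\<close>

lemma mono_normal_target:
  assumes "abelian_category C" "monomorphism D f"
  shows "\<exists>g. is_kernel D f g"
proof -
  interpret C: abelian_category C by fact
  note fA = D.mono_arr[OF assms(2)]
  obtain u a a' b b' where *: "u \<in> Arr C" "inverse_arrows D a a'" "a \<in> Arr D" "a' \<in> Arr D"
    "Dom D a = FObj F (Dom C u)" "Cod D a = Dom D f" "Dom D a' = Dom D f" "Cod D a' = FObj F (Dom C u)"
    "inverse_arrows D b b'" "b \<in> Arr D" "b' \<in> Arr D"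
    "Dom D b = FObj F (Cod C u)" "Cod D b = Cod D f" "Dom D b' = Cod D f" "Cod D b' = FObj F (Cod C u)"
    "b \<cdot>\<^bsub>D\<^esub> (FArr F u \<cdot>\<^bsub>D\<^esub> a') = f"
    using arr_rep[OF fA] .
  have fa: "f \<cdot>\<^bsub>D\<^esub> a = b \<cdot>\<^bsub>D\<^esub> FArr F u"
  proof -
    have "a' \<cdot>\<^bsub>D\<^esub> a = Idn D (FObj F (Dom C u))" using *(2,5) by (simp add: inverse_arrows_def)
    then show ?thesis unfolding *(16)[symmetric] using *(1,3,4,6,7,8,10,12) *(5) by simp
  qed
  have "monomorphism C u"
  proof (rule C.monoI)
    fix g h assume gh: "g \<in> Arr C" "h \<in> Arr C" "Dom C g = Dom C h" "Cod C g = Dom C u"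
      "Cod C h = Dom C u" "u \<cdot> g = u \<cdot> h"
    have "monomorphism D (f \<cdot>\<^bsub>D\<^esub> a)"
      using assms(2) D.iso_mono[OF *(2)] * by (simp add: D.mono_comp)
    moreover have "(f \<cdot>\<^bsub>D\<^esub> a) \<cdot>\<^bsub>D\<^esub> FArr F g = (f \<cdot>\<^bsub>D\<^esub> a) \<cdot>\<^bsub>D\<^esub> FArr F h"
      using arr_comp[of g u] arr_comp[of h u] gh * unfolding fa by simp
    ultimately have "FArr F g = FArr F h" by (rule D.mono_cancel) (use gh * fA in simp_all)
    then show "g = h" by (rule faithful) (use gh in simp_all)
  qed fact
  then obtain v where v: "is_kernel C u v" using C.mono_normal by blast
  note vD = C.kernelD[OF v]
  have "is_kernel D (b \<cdot>\<^bsub>D\<^esub> (FArr F u \<cdot>\<^bsub>D\<^esub> a')) (Idn D (FObj F (Cod C v)) \<cdot>\<^bsub>D\<^esub> (FArr F v \<cdot>\<^bsub>D\<^esub> b'))"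
    by (rule D.kernel_transport[OF preserves_kernel[OF v] inverse_arrows_sym[OF *(9)]
          inverse_arrows_sym[OF *(2)] D.idn_mono]) (use * vD in simp_all)
  then show ?thesis unfolding *(16) by blast
qed

lemma isomorphic_op: "isomorphic (op_cat D) x y \<longleftrightarrow> isomorphic D x y"
proof -
  interpret O: category "op_cat D" by (rule D.cat_op)
  show ?thesis unfolding D.isomorphic_iff O.isomorphic_iff inverse_arrows_op
    by (metis inverse_arrows_def op_cat_simps(3,4))
qed

lemma op_dense: "ff_dense (op_cat C) (op_cat D) F"
  using dense by (intro ff_dense.intro op ff_dense_axioms.intro) (simp add: isomorphic_op)

lemma abelian_target:
  assumes C: "abelian_category C"
  shows "abelian_category D"
proof -
  interpret D: additive_category D by (rule additive_target)
  interpret O: ff_dense "op_cat C" "op_cat D" F by (rule op_dense)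
  have o: "abelian_category (op_cat C)" by (rule abelian_category_op[OF C])
  show ?thesis
    using ex_kernel_target[OF C] O.ex_kernel_target[OF o] mono_normal_target[OF C]
      O.mono_normal_target[OF o]
    by unfold_locales simp_all
qed

end


section \<open>Full subcategories\<close>

lemma full_subcat_simps [simp]:
  "Obj (full_subcat C S) = S" "Arr (full_subcat C S) = {f \<in> Arr C. Dom C f \<in> S \<and> Cod C f \<in> S}"
  "Dom (full_subcat C S) = Dom C" "Cod (full_subcat C S) = Cod C" "Idn (full_subcat C S) = Idn C"
  "g \<cdot>\<^bsub>full_subcat C S\<^esub> f = g \<cdot>\<^bsub>C\<^esub> f"
  by (simp_all add: full_subcat_def)

lemma full_subcat_add_simps [simp]:
  "Add (full_subcat C S) = Add C" "Zer (full_subcat C S) = Zer C"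
  by (simp_all add: full_subcat_def)

lemma homset_full_subcat: "x \<in> S \<Longrightarrow> y \<in> S \<Longrightarrow> homset (full_subcat C S) x y = homset C x y"
  by auto

lemma full_subcat_full_subcat: "S \<subseteq> A \<Longrightarrow> full_subcat (full_subcat C A) S = full_subcat C S"
proof -
  assume "S \<subseteq> A"
  then have "(Dom C f \<in> A \<and> Cod C f \<in> A \<and> Dom C f \<in> S \<and> Cod C f \<in> S) \<longleftrightarrow>
      Dom C f \<in> S \<and> Cod C f \<in> S" for f by auto
  then show ?thesis by (simp add: full_subcat_def)
qed

lemma (in category) category_full_subcat: "S \<subseteq> Obj C \<Longrightarrow> category (full_subcat C S)"
  by unfold_locales auto

lemma (in preadditive_category) preadditive_full_subcat:
  assumes "S \<subseteq> Obj C"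
  shows "preadditive_category (full_subcat C S)"
proof -
  have "hom_group (full_subcat C S) x y = hom_group C x y" if "x \<in> S" "y \<in> S" for x y
    unfolding hom_group_def using homset_full_subcat[OF that] by simp
  then show ?thesis
    using assms
    by (intro preadditive_category.intro preadditive_category_axioms.intro category_full_subcat)
      (simp_all add: hom_comm_group subsetD[OF assms])
qed

lemma inverse_arrows_full_subcat:
  "inverse_arrows (full_subcat C S) f g \<longleftrightarrow>
    inverse_arrows C f g \<and> Dom C f \<in> S \<and> Cod C f \<in> S"
  by (auto simp: inverse_arrows_def)

lemma (in category) isomorphic_full_subcat:
  assumes "S \<subseteq> Obj C"
  shows "isomorphic (full_subcat C S) x y \<longleftrightarrow> x \<in> S \<and> y \<in> S \<and> isomorphic C x y"
proof -
  interpret S: category "full_subcat C S" by (rule category_full_subcat[OF assms])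
  show ?thesis unfolding S.isomorphic_iff isomorphic_iff inverse_arrows_full_subcat by auto
qed

text \<open>The universal property is only tested on fewer objects, with the same Hom-sets.\<close>

lemma kernel_full_subcat:
  assumes "is_kernel C k f" "Dom C k \<in> S" "Dom C f \<in> S" "Cod C f \<in> S"
  shows "is_kernel (full_subcat C S) k f"
  using assms unfolding is_kernel_def
  by (simp add: homset_full_subcat del: in_homset)

lemma cokernel_full_subcat:
  assumes "is_cokernel C c f" "Cod C c \<in> S" "Dom C f \<in> S" "Cod C f \<in> S"
  shows "is_cokernel (full_subcat C S) c f"
  using assms unfolding is_cokernel_def
  by (simp add: homset_full_subcat del: in_homset)

lemma short_exact_full_subcat:
  assumes "short_exact C f g" "Dom C f \<in> S" "Cod C f \<in> S" "Cod C g \<in> S"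
  shows "short_exact (full_subcat C S) f g"
proof -
  have "Cod C f = Dom C g" using assms(1) by (simp add: short_exact_def is_kernel_def)
  then show ?thesis
    using assms by (auto simp: short_exact_def intro!: kernel_full_subcat cokernel_full_subcat)
qed

section \<open>Essential images\<close>

lemma (in functor_between) essential_image_obj: "x \<in> Obj C \<Longrightarrow> FObj F x \<in> essential_image C D F"
  using D.isomorphic_refl[of "FObj F x"] by (auto simp: essential_image_def)

lemma essential_image_subset: "essential_image C D F \<subseteq> Obj D"
  by (auto simp: essential_image_def)

lemma (in functor_between) essential_image_iso:
  "x \<in> essential_image C D F \<Longrightarrow> isomorphic D x y \<Longrightarrow> y \<in> essential_image C D F"
proof -
  assume x: "x \<in> essential_image C D F" and i: "isomorphic D x y"
  then obtain w where "w \<in> Obj C" "isomorphic D (FObj F w) y"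
    using D.isomorphic_trans unfolding essential_image_def by blast
  moreover have "y \<in> Obj D" using D.isomorphicE[OF i] D.obj_simps by metis
  ultimately show ?thesis unfolding essential_image_def by blast
qed

text \<open>Corestricted to its essential image, \<open>F\<close> is dense, so the abelian structure
  of \<open>C\<close> is transported.\<close>

lemma (in ff_additive) essential_image_abelian:
  assumes "abelian_category C"
  shows "abelian_category (full_subcat D (essential_image C D F))"
proof -
  let ?S = "essential_image C D F"
  interpret S: preadditive_category "full_subcat D ?S"
    by (rule D.preadditive_full_subcat[OF essential_image_subset])
  have h: "homset (full_subcat D ?S) (FObj F x) (FObj F y) = homset D (FObj F x) (FObj F y)"
    if "x \<in> Obj C" "y \<in> Obj C" for x y
    by (rule homset_full_subcat) (simp_all add: essential_image_obj that)
  interpret S: ff_dense C "full_subcat D ?S" F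
  proof unfold_locales
    show "is_functor C (full_subcat D ?S) F"
      using is_functor essential_image_obj by (simp add: is_functor_def)
    show "fully_faithful C (full_subcat D ?S) F"
      using ff by (simp add: fully_faithful_def h)
    fix y assume "y \<in> Obj (full_subcat D ?S)"
    then have y: "y \<in> ?S" by simp
    then obtain x where "x \<in> Obj C" "isomorphic D (FObj F x) y" by (auto simp: essential_image_def)
    then show "\<exists>x\<in>Obj C. isomorphic (full_subcat D ?S) (FObj F x) y"
      using y essential_image_obj D.isomorphic_full_subcat[OF essential_image_subset] by blast
  qed
  show ?thesis by (rule S.abelian_target[OF assms])
qed


section \<open>Adjoint triples\<close>

lemma bij_betw_ex1: "bij_betw f S T \<Longrightarrow> y \<in> T \<Longrightarrow> \<exists>!x. x \<in> S \<and> f x = y"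
  by (auto simp: bij_betw_def inj_on_def)

text \<open>The Hom-set bijections are traded for universal arrows, which are easier to dualise and
  to compute with. As usual the unit is the image of an identity.\<close>

lemma left_adjoint_unit:
  assumes "category C" "category A" "left_adjoint C A L E"
  obtains \<eta> where "\<And>x. x \<in> Obj C \<Longrightarrow> \<eta> x \<in> homset C x (FObj E (FObj L x))"
    "\<And>u. u \<in> Arr C \<Longrightarrow> \<eta> (Cod C u) \<cdot>\<^bsub>C\<^esub> u = FArr E (FArr L u) \<cdot>\<^bsub>C\<^esub> \<eta> (Dom C u)"
    "\<And>x a h. x \<in> Obj C \<Longrightarrow> a \<in> Obj A \<Longrightarrow> h \<in> homset C x (FObj E a) \<Longrightarrow>
      \<exists>!v. v \<in> homset A (FObj L x) a \<and> FArr E v \<cdot>\<^bsub>C\<^esub> \<eta> x = h"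
proof -
  interpret C: category C by fact
  interpret A: category A by fact
  interpret L: functor_between C A L
    using assms(3) by unfold_locales (simp add: left_adjoint_def)
  interpret E: functor_between A C E
    using assms(3) by unfold_locales (simp add: left_adjoint_def)
  from assms(3) obtain \<phi> where
    bij: "\<And>x y. x \<in> Obj C \<Longrightarrow> y \<in> Obj A \<Longrightarrow>
      bij_betw (\<phi> x y) (homset A (FObj L x) y) (homset C x (FObj E y))"
    and nat: "\<And>u v f. u \<in> Arr C \<Longrightarrow> v \<in> Arr A \<Longrightarrow> f \<in> homset A (FObj L (Cod C u)) (Dom A v) \<Longrightarrow>
      \<phi> (Dom C u) (Cod A v) ((v \<cdot>\<^bsub>A\<^esub> f) \<cdot>\<^bsub>A\<^esub> FArr L u) =
        (FArr E v \<cdot>\<^bsub>C\<^esub> \<phi> (Cod C u) (Dom A v) f) \<cdot>\<^bsub>C\<^esub> u"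
    unfolding left_adjoint_def by blast
  define \<eta> where "\<eta> x = \<phi> x (FObj L x) (Idn A (FObj L x))" for x
  have hom: "\<eta> x \<in> homset C x (FObj E (FObj L x))" if "x \<in> Obj C" for x
    using bij_betwE[OF bij[of x "FObj L x"]] that unfolding \<eta>_def by simp
  \<comment> \<open>Naturality applied to the identity turns \<open>\<phi>\<close> into composition
    with \<open>\<eta>\<close>, so that bijectivity becomes the universal property.\<close>
  have lift: "\<phi> x a v = FArr E v \<cdot>\<^bsub>C\<^esub> \<eta> x"
    if "x \<in> Obj C" "v \<in> homset A (FObj L x) a" for x a v
    using nat[of "Idn C x" v "Idn A (FObj L x)"] hom[OF that(1)] that by (simp add: \<eta>_def[symmetric])
  show ?thesis
  proof (rule that[of \<eta>])
    fix u assume u: "u \<in> Arr C"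
    show "\<eta> (Cod C u) \<cdot>\<^bsub>C\<^esub> u = FArr E (FArr L u) \<cdot>\<^bsub>C\<^esub> \<eta> (Dom C u)"
      using nat[of u "Idn A (FObj L (Cod C u))" "Idn A (FObj L (Cod C u))"]
        lift[of "Dom C u" "FArr L u" "FObj L (Cod C u)"] hom[of "Cod C u"] u
      by (simp add: \<eta>_def[symmetric])
  next
    fix x a h assume x: "x \<in> Obj C" and a: "a \<in> Obj A" and h: "h \<in> homset C x (FObj E a)"
    have "\<exists>!v. v \<in> homset A (FObj L x) a \<and> \<phi> x a v = h"
      using bij[OF x a] h by (rule bij_betw_ex1)
    then show "\<exists>!v. v \<in> homset A (FObj L x) a \<and> FArr E v \<cdot>\<^bsub>C\<^esub> \<eta> x = h"
      using lift[OF x] by (metis (no_types, lifting))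
  qed (rule hom)
qed

text \<open>Here \<open>\<phi>\<close> leads away from the Hom-sets that contain the counit. Thus
  \<open>\<kappa> x\<close> is a preimage of an identity, and equations in \<open>C\<close> are
  checked after applying the injective \<open>\<phi>\<close>.\<close>

lemma left_adjoint_counit:
  assumes "category C" "category A" "left_adjoint A C E R"
  obtains \<kappa> where "\<And>x. x \<in> Obj C \<Longrightarrow> \<kappa> x \<in> homset C (FObj E (FObj R x)) x"
    "\<And>u. u \<in> Arr C \<Longrightarrow> \<kappa> (Cod C u) \<cdot>\<^bsub>C\<^esub> FArr E (FArr R u) = u \<cdot>\<^bsub>C\<^esub> \<kappa> (Dom C u)"
    "\<And>x a h. x \<in> Obj C \<Longrightarrow> a \<in> Obj A \<Longrightarrow> h \<in> homset C (FObj E a) x \<Longrightarrow>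
      \<exists>!v. v \<in> homset A a (FObj R x) \<and> \<kappa> x \<cdot>\<^bsub>C\<^esub> FArr E v = h"
proof -
  interpret C: category C by fact
  interpret A: category A by fact
  interpret R: functor_between C A R
    using assms(3) by unfold_locales (simp add: left_adjoint_def)
  interpret E: functor_between A C E
    using assms(3) by unfold_locales (simp add: left_adjoint_def)
  from assms(3) obtain \<phi> where
    bij: "\<And>a x. a \<in> Obj A \<Longrightarrow> x \<in> Obj C \<Longrightarrow>
      bij_betw (\<phi> a x) (homset C (FObj E a) x) (homset A a (FObj R x))"
    and nat: "\<And>u v f. u \<in> Arr A \<Longrightarrow> v \<in> Arr C \<Longrightarrow> f \<in> homset C (FObj E (Cod A u)) (Dom C v) \<Longrightarrow>
      \<phi> (Dom A u) (Cod C v) ((v \<cdot>\<^bsub>C\<^esub> f) \<cdot>\<^bsub>C\<^esub> FArr E u) =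
        (FArr R v \<cdot>\<^bsub>A\<^esub> \<phi> (Cod A u) (Dom C v) f) \<cdot>\<^bsub>A\<^esub> u"
    unfolding left_adjoint_def by blast
  have "\<exists>k. k \<in> homset C (FObj E (FObj R x)) x \<and> \<phi> (FObj R x) x k = Idn A (FObj R x)"
    if "x \<in> Obj C" for x
    using bij_betw_ex1[OF bij[of "FObj R x" x], of "Idn A (FObj R x)"] that
    by (simp del: in_homset add: A.idn_hom) blast
  then obtain \<kappa> where hom: "\<And>x. x \<in> Obj C \<Longrightarrow> \<kappa> x \<in> homset C (FObj E (FObj R x)) x"
    and \<kappa>: "\<And>x. x \<in> Obj C \<Longrightarrow> \<phi> (FObj R x) x (\<kappa> x) = Idn A (FObj R x)"
    by metis
  have lift: "\<phi> a x (\<kappa> x \<cdot>\<^bsub>C\<^esub> FArr E v) = v" if "x \<in> Obj C" "v \<in> homset A a (FObj R x)" for x a v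
    using nat[of v "Idn C x" "\<kappa> x"] hom[OF that(1)] \<kappa>[OF that(1)] that by simp
  have inj: "f = g" if "f \<in> homset C (FObj E a) x" "g \<in> homset C (FObj E a) x" "\<phi> a x f = \<phi> a x g"
    "a \<in> Obj A" "x \<in> Obj C" for f g a x
    using bij[OF that(4,5)] that(1-3) by (auto simp: bij_betw_def inj_on_def)
  show ?thesis
  proof (rule that[of \<kappa>])
    fix u assume u: "u \<in> Arr C"
    show "\<kappa> (Cod C u) \<cdot>\<^bsub>C\<^esub> FArr E (FArr R u) = u \<cdot>\<^bsub>C\<^esub> \<kappa> (Dom C u)"
    proof (rule inj[of _ "FObj R (Dom C u)" "Cod C u"])
      have "\<phi> (FObj R (Dom C u)) (Cod C u) (u \<cdot>\<^bsub>C\<^esub> \<kappa> (Dom C u)) = FArr R u"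
        using nat[of "Idn A (FObj R (Dom C u))" u "\<kappa> (Dom C u)"] hom[of "Dom C u"] \<kappa>[of "Dom C u"] u
        by simp
      then show "\<phi> (FObj R (Dom C u)) (Cod C u) (\<kappa> (Cod C u) \<cdot>\<^bsub>C\<^esub> FArr E (FArr R u)) =
          \<phi> (FObj R (Dom C u)) (Cod C u) (u \<cdot>\<^bsub>C\<^esub> \<kappa> (Dom C u))"
        using lift[of "Cod C u" "FArr R u" "FObj R (Dom C u)"] u by simp
    qed (use u hom[of "Dom C u"] hom[of "Cod C u"] in simp_all)
  next
    fix x a h assume x: "x \<in> Obj C" and a: "a \<in> Obj A" and h: "h \<in> homset C (FObj E a) x"
    show "\<exists>!v. v \<in> homset A a (FObj R x) \<and> \<kappa> x \<cdot>\<^bsub>C\<^esub> FArr E v = h"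
    proof (rule ex1I[of _ "\<phi> a x h"])
      have v: "\<phi> a x h \<in> homset A a (FObj R x)" using bij_betwE[OF bij[OF a x]] h by blast
      have "\<kappa> x \<cdot>\<^bsub>C\<^esub> FArr E (\<phi> a x h) = h"
        by (rule inj[of _ a x]) (use lift[OF x v] v hom[OF x] h a x in simp_all)
      then show "\<phi> a x h \<in> homset A a (FObj R x) \<and> \<kappa> x \<cdot>\<^bsub>C\<^esub> FArr E (\<phi> a x h) = h" using v by blast
      show "v = \<phi> a x h" if "v \<in> homset A a (FObj R x) \<and> \<kappa> x \<cdot>\<^bsub>C\<^esub> FArr E v = h" for v
        using lift[of x v a] that x by simp
    qed
  qed (rule hom)
qed

text \<open>Of the four units and counits exactly the two living in \<open>C\<close> are parameters:
  the unit of the adjunction of \<open>L\<close> and \<open>E\<close>, and the counit of that of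
  \<open>E\<close> and \<open>R\<close>. Reversing all arrows exchanges them.\<close>

locale adjoint_triple =
  A: preadditive_category A + C: preadditive_category C +
  E: functor_between A C E + L: functor_between C A L + R: functor_between C A R
  for A :: "('o, 'm, 'y) addcat_scheme" (structure) and C :: "('p, 'n, 'z) addcat_scheme" (structure)
    and E :: "('o, 'm, 'p, 'n) fctr" and L R :: "('p, 'n, 'o, 'm) fctr" +
  fixes \<eta> \<kappa> :: "'p \<Rightarrow> 'n"
  assumes unit_hom: "x \<in> Obj C \<Longrightarrow> \<eta> x \<in> homset C x (FObj E (FObj L x))"
    and unit_nat: "u \<in> Arr C \<Longrightarrow> \<eta> (Cod C u) \<cdot>\<^bsub>C\<^esub> u = FArr E (FArr L u) \<cdot>\<^bsub>C\<^esub> \<eta> (Dom C u)"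
    and unit_univ: "x \<in> Obj C \<Longrightarrow> a \<in> Obj A \<Longrightarrow> h \<in> homset C x (FObj E a) \<Longrightarrow>
      \<exists>!v. v \<in> homset A (FObj L x) a \<and> FArr E v \<cdot>\<^bsub>C\<^esub> \<eta> x = h"
    and counit_hom: "x \<in> Obj C \<Longrightarrow> \<kappa> x \<in> homset C (FObj E (FObj R x)) x"
    and counit_nat: "u \<in> Arr C \<Longrightarrow> \<kappa> (Cod C u) \<cdot>\<^bsub>C\<^esub> FArr E (FArr R u) = u \<cdot>\<^bsub>C\<^esub> \<kappa> (Dom C u)"
    and counit_univ: "x \<in> Obj C \<Longrightarrow> a \<in> Obj A \<Longrightarrow> h \<in> homset C (FObj E a) x \<Longrightarrow>
      \<exists>!v. v \<in> homset A a (FObj R x) \<and> \<kappa> x \<cdot>\<^bsub>C\<^esub> FArr E v = h"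
begin

text \<open>Between the opposite categories \<open>R\<close> is left adjoint and \<open>L\<close>
  right adjoint to \<open>E\<close>. Every fact proved below for \<open>L\<close> and
  \<open>\<eta>\<close> thereby yields one for \<open>R\<close> and \<open>\<kappa>\<close>.\<close>

lemma op: "adjoint_triple (op_cat A) (op_cat C) E R L \<kappa> \<eta>"
  by (intro adjoint_triple.intro A.pre_op C.pre_op functor_between.intro A.cat_op C.cat_op
      functor_between_axioms.intro adjoint_triple_axioms.intro)
    (simp_all add: is_functor_op E.is_functor L.is_functor R.is_functor homset_op unit_hom counit_hom
      unit_nat counit_nat unit_univ counit_univ del: in_homset)

section \<open>Transposition along the two adjunctions\<close>

lemma unit_simps [simp]:
  assumes "x \<in> Obj C"
  shows "\<eta> x \<in> Arr C" "Dom C (\<eta> x) = x" "Cod C (\<eta> x) = FObj E (FObj L x)"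
    "\<kappa> x \<in> Arr C" "Dom C (\<kappa> x) = FObj E (FObj R x)" "Cod C (\<kappa> x) = x"
  using unit_hom[OF assms] counit_hom[OF assms] by simp_all

lemma unit_lift:
  assumes "h \<in> Arr C" "Dom C h = x" "Cod C h = FObj E a" "a \<in> Obj A"
  obtains v where "v \<in> Arr A" "Dom A v = FObj L x" "Cod A v = a" "FArr E v \<cdot>\<^bsub>C\<^esub> \<eta> x = h"
proof -
  have "\<exists>!v. v \<in> homset A (FObj L x) a \<and> FArr E v \<cdot>\<^bsub>C\<^esub> \<eta> x = h"
    using assms by (intro unit_univ) auto
  then obtain v where "v \<in> homset A (FObj L x) a" "FArr E v \<cdot>\<^bsub>C\<^esub> \<eta> x = h" by blast
  then show ?thesis using that[of v] by simp
qed

lemma counit_lift: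
  assumes "h \<in> Arr C" "Dom C h = FObj E a" "Cod C h = x" "a \<in> Obj A"
  obtains v where "v \<in> Arr A" "Dom A v = a" "Cod A v = FObj R x" "\<kappa> x \<cdot>\<^bsub>C\<^esub> FArr E v = h"
proof -
  obtain v where "v \<in> Arr (op_cat A)" "Dom (op_cat A) v = FObj R x" "Cod (op_cat A) v = a"
    "FArr E v \<cdot>\<^bsub>op_cat C\<^esub> \<kappa> x = h"
    by (rule adjoint_triple.unit_lift[OF op, of h x a]) (use assms in simp_all)
  then show ?thesis using that[of v] by simp
qed

lemma unit_eqI:
  assumes e: "FArr E v \<cdot>\<^bsub>C\<^esub> \<eta> x = FArr E w \<cdot>\<^bsub>C\<^esub> \<eta> x"
    and "x \<in> Obj C" "v \<in> Arr A" "w \<in> Arr A" "Dom A v = FObj L x" "Dom A w = FObj L x" "Cod A v = Cod A w"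
  shows "v = w"
proof -
  have "\<exists>!t. t \<in> homset A (FObj L x) (Cod A w) \<and> FArr E t \<cdot>\<^bsub>C\<^esub> \<eta> x = FArr E w \<cdot>\<^bsub>C\<^esub> \<eta> x"
    using assms by (intro unit_univ) simp_all
  moreover have "v \<in> homset A (FObj L x) (Cod A w)" "w \<in> homset A (FObj L x) (Cod A w)"
    using assms by simp_all
  ultimately show ?thesis using e by blast
qed

lemma counit_eqI:
  assumes "\<kappa> x \<cdot>\<^bsub>C\<^esub> FArr E v = \<kappa> x \<cdot>\<^bsub>C\<^esub> FArr E w"
    and "x \<in> Obj C" "v \<in> Arr A" "w \<in> Arr A" "Cod A v = FObj R x" "Cod A w = FObj R x" "Dom A v = Dom A w"
  shows "v = w"
  using adjoint_triple.unit_eqI[OF op, of v x w] assms by simp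

text \<open>Arrows into \<open>E (R y)\<close> are rewritten as \<open>E g'\<close> after
  \<open>\<eta> x\<close> with \<open>g'\<close> from \<open>L x\<close> to \<open>R y\<close>.
  Cancelling the invertible \<open>\<eta> x\<close> brings the universal property of
  \<open>\<kappa> y\<close> to bear and shows that \<open>\<kappa> y\<close> is mono; it remains to
  split it.\<close>

lemma counit_iso_if_unit_iso:
  assumes iso: "\<And>x. x \<in> Obj C \<Longrightarrow> isomorphism C (\<eta> x)" and y: "y \<in> Obj C"
  shows "isomorphism C (\<kappa> y)"
proof -
  have mono: "monomorphism C (\<kappa> y)"
  proof (rule C.monoI)
    fix g h assume gh: "g \<in> Arr C" "h \<in> Arr C" "Dom C g = Dom C h" "Cod C g = Dom C (\<kappa> y)"
      "Cod C h = Dom C (\<kappa> y)" "\<kappa> y \<cdot>\<^bsub>C\<^esub> g = \<kappa> y \<cdot>\<^bsub>C\<^esub> h"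
    obtain x where d: "Dom C g = x" "Dom C h = x" using gh(3) by simp
    have x: "x \<in> Obj C" and Ry: "FObj R y \<in> Obj A"
      and cod: "Cod C g = FObj E (FObj R y)" "Cod C h = FObj E (FObj R y)"
      using gh(1,2,4,5) d y by auto
    obtain g' where g': "g' \<in> Arr A" "Dom A g' = FObj L x" "Cod A g' = FObj R y" "FArr E g' \<cdot>\<^bsub>C\<^esub> \<eta> x = g"
      using unit_lift[OF gh(1) d(1) cod(1) Ry] .
    obtain h' where h': "h' \<in> Arr A" "Dom A h' = FObj L x" "Cod A h' = FObj R y" "FArr E h' \<cdot>\<^bsub>C\<^esub> \<eta> x = h"
      using unit_lift[OF gh(2) d(2) cod(2) Ry] .
    obtain i where i: "inverse_arrows C (\<eta> x) i" using iso[OF x] unfolding isomorphism_iff by blast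
    have "(\<kappa> y \<cdot>\<^bsub>C\<^esub> FArr E g') \<cdot>\<^bsub>C\<^esub> \<eta> x = (\<kappa> y \<cdot>\<^bsub>C\<^esub> FArr E h') \<cdot>\<^bsub>C\<^esub> \<eta> x"
      using gh(6) g' h' x y by (simp add: C.assoc)
    then have "\<kappa> y \<cdot>\<^bsub>C\<^esub> FArr E g' = \<kappa> y \<cdot>\<^bsub>C\<^esub> FArr E h'"
      by (rule C.epi_cancel[OF C.iso_epi[OF i]]) (use g' h' x y in simp_all)
    then have "g' = h'" by (rule counit_eqI) (use g' h' x y in simp_all)
    then show "g = h" using g' h' by simp
  qed (use y in simp)
  obtain i where "inverse_arrows C (\<eta> y) i" using iso[OF y] unfolding isomorphism_iff by blast
  then have i: "i \<in> Arr C" "Dom C i = FObj E (FObj L y)" "Cod C i = y" "i \<cdot>\<^bsub>C\<^esub> \<eta> y = Idn C y"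
    using y by (simp_all add: inverse_arrows_def)
  \<comment> \<open>Transposing the inverse of \<open>\<eta> y\<close> gives an arrow from
    \<open>L y\<close> to \<open>R y\<close> whose image under \<open>E\<close>, composed with
    \<open>\<eta> y\<close>, is the required right inverse.\<close>
  obtain t where t: "t \<in> Arr A" "Dom A t = FObj L y" "Cod A t = FObj R y" "\<kappa> y \<cdot>\<^bsub>C\<^esub> FArr E t = i"
    using counit_lift[OF i(1,2,3)] y by auto
  have "\<kappa> y \<cdot>\<^bsub>C\<^esub> (FArr E t \<cdot>\<^bsub>C\<^esub> \<eta> y) = Idn C y"
    using C.reassoc1[OF t(4), of "\<eta> y"] t i y by simp
  then have "inverse_arrows C (\<kappa> y) (FArr E t \<cdot>\<^bsub>C\<^esub> \<eta> y)"
    using t y by (intro C.mono_split_iso[OF mono]) simp_all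
  then show ?thesis unfolding isomorphism_iff by blast
qed

lemma unit_iso_if_counit_iso:
  "(\<And>x. x \<in> Obj C \<Longrightarrow> isomorphism C (\<kappa> x)) \<Longrightarrow> y \<in> Obj C \<Longrightarrow> isomorphism C (\<eta> y)"
  using adjoint_triple.counit_iso_if_unit_iso[OF op, of y] by simp

text \<open>An arrow from \<open>y\<close> to \<open>E (L x)\<close> transposes to one from
  \<open>L y\<close> to \<open>L x\<close>, hence to some \<open>L u\<close>, and naturality makes
  the original \<open>\<eta> x\<close> after \<open>u\<close>. So \<open>\<eta> x\<close> splits,
  and it is mono because \<open>L\<close> is faithful.\<close>

lemma unit_iso_if_ff:
  assumes ff: "fully_faithful C A L" and x: "x \<in> Obj C"
  shows "isomorphism C (\<eta> x)"
proof -
  have surj: "\<exists>u\<in>Arr C. Dom C u = y \<and> Cod C u = x \<and> \<eta> x \<cdot>\<^bsub>C\<^esub> u = h"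
    if h: "h \<in> Arr C" "Dom C h = y" "Cod C h = FObj E (FObj L x)" for y h
  proof -
    have y: "y \<in> Obj C" using h by auto
    obtain v where v: "v \<in> Arr A" "Dom A v = FObj L y" "Cod A v = FObj L x" "FArr E v \<cdot>\<^bsub>C\<^esub> \<eta> y = h"
      using unit_lift[OF h] x by auto
    have "FArr L ` homset C y x = homset A (FObj L y) (FObj L x)"
      using ff x y by (auto simp: fully_faithful_def bij_betw_def)
    then have "v \<in> FArr L ` homset C y x" using v by simp
    then obtain u where u: "u \<in> Arr C" "Dom C u = y" "Cod C u = x" "FArr L u = v" by auto
    then show ?thesis using unit_nat[OF u(1)] v by auto
  qed
  have mono: "monomorphism C (\<eta> x)"
  proof (rule C.monoI)
    fix g h assume gh: "g \<in> Arr C" "h \<in> Arr C" "Dom C g = Dom C h" "Cod C g = Dom C (\<eta> x)"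
      "Cod C h = Dom C (\<eta> x)" "\<eta> x \<cdot>\<^bsub>C\<^esub> g = \<eta> x \<cdot>\<^bsub>C\<^esub> h"
    then have "FArr E (FArr L g) \<cdot>\<^bsub>C\<^esub> \<eta> (Dom C h) = FArr E (FArr L h) \<cdot>\<^bsub>C\<^esub> \<eta> (Dom C h)"
      using unit_nat[of g] unit_nat[of h] x by simp
    then have "FArr L g = FArr L h" by (rule unit_eqI) (use gh x in simp_all)
    moreover have "inj_on (FArr L) (homset C (Dom C h) x)"
      using ff x gh by (simp add: fully_faithful_def bij_betw_def)
    ultimately show "g = h" using gh x by (auto dest: inj_onD)
  qed (use x in simp)
  obtain u where "u \<in> Arr C" "Dom C u = FObj E (FObj L x)" "Cod C u = x"
    "\<eta> x \<cdot>\<^bsub>C\<^esub> u = Idn C (FObj E (FObj L x))"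
    using surj[of "Idn C (FObj E (FObj L x))"] x by auto
  then have "inverse_arrows C (\<eta> x) u" using x by (intro C.mono_split_iso[OF mono]) simp_all
  then show ?thesis unfolding isomorphism_iff by blast
qed

lemma counit_iso_if_ff: "fully_faithful C A R \<Longrightarrow> x \<in> Obj C \<Longrightarrow> isomorphism C (\<kappa> x)"
  using adjoint_triple.unit_iso_if_ff[OF op, of x] by (simp add: fully_faithful_op)

lemma unit_counit_iso:
  assumes "fully_faithful C A L \<or> fully_faithful C A R"
  shows "\<forall>x\<in>Obj C. isomorphism C (\<eta> x) \<and> isomorphism C (\<kappa> x)"
  using assms unit_iso_if_ff counit_iso_if_ff unit_iso_if_counit_iso counit_iso_if_unit_iso by metis

section \<open>Monomorphisms and epimorphisms under the three functors\<close>

lemma E_mono: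
  assumes "monomorphism A f"
  shows "monomorphism C (FArr E f)"
proof (rule C.monoI)
  note fA = A.mono_arr[OF assms]
  fix g h assume gh: "g \<in> Arr C" "h \<in> Arr C" "Dom C g = Dom C h" "Cod C g = Dom C (FArr E f)"
    "Cod C h = Dom C (FArr E f)" "FArr E f \<cdot>\<^bsub>C\<^esub> g = FArr E f \<cdot>\<^bsub>C\<^esub> h"
  let ?a = "Dom A f"
  obtain x where d: "Dom C g = x" "Dom C h = x" using gh(3) by simp
  have x: "x \<in> Obj C" and a: "?a \<in> Obj A"
    and cod: "Cod C g = FObj E ?a" "Cod C h = FObj E ?a"
    using gh(1,2,4,5) d fA by auto
  obtain g' where g': "g' \<in> Arr A" "Dom A g' = FObj L x" "Cod A g' = ?a" "FArr E g' \<cdot>\<^bsub>C\<^esub> \<eta> x = g"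
    using unit_lift[OF gh(1) d(1) cod(1) a] .
  obtain h' where h': "h' \<in> Arr A" "Dom A h' = FObj L x" "Cod A h' = ?a" "FArr E h' \<cdot>\<^bsub>C\<^esub> \<eta> x = h"
    using unit_lift[OF gh(2) d(2) cod(2) a] .
  have "f \<cdot> g' = f \<cdot> h'"
    by (rule unit_eqI[OF _ x]) (use gh g' h' fA x in simp_all)
  then have "g' = h'" by (rule A.mono_cancel[OF assms]) (use g' h' in simp_all)
  then show "g = h" using g' h' by simp
qed (use A.mono_arr[OF assms] in simp)

lemma L_epi:
  assumes "epimorphism C u"
  shows "epimorphism A (FArr L u)"
proof (rule A.epiI)
  note uA = C.epi_arr[OF assms]
  fix g h assume gh: "g \<in> Arr A" "h \<in> Arr A" "Cod A g = Cod A h" "Dom A g = Cod A (FArr L u)"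
    "Dom A h = Cod A (FArr L u)" "g \<cdot> FArr L u = h \<cdot> FArr L u"
  let ?y = "Cod C u"
  have *: "(FArr E k \<cdot>\<^bsub>C\<^esub> \<eta> ?y) \<cdot>\<^bsub>C\<^esub> u = FArr E (k \<cdot> FArr L u) \<cdot>\<^bsub>C\<^esub> \<eta> (Dom C u)"
    if "k \<in> Arr A" "Dom A k = FObj L ?y" for k
    using that uA unit_nat[OF uA] by simp
  have "FArr E g \<cdot>\<^bsub>C\<^esub> \<eta> ?y = FArr E h \<cdot>\<^bsub>C\<^esub> \<eta> ?y"
    by (rule C.epi_cancel[OF assms]) (use *[of g] *[of h] gh uA in simp_all)
  then show "g = h" by (rule unit_eqI) (use gh uA in simp_all)
qed (use C.epi_arr[OF assms] in simp)

lemma E_epi: "epimorphism A f \<Longrightarrow> epimorphism C (FArr E f)"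
  using adjoint_triple.E_mono[OF op, of f] by simp

lemma R_mono: "monomorphism C u \<Longrightarrow> monomorphism A (FArr R u)"
  using adjoint_triple.L_epi[OF op, of u] by simp

text \<open>The counit from \<open>L (E a)\<close> to \<open>a\<close> of the left adjunction;
  \<open>unit_R\<close> is the unit from \<open>a\<close> to \<open>R (E a)\<close> of the right
  one. They live in \<open>A\<close>, are determined by the triangle identity, and are exchanged by
  duality.\<close>

definition counit_L :: "'o \<Rightarrow> 'm" where
  "counit_L a = (THE v. v \<in> homset A (FObj L (FObj E a)) a \<and> FArr E v \<cdot>\<^bsub>C\<^esub> \<eta> (FObj E a) = Idn C (FObj E a))"

definition unit_R :: "'o \<Rightarrow> 'm" where
  "unit_R a = (THE v. v \<in> homset A a (FObj R (FObj E a)) \<and> \<kappa> (FObj E a) \<cdot>\<^bsub>C\<^esub> FArr E v = Idn C (FObj E a))"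

lemma counit_L_op: "adjoint_triple.counit_L (op_cat A) (op_cat C) E R \<kappa> = unit_R"
  unfolding adjoint_triple.counit_L_def[OF op] unit_R_def by (simp add: homset_op del: in_homset)

lemma unit_R_op: "adjoint_triple.unit_R (op_cat A) (op_cat C) E L \<eta> = counit_L"
  unfolding adjoint_triple.unit_R_def[OF op] counit_L_def by (simp add: homset_op del: in_homset)

lemma counit_L [simp]:
  assumes a: "a \<in> Obj A"
  shows "counit_L a \<in> Arr A" "Dom A (counit_L a) = FObj L (FObj E a)" "Cod A (counit_L a) = a"
    "FArr E (counit_L a) \<cdot>\<^bsub>C\<^esub> \<eta> (FObj E a) = Idn C (FObj E a)"
proof -
  have "\<exists>!v. v \<in> homset A (FObj L (FObj E a)) a \<and> FArr E v \<cdot>\<^bsub>C\<^esub> \<eta> (FObj E a) = Idn C (FObj E a)"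
    using a by (intro unit_univ) simp_all
  from theI'[OF this]
  show "counit_L a \<in> Arr A" "Dom A (counit_L a) = FObj L (FObj E a)" "Cod A (counit_L a) = a"
    "FArr E (counit_L a) \<cdot>\<^bsub>C\<^esub> \<eta> (FObj E a) = Idn C (FObj E a)"
    by (simp_all add: counit_L_def)
qed

lemma unit_R [simp]:
  assumes a: "a \<in> Obj A"
  shows "unit_R a \<in> Arr A" "Dom A (unit_R a) = a" "Cod A (unit_R a) = FObj R (FObj E a)"
    "\<kappa> (FObj E a) \<cdot>\<^bsub>C\<^esub> FArr E (unit_R a) = Idn C (FObj E a)"
  using adjoint_triple.counit_L[OF op, of a] a by (simp_all add: counit_L_op)

lemma counit_L_nat:
  assumes "f \<in> Arr A"
  shows "counit_L (Cod A f) \<cdot> FArr L (FArr E f) = f \<cdot> counit_L (Dom A f)"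
proof (rule unit_eqI[of _ "FObj E (Dom A f)"])
  have "FArr E (counit_L (Cod A f)) \<cdot>\<^bsub>C\<^esub> (FArr E (FArr L (FArr E f)) \<cdot>\<^bsub>C\<^esub> \<eta> (FObj E (Dom A f))) = FArr E f"
    using unit_nat[of "FArr E f", symmetric] C.reassoc1[OF counit_L(4), of "Cod A f" "FArr E f"] assms by simp
  then show "FArr E (counit_L (Cod A f) \<cdot> FArr L (FArr E f)) \<cdot>\<^bsub>C\<^esub> \<eta> (FObj E (Dom A f)) =
      FArr E (f \<cdot> counit_L (Dom A f)) \<cdot>\<^bsub>C\<^esub> \<eta> (FObj E (Dom A f))"
    using assms by simp
qed (use assms in simp_all)

lemma unit_R_nat: "f \<in> Arr A \<Longrightarrow> FArr R (FArr E f) \<cdot> unit_R (Dom A f) = unit_R (Cod A f) \<cdot> f"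
  using adjoint_triple.counit_L_nat[OF op, of f] by (simp add: counit_L_op)

text \<open>By naturality \<open>v\<close> after the counit is the counit after
  \<open>L (E v)\<close>, which depends on \<open>E v\<close> only; the epi counit cancels.\<close>

lemma E_faithful_from:
  assumes "epimorphism A (counit_L (Dom A v))" "FArr E v = FArr E w" "v \<in> Arr A" "w \<in> Arr A"
    "Dom A v = Dom A w" "Cod A v = Cod A w"
  shows "v = w"
proof (rule A.epi_cancel[OF assms(1)])
  show "v \<cdot> counit_L (Dom A v) = w \<cdot> counit_L (Dom A v)"
    using counit_L_nat[OF assms(3)] counit_L_nat[OF assms(4)] assms(2-) by simp
qed (use assms in simp_all)

lemma E_faithful_to:
  assumes "monomorphism A (unit_R (Cod A v))" "FArr E v = FArr E w" "v \<in> Arr A" "w \<in> Arr A"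
    "Dom A v = Dom A w" "Cod A v = Cod A w"
  shows "v = w"
  using adjoint_triple.E_faithful_from[OF op, of v w] assms by (simp add: counit_L_op)

lemma counit_L_iso_image:
  assumes "inverse_arrows A a a'" "epimorphism A (counit_L (Dom A a))"
  shows "epimorphism A (counit_L (Cod A a))"
proof -
  have t: "a \<in> Arr A" using assms(1) by (simp add: inverse_arrows_def)
  have "epimorphism A (a \<cdot> counit_L (Dom A a))"
    using A.iso_epi[OF assms(1)] assms(2) t by (simp add: A.epi_comp)
  then have "epimorphism A (counit_L (Cod A a) \<cdot> FArr L (FArr E a))" using counit_L_nat[OF t] by simp
  then show ?thesis by (rule A.epi_of_comp) (use t in simp_all)
qed

lemma unit_R_iso_image:
  "inverse_arrows A a a' \<Longrightarrow> monomorphism A (unit_R (Dom A a)) \<Longrightarrow> monomorphism A (unit_R (Cod A a))"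
  using adjoint_triple.counit_L_iso_image[OF op, of a' a] inverse_arrows_op[of A a' a]
  by (simp add: counit_L_op inverse_arrows_def)

end


section \<open>Fully faithful triples: exactness of \<open>E\<close>, right exactness of
  \<open>L\<close>, and abelianness of \<open>C\<close>\<close>

lemma essential_image_op:
  assumes "preadditive_category A"
  shows "essential_image (op_cat C) (op_cat A) F = essential_image C A F"
proof -
  interpret A: preadditive_category A by fact
  interpret O: category "op_cat A" by (rule A.cat_op)
  have "isomorphic (op_cat A) x y \<longleftrightarrow> isomorphic A x y" for x y
    unfolding A.isomorphic_iff O.isomorphic_iff inverse_arrows_op
    by (metis inverse_arrows_def op_cat_simps(3,4))
  then show ?thesis by (simp add: essential_image_def)
qed

lemma extension_closed_op: "extension_closed (op_cat A) S \<longleftrightarrow> extension_closed A S"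
proof -
  have "short_exact A f g \<Longrightarrow> Cod A f = Dom A g" for f g
    by (simp add: short_exact_def is_kernel_def)
  then show ?thesis by (auto simp: extension_closed_def)
qed

locale ff_adjoint_triple = adjoint_triple A C E L R \<eta> \<kappa> + A: abelian_category A + C: additive_category C
  for A :: "('o, 'm, 'y) addcat_scheme" (structure) and C :: "('p, 'n, 'z) addcat_scheme" (structure)
    and E :: "('o, 'm, 'p, 'n) fctr" and L R :: "('p, 'n, 'o, 'm) fctr"
    and \<eta> \<kappa> :: "'p \<Rightarrow> 'n" +
  fixes \<eta>' \<kappa>' :: "'p \<Rightarrow> 'n"
  assumes unit_inv: "x \<in> Obj C \<Longrightarrow> inverse_arrows C (\<eta> x) (\<eta>' x)"
    and counit_inv: "x \<in> Obj C \<Longrightarrow> inverse_arrows C (\<kappa> x) (\<kappa>' x)"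
begin

lemma ff_op: "ff_adjoint_triple (op_cat A) (op_cat C) E R L \<kappa> \<eta> \<kappa>' \<eta>'"
  by (intro ff_adjoint_triple.intro op A.ab_op additive_category_op ff_adjoint_triple_axioms.intro)
    (unfold_locales, simp_all add: inverse_arrows_op inverse_arrows_sym unit_inv counit_inv)

lemma inv_simps [simp]:
  assumes "x \<in> Obj C"
  shows "\<eta>' x \<in> Arr C" "Dom C (\<eta>' x) = FObj E (FObj L x)" "Cod C (\<eta>' x) = x"
    "\<kappa>' x \<in> Arr C" "Dom C (\<kappa>' x) = x" "Cod C (\<kappa>' x) = FObj E (FObj R x)"
    "\<eta>' x \<cdot>\<^bsub>C\<^esub> \<eta> x = Idn C x" "\<eta> x \<cdot>\<^bsub>C\<^esub> \<eta>' x = Idn C (FObj E (FObj L x))"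
    "\<kappa> x \<cdot>\<^bsub>C\<^esub> \<kappa>' x = Idn C x" "\<kappa>' x \<cdot>\<^bsub>C\<^esub> \<kappa> x = Idn C (FObj E (FObj R x))"
  using unit_inv[OF assms] counit_inv[OF assms] assms by (simp_all add: inverse_arrows_def)

text \<open>For a zero object \<open>z\<close> of \<open>A\<close> there is only one arrow from
  \<open>L (E z)\<close> to \<open>z\<close>, so its possible transposes, the identity and the zero
  arrow of \<open>E z\<close>, coincide. Zero arrows factor through \<open>z\<close>.\<close>

lemma E_zer [simp]:
  assumes a: "a \<in> Obj A" and b: "b \<in> Obj A"
  shows "FArr E (Zer A a b) = Zer C (FObj E a) (FObj E b)"
proof -
  obtain z where z: "zero_object A z" using A.ex_zero_object by blast
  then have zO: "z \<in> Obj A" by (simp add: zero_object_def)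
  let ?z = "FObj E z"
  have Ez: "?z \<in> Obj C" using zO by simp
  obtain v where v: "v \<in> Arr A" "Dom A v = FObj L ?z" "Cod A v = z" "FArr E v \<cdot>\<^bsub>C\<^esub> \<eta> ?z = Idn C ?z"
    using unit_lift[of "Idn C ?z" ?z z] Ez zO by auto
  obtain w where w: "w \<in> Arr A" "Dom A w = FObj L ?z" "Cod A w = z" "FArr E w \<cdot>\<^bsub>C\<^esub> \<eta> ?z = Zer C ?z ?z"
    using unit_lift[of "Zer C ?z ?z" ?z z] Ez zO by auto
  have "\<exists>!f. f \<in> homset A (FObj L ?z) z" using z Ez by (simp add: zero_object_def)
  moreover have "v \<in> homset A (FObj L ?z) z" "w \<in> homset A (FObj L ?z) z" using v w by simp_all
  ultimately have "v = w" by blast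
  then have id: "Idn C ?z = Zer C ?z ?z" using v w by simp
  have "FArr E (Zer A z b) = FArr E (Zer A z b) \<cdot>\<^bsub>C\<^esub> Idn C ?z" using b zO by simp
  also have "\<dots> = Zer C ?z (FObj E b)" using b zO unfolding id by simp
  finally have "FArr E (Zer A z b) = Zer C ?z (FObj E b)" .
  moreover have "Zer A a b = Zer A z b \<cdot> Zer A a z" using a b zO by simp
  then have "FArr E (Zer A a b) = FArr E (Zer A z b) \<cdot>\<^bsub>C\<^esub> FArr E (Zer A a z)"
    using a b zO E.arr_comp[of "Zer A a z" "Zer A z b"] by simp
  ultimately show ?thesis using a b zO by simp
qed

text \<open>A test arrow into \<open>E (Dom A f)\<close> is transposed to \<open>A\<close>, factored
  through \<open>k\<close> there, and transposed back.\<close>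

lemma E_kernel:
  assumes k: "is_kernel A k f"
  shows "is_kernel C (FArr E k) (FArr E f)"
proof (rule C.kernelI)
  note kD = A.kernelD[OF k]
  show "monomorphism C (FArr E k)" using E_mono A.kernel_mono[OF k] .
  show "FArr E f \<cdot>\<^bsub>C\<^esub> FArr E k = Zer C (Dom C (FArr E k)) (Cod C (FArr E f))"
    using E.arr_comp[of k f] kD by simp
  fix h assume h: "h \<in> Arr C" "Cod C h = Dom C (FArr E f)"
    "FArr E f \<cdot>\<^bsub>C\<^esub> h = Zer C (Dom C h) (Cod C (FArr E f))"
  let ?x = "Dom C h"
  have x: "?x \<in> Obj C" and a: "Dom A f \<in> Obj A" and cod: "Cod C h = FObj E (Dom A f)"
    using h(1,2) kD by simp_all
  obtain v where v: "v \<in> Arr A" "Dom A v = FObj L ?x" "Cod A v = Dom A f" "FArr E v \<cdot>\<^bsub>C\<^esub> \<eta> ?x = h"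
    using unit_lift[OF h(1) refl cod a] .
  have "FArr E (f \<cdot> v) \<cdot>\<^bsub>C\<^esub> \<eta> ?x = FArr E f \<cdot>\<^bsub>C\<^esub> (FArr E v \<cdot>\<^bsub>C\<^esub> \<eta> ?x)" using v(1-3) x kD by simp
  also have "\<dots> = Zer C ?x (FObj E (Cod A f))" unfolding v(4) using h(3) kD by simp
  finally have "f \<cdot> v = Zer A (FObj L ?x) (Cod A f)"
    by (intro unit_eqI[OF _ x]) (use v(1-3) x kD in simp_all)
  then obtain w where w: "w \<in> Arr A" "Dom A w = FObj L ?x" "Cod A w = Dom A k" "k \<cdot> w = v"
    using A.kernel_factor[OF k, of v] v(1-3) by auto
  have "FArr E k \<cdot>\<^bsub>C\<^esub> (FArr E w \<cdot>\<^bsub>C\<^esub> \<eta> ?x) = h"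
    using v(4) w x kD unfolding w(4)[symmetric] by simp
  then show "\<exists>u\<in>Arr C. Dom C u = Dom C h \<and> Cod C u = Dom C (FArr E k) \<and> FArr E k \<cdot>\<^bsub>C\<^esub> u = h"
    using w x kD by (intro bexI[of _ "FArr E w \<cdot>\<^bsub>C\<^esub> \<eta> ?x"]) simp_all
qed (use A.kernelD[OF k] in simp_all)

lemma E_cokernel: "is_cokernel A c f \<Longrightarrow> is_cokernel C (FArr E c) (FArr E f)"
  using ff_adjoint_triple.E_kernel[OF ff_op, of c f] by simp

lemma L_zer [simp]:
  assumes "x \<in> Obj C" "y \<in> Obj C"
  shows "FArr L (Zer C x y) = Zer A (FObj L x) (FObj L y)"
  by (rule unit_eqI[of _ x]) (use assms unit_nat[of "Zer C x y", symmetric] in simp_all)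

lemma L_cokernel:
  assumes c: "is_cokernel C c f"
  shows "is_cokernel A (FArr L c) (FArr L f)"
proof (rule A.cokernelI)
  note cD = C.cokernelD[OF c]
  show "epimorphism A (FArr L c)" using L_epi C.cokernel_epi[OF c] .
  show "FArr L c \<cdot> FArr L f = Zer A (Dom A (FArr L f)) (Cod A (FArr L c))"
    using L.arr_comp[of f c] cD by simp
  fix h assume h: "h \<in> Arr A" "Dom A h = Cod A (FArr L f)"
    "h \<cdot> FArr L f = Zer A (Dom A (FArr L f)) (Cod A h)"
  let ?y = "Cod C f" and ?z = "Cod C c" and ?a = "Cod A h"
  have dom: "Dom A h = FObj L ?y" using h(2) cD by simp
  have "(FArr E h \<cdot>\<^bsub>C\<^esub> \<eta> ?y) \<cdot>\<^bsub>C\<^esub> f = FArr E (h \<cdot> FArr L f) \<cdot>\<^bsub>C\<^esub> \<eta> (Dom C f)"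
    using h(1) dom cD unit_nat[of f] by simp
  also have "\<dots> = Zer C (Dom C f) (FObj E ?a)" unfolding h(3) using h(1) cD by simp
  finally obtain u where u: "u \<in> Arr C" "Dom C u = ?z" "Cod C u = FObj E ?a" "u \<cdot>\<^bsub>C\<^esub> c = FArr E h \<cdot>\<^bsub>C\<^esub> \<eta> ?y"
    using C.cokernel_factor[OF c, of "FArr E h \<cdot>\<^bsub>C\<^esub> \<eta> ?y"] h(1) dom cD by auto
  obtain w where w: "w \<in> Arr A" "Dom A w = FObj L ?z" "Cod A w = ?a" "FArr E w \<cdot>\<^bsub>C\<^esub> \<eta> ?z = u"
    using unit_lift[OF u(1-3)] h(1) by auto
  have "FArr E (w \<cdot> FArr L c) \<cdot>\<^bsub>C\<^esub> \<eta> ?y = (FArr E w \<cdot>\<^bsub>C\<^esub> \<eta> ?z) \<cdot>\<^bsub>C\<^esub> c"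
    using w(1-3) cD unit_nat[of c] by simp
  also have "\<dots> = FArr E h \<cdot>\<^bsub>C\<^esub> \<eta> ?y" using w u by simp
  finally have "w \<cdot> FArr L c = h"
    by (rule unit_eqI) (use w h(1) dom cD in simp_all)
  then show "\<exists>u\<in>Arr A. Dom A u = Cod A (FArr L c) \<and> Cod A u = Cod A h \<and> u \<cdot> FArr L c = h"
    using w cD by auto
qed (use C.cokernelD[OF c] in simp_all)

text \<open>As \<open>\<eta>\<close> is invertible, \<open>u\<close> is conjugate to
  \<open>E (L u)\<close>, and \<open>E\<close> preserves the kernel of \<open>L u\<close> formed in
  \<open>A\<close>.\<close>

lemma ex_kernel_C:
  assumes u: "u \<in> Arr C"
  shows "\<exists>k. is_kernel C k u"
proof -
  let ?x = "Dom C u" and ?y = "Cod C u"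
  have xy: "?x \<in> Obj C" "?y \<in> Obj C" using u by simp_all
  obtain k where k: "is_kernel A k (FArr L u)" using A.ex_kernel[of "FArr L u"] u by auto
  note kD = A.kernelD[OF k]
  have "is_kernel C (\<eta>' ?x \<cdot>\<^bsub>C\<^esub> (FArr E k \<cdot>\<^bsub>C\<^esub> Idn C (FObj E (Dom A k))))
      (\<eta>' ?y \<cdot>\<^bsub>C\<^esub> (FArr E (FArr L u) \<cdot>\<^bsub>C\<^esub> \<eta> ?x))"
    by (rule C.kernel_transport[OF E_kernel[OF k] unit_inv[OF xy(1)] C.inverse_arrows_idn
          C.iso_mono[OF inverse_arrows_sym[OF unit_inv[OF xy(2)]]]]) (use u kD xy in simp_all)
  moreover have "\<eta>' ?y \<cdot>\<^bsub>C\<^esub> (FArr E (FArr L u) \<cdot>\<^bsub>C\<^esub> \<eta> ?x) = u"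
    using u xy C.inverse_cancel[OF unit_inv[OF xy(2)], of u] by (simp add: unit_nat[OF u, symmetric])
  ultimately show ?thesis by auto
qed

text \<open>Here \<open>R\<close> replaces \<open>L\<close>, since a right adjoint preserves
  monomorphisms: \<open>R u\<close> is a kernel in \<open>A\<close>, its image under
  \<open>E\<close> is one in \<open>C\<close>, and \<open>\<kappa>\<close> identifies this image
  with \<open>u\<close>.\<close>

lemma mono_normal_C:
  assumes m: "monomorphism C u"
  shows "\<exists>g. is_kernel C u g"
proof -
  let ?x = "Dom C u" and ?y = "Cod C u"
  note u = C.mono_arr[OF m]
  have xy: "?x \<in> Obj C" "?y \<in> Obj C" using u by simp_all
  obtain g where g: "is_kernel A (FArr R u) g" using A.mono_normal[OF R_mono[OF m]] by blast
  note gD = A.kernelD[OF g]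
  have "is_kernel C (\<kappa> ?y \<cdot>\<^bsub>C\<^esub> (FArr E (FArr R u) \<cdot>\<^bsub>C\<^esub> \<kappa>' ?x))
      (Idn C (FObj E (Cod A g)) \<cdot>\<^bsub>C\<^esub> (FArr E g \<cdot>\<^bsub>C\<^esub> \<kappa>' ?y))"
    by (rule C.kernel_transport[OF E_kernel[OF g] inverse_arrows_sym[OF counit_inv[OF xy(2)]]
          inverse_arrows_sym[OF counit_inv[OF xy(1)]] C.idn_mono]) (use u gD xy in simp_all)
  moreover have "\<kappa> ?y \<cdot>\<^bsub>C\<^esub> (FArr E (FArr R u) \<cdot>\<^bsub>C\<^esub> \<kappa>' ?x) = u"
    using u xy C.reassoc[OF counit_nat[OF u], of "\<kappa>' ?x"] by simp
  ultimately show ?thesis by auto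
qed

lemma ex_cokernel_C: "u \<in> Arr C \<Longrightarrow> \<exists>c. is_cokernel C c u"
  using ff_adjoint_triple.ex_kernel_C[OF ff_op, of u] by simp

lemma epi_normal_C: "epimorphism C u \<Longrightarrow> \<exists>g. is_cokernel C u g"
  using ff_adjoint_triple.mono_normal_C[OF ff_op, of u] by simp

lemma abelian_C: "abelian_category C"
  by unfold_locales (fact ex_kernel_C ex_cokernel_C mono_normal_C epi_normal_C)+

text \<open>The common reason why \<open>L\<close> and \<open>M\<close> are fully faithful: each is
  a section of \<open>E\<close> up to a natural isomorphism \<open>\<zeta>\<close>, and
  \<open>E\<close> is faithful on arrows between its values.\<close>

lemma section_ff:
  assumes F: "is_functor C A F"
    and inv: "\<And>x. x \<in> Obj C \<Longrightarrow> inverse_arrows C (\<zeta> x) (\<zeta>' x)"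
    and ty: "\<And>x. x \<in> Obj C \<Longrightarrow> Dom C (\<zeta> x) = x \<and> Cod C (\<zeta> x) = FObj E (FObj F x)"
    and nat: "\<And>u. u \<in> Arr C \<Longrightarrow> \<zeta> (Cod C u) \<cdot>\<^bsub>C\<^esub> u = FArr E (FArr F u) \<cdot>\<^bsub>C\<^esub> \<zeta> (Dom C u)"
    and inj: "\<And>v w x y. x \<in> Obj C \<Longrightarrow> y \<in> Obj C \<Longrightarrow> v \<in> homset A (FObj F x) (FObj F y) \<Longrightarrow>
      w \<in> homset A (FObj F x) (FObj F y) \<Longrightarrow> FArr E v = FArr E w \<Longrightarrow> v = w"
  shows "fully_faithful C A F"
  unfolding fully_faithful_def
proof (intro ballI)
  fix x y assume xy: "x \<in> Obj C" "y \<in> Obj C"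
  interpret F: functor_between C A F using F by unfold_locales
  have z: "\<zeta> x \<in> Arr C" "\<zeta> y \<in> Arr C" "\<zeta>' y \<in> Arr C" "Dom C (\<zeta>' y) = FObj E (FObj F y)" "Cod C (\<zeta>' y) = y"
    "Dom C (\<zeta> x) = x" "Cod C (\<zeta> x) = FObj E (FObj F x)" "Dom C (\<zeta> y) = y" "Cod C (\<zeta> y) = FObj E (FObj F y)"
    using inv[OF xy(1)] inv[OF xy(2)] ty[OF xy(1)] ty[OF xy(2)] by (simp_all add: inverse_arrows_def)
  show "bij_betw (FArr F) (homset C x y) (homset A (FObj F x) (FObj F y))"
    unfolding bij_betw_def
  proof
    show "inj_on (FArr F) (homset C x y)"
    proof (rule inj_onI)
      fix u v assume u: "u \<in> homset C x y" and v: "v \<in> homset C x y" and e: "FArr F u = FArr F v"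
      show "u = v"
        by (rule C.mono_cancel[OF C.iso_mono[OF inv[OF xy(2)]]]) (use nat[of u] nat[of v] u v e z in simp_all)
    qed
    show "FArr F ` homset C x y = homset A (FObj F x) (FObj F y)"
    proof (intro equalityI subsetI)
      fix h assume h: "h \<in> homset A (FObj F x) (FObj F y)"
      \<comment> \<open>Conjugating \<open>E h\<close> by \<open>\<zeta>\<close> is the only
        candidate that naturality leaves for a preimage of \<open>h\<close>.\<close>
      let ?u = "\<zeta>' y \<cdot>\<^bsub>C\<^esub> (FArr E h \<cdot>\<^bsub>C\<^esub> \<zeta> x)"
      have u: "?u \<in> Arr C" "Dom C ?u = x" "Cod C ?u = y" using z h by simp_all
      have "FArr E (FArr F ?u) \<cdot>\<^bsub>C\<^esub> \<zeta> x = FArr E h \<cdot>\<^bsub>C\<^esub> \<zeta> x"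
        using nat[OF u(1)] C.inverse_cancel'[OF inv[OF xy(2)], of "FArr E h \<cdot>\<^bsub>C\<^esub> \<zeta> x"] z h
        unfolding u by simp
      then have "FArr E (FArr F ?u) = FArr E h"
        by (rule C.epi_cancel[OF C.iso_epi[OF inv[OF xy(1)]]]) (use z h u in \<open>simp_all del: F.arr_comp\<close>)
      then have "FArr F ?u = h"
        by (rule inj[OF xy, rotated 2]) (use u h in \<open>simp_all del: F.arr_comp\<close>)
      then show "h \<in> FArr F ` homset C x y" using u by (intro image_eqI[of _ _ ?u]) simp_all
    qed auto
  qed
qed

section \<open>The essential images of \<open>L\<close> and \<open>R\<close>\<close>

lemma L_ff: "fully_faithful C A L"
proof (rule section_ff[OF L.is_functor unit_inv])
  fix v w x y assume "x \<in> Obj C" "y \<in> Obj C" "v \<in> homset A (FObj L x) (FObj L y)"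
    "w \<in> homset A (FObj L x) (FObj L y)" "FArr E v = FArr E w"
  then show "v = w" by (intro unit_eqI[of v x w]) simp_all
next
  show "Dom C (\<eta> x) = x \<and> Cod C (\<eta> x) = FObj E (FObj L x)" if "x \<in> Obj C" for x
    using that by simp
qed (assumption | erule unit_nat)+

lemma R_ff: "fully_faithful C A R"
  using ff_adjoint_triple.L_ff[OF ff_op] by (simp add: fully_faithful_op)

text \<open>The triangle identity makes the counit a left inverse of \<open>L (\<eta> x)\<close>,
  which is already invertible.\<close>

lemma counit_L_L_inverse:
  assumes x: "x \<in> Obj C"
  shows "inverse_arrows A (counit_L (FObj L x)) (FArr L (\<eta> x))"
proof -
  have Lx: "FObj L x \<in> Obj A" and ELx: "FObj E (FObj L x) \<in> Obj C" using x by simp_all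
  have i: "inverse_arrows A (FArr L (\<eta> x)) (FArr L (\<eta>' x))" using L.arr_inverse[OF unit_inv[OF x]] .
  have "counit_L (FObj L x) \<cdot> FArr L (\<eta> x) = Idn A (FObj L x)"
  proof (rule unit_eqI[OF _ x])
    have "FArr E (counit_L (FObj L x)) \<cdot>\<^bsub>C\<^esub> (FArr E (FArr L (\<eta> x)) \<cdot>\<^bsub>C\<^esub> \<eta> x) = \<eta> x"
      using unit_nat[of "\<eta> x", symmetric] C.reassoc1[OF counit_L(4)[OF Lx], of "\<eta> x"] x by simp
    then show "FArr E (counit_L (FObj L x) \<cdot> FArr L (\<eta> x)) \<cdot>\<^bsub>C\<^esub> \<eta> x = FArr E (Idn A (FObj L x)) \<cdot>\<^bsub>C\<^esub> \<eta> x"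
      using x by simp
  qed (use x in simp_all)
  from A.reassoc1[OF this, of "FArr L (\<eta>' x)"] have "counit_L (FObj L x) = FArr L (\<eta>' x)"
    using x i by (simp add: inverse_arrows_def)
  then show ?thesis using inverse_arrows_sym[OF i] by simp
qed

text \<open>Given an isomorphism \<open>f\<close> from \<open>L x\<close> to \<open>a\<close>,
  naturality writes the counit at \<open>a\<close> as the counit at \<open>L x\<close> conjugated by
  isomorphisms.\<close>

lemma L_image_iff:
  assumes a: "a \<in> Obj A"
  shows "a \<in> essential_image C A L \<longleftrightarrow> isomorphism A (counit_L a)"
proof
  assume "isomorphism A (counit_L a)"
  then obtain i where "inverse_arrows A (counit_L a) i" unfolding isomorphism_iff by blast
  from A.isomorphicI[OF this] have "isomorphic A (FObj L (FObj E a)) a" using a by simp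
  moreover have "FObj E a \<in> Obj C" using a by simp
  ultimately show "a \<in> essential_image C A L" using a unfolding essential_image_def by blast
next
  assume "a \<in> essential_image C A L"
  then obtain x where x: "x \<in> Obj C" and "isomorphic A (FObj L x) a"
    unfolding essential_image_def by blast
  then obtain f g where f: "inverse_arrows A f g" "f \<in> Arr A" "g \<in> Arr A" "Dom A f = FObj L x" "Cod A f = a"
    "Dom A g = a" "Cod A g = FObj L x"
    using A.isomorphicE by metis
  have i: "inverse_arrows A (f \<cdot> (counit_L (FObj L x) \<cdot> FArr L (FArr E g)))
      ((FArr L (FArr E f) \<cdot> FArr L (\<eta> x)) \<cdot> g)"
    by (intro A.inverse_arrows_comp f counit_L_L_inverse x L.arr_inverse E.arr_inverse inverse_arrows_sym[OF f(1)])
      (use f x in simp_all)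
  have "counit_L (FObj L x) \<cdot> FArr L (FArr E g) = g \<cdot> counit_L a" using counit_L_nat[OF f(3)] f by simp
  then have "f \<cdot> (counit_L (FObj L x) \<cdot> FArr L (FArr E g)) = counit_L a"
    using A.inverse_cancel'[OF f(1), of "counit_L a"] a f by simp
  then show "isomorphism A (counit_L a)" using i unfolding isomorphism_iff by auto
qed

text \<open>If \<open>q\<close> kills the counit at the middle term, naturality shows that
  \<open>q \<cdot> f\<close> kills the counit at the left term, so \<open>q\<close> is
  \<open>r \<cdot> g\<close>. Then \<open>r\<close> kills the counit at the right term composed with
  \<open>L (E g)\<close>, which is epi.\<close>

lemma counit_L_epi_extension:
  assumes fg: "short_exact A f g" and a: "epimorphism A (counit_L (Dom A f))" and c: "epimorphism A (counit_L (Cod A g))"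
  shows "epimorphism A (counit_L (Cod A f))"
proof (rule A.epi_zeroI)
  note gC = fg[unfolded short_exact_def, THEN conjunct2]
  note D = A.cokernelD[OF gC]
  show "counit_L (Cod A f) \<in> Arr A" using D by simp
  fix q assume q: "q \<in> Arr A" "Dom A q = Cod A (counit_L (Cod A f))"
    "q \<cdot> counit_L (Cod A f) = Zer A (Dom A (counit_L (Cod A f))) (Cod A q)"
  have q': "Dom A q = Cod A f" and q0: "q \<cdot> counit_L (Cod A f) = Zer A (FObj L (FObj E (Cod A f))) (Cod A q)"
    using q D by simp_all
  have "(q \<cdot> f) \<cdot> counit_L (Dom A f) = (q \<cdot> counit_L (Cod A f)) \<cdot> FArr L (FArr E f)"
    using counit_L_nat[OF D(2)] q(1) q' D by simp
  also have "\<dots> = Zer A (Dom A f) (Cod A q) \<cdot> counit_L (Dom A f)" unfolding q0 using q(1) D by simp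
  finally have "q \<cdot> f = Zer A (Dom A f) (Cod A q)"
    by (rule A.epi_cancel[OF a]) (use q(1) q' D in simp_all)
  then obtain r where r: "r \<in> Arr A" "Dom A r = Cod A g" "Cod A r = Cod A q" "r \<cdot> g = q"
    using A.cokernel_factor[OF gC, of q] q(1) q' by auto
  have e: "epimorphism A (counit_L (Cod A g) \<cdot> FArr L (FArr E g))"
    by (rule A.epi_comp[OF L_epi[OF E_epi[OF A.cokernel_epi[OF gC]]] c]) (use D in simp)
  have "r \<cdot> (counit_L (Cod A g) \<cdot> FArr L (FArr E g)) = (r \<cdot> g) \<cdot> counit_L (Cod A f)"
    using counit_L_nat[OF D(1)] r(1,2) D by simp
  also have "\<dots> = Zer A (Cod A g) (Cod A q) \<cdot> (counit_L (Cod A g) \<cdot> FArr L (FArr E g))"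
    unfolding r(4) q0 using q(1) D by simp
  finally have "r = Zer A (Cod A g) (Cod A q)"
    by (rule A.epi_cancel[OF e]) (use r q(1) D in simp_all)
  then show "q = Zer A (Cod A (counit_L (Cod A f))) (Cod A q)"
    using r(4) q(1) D by auto
qed

lemma unit_R_mono_extension:
  assumes "short_exact A f g" "monomorphism A (unit_R (Dom A f))" "monomorphism A (unit_R (Cod A g))"
  shows "monomorphism A (unit_R (Cod A f))"
proof -
  have "Dom A g = Cod A f" using assms(1) by (simp add: short_exact_def is_kernel_def)
  then show ?thesis
    using ff_adjoint_triple.counit_L_epi_extension[OF ff_op, of g f] assms by (simp add: counit_L_op)
qed

text \<open>The chase needs \<open>L (E f)\<close> to be a kernel of \<open>L (E g)\<close>,
  although \<open>L\<close> is only right exact. By naturality \<open>L (E f)\<close> is the first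
  factor of the mono \<open>f \<cdot> counit_L (Dom A f)\<close>, hence mono, and a mono is the
  kernel of its cokernel.\<close>

lemma counit_L_mono_extension:
  assumes fg: "short_exact A f g" and a: "monomorphism A (counit_L (Dom A f))"
    and c: "monomorphism A (counit_L (Cod A g))"
  shows "monomorphism A (counit_L (Cod A f))"
proof (rule A.mono_zeroI)
  note gC = fg[unfolded short_exact_def, THEN conjunct2] and fK = fg[unfolded short_exact_def, THEN conjunct1]
  note D = A.cokernelD[OF gC]
  let ?f = "FArr L (FArr E f)" and ?g = "FArr L (FArr E g)"
  have ty: "?f \<in> Arr A" "?g \<in> Arr A" "Dom A ?f = FObj L (FObj E (Dom A f))"
    "Cod A ?f = FObj L (FObj E (Cod A f))" "Dom A ?g = FObj L (FObj E (Cod A f))"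
    "Cod A ?g = FObj L (FObj E (Cod A g))"
    using D by simp_all
  have "monomorphism A (f \<cdot> counit_L (Dom A f))"
    by (rule A.mono_comp[OF a A.kernel_mono[OF fK]]) (use D in simp)
  then have "monomorphism A (counit_L (Cod A f) \<cdot> ?f)" using counit_L_nat[OF D(2)] by simp
  then have mf: "monomorphism A ?f" by (rule A.mono_of_comp) (use ty D in simp_all)
  have K: "is_kernel A ?f ?g" by (rule A.mono_kernel_of_cokernel[OF mf L_cokernel[OF E_cokernel[OF gC]]])
  show "counit_L (Cod A f) \<in> Arr A" using D by simp
  fix t assume t: "t \<in> Arr A" "Cod A t = Dom A (counit_L (Cod A f))"
    "counit_L (Cod A f) \<cdot> t = Zer A (Dom A t) (Cod A (counit_L (Cod A f)))"
  have t': "Cod A t = FObj L (FObj E (Cod A f))" and t0: "counit_L (Cod A f) \<cdot> t = Zer A (Dom A t) (Cod A f)"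
    using t D by simp_all
  \<comment> \<open>An arrow \<open>t\<close> killed by the middle counit is killed by
    \<open>L (E g)\<close>, so it comes from \<open>L (E (Dom A f))\<close>.\<close>
  have "counit_L (Cod A g) \<cdot> (?g \<cdot> t) = (counit_L (Cod A g) \<cdot> ?g) \<cdot> t" using t(1) t' ty D by simp
  also have "\<dots> = g \<cdot> (counit_L (Cod A f) \<cdot> t)" using counit_L_nat[OF D(1)] t(1) t' D by simp
  also have "\<dots> = counit_L (Cod A g) \<cdot> Zer A (Dom A t) (FObj L (FObj E (Cod A g)))"
    unfolding t0 using t(1) D by simp
  finally have "?g \<cdot> t = Zer A (Dom A t) (FObj L (FObj E (Cod A g)))"
    by (rule A.mono_cancel[OF c]) (use t(1) t' ty D in simp_all)
  then obtain s where s: "s \<in> Arr A" "Dom A s = Dom A t" "Cod A s = FObj L (FObj E (Dom A f))" "?f \<cdot> s = t"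
    using A.kernel_factor[OF K, of t] t(1) t' ty by auto
  have "(f \<cdot> counit_L (Dom A f)) \<cdot> s = (counit_L (Cod A f) \<cdot> ?f) \<cdot> s" using counit_L_nat[OF D(2)] by simp
  also have "\<dots> = counit_L (Cod A f) \<cdot> (?f \<cdot> s)" using s(1-3) ty D by simp
  also have "\<dots> = (f \<cdot> counit_L (Dom A f)) \<cdot> Zer A (Dom A t) (FObj L (FObj E (Dom A f)))"
    unfolding s(4) t0 using t(1) D by simp
  finally have "s = Zer A (Dom A t) (FObj L (FObj E (Dom A f)))"
    by (rule A.mono_cancel[OF \<open>monomorphism A (f \<cdot> counit_L (Dom A f))\<close>]) (use s t(1) D in simp_all)
  then show "t = Zer A (Dom A t) (Dom A (counit_L (Cod A f)))"
    using s(4) t(1) ty D by auto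
qed

lemma L_image_extension_closed: "extension_closed A (essential_image C A L)"
  unfolding extension_closed_def
proof (intro allI impI)
  fix f g assume *: "short_exact A f g \<and> Dom A f \<in> essential_image C A L \<and> Cod A g \<in> essential_image C A L"
  then have D: "f \<in> Arr A" "g \<in> Arr A" by (simp_all add: short_exact_def is_kernel_def)
  obtain i j where "inverse_arrows A (counit_L (Dom A f)) i" "inverse_arrows A (counit_L (Cod A g)) j"
    using * D by (auto simp: L_image_iff isomorphism_iff)
  then have "monomorphism A (counit_L (Cod A f))" "epimorphism A (counit_L (Cod A f))"
    using * counit_L_epi_extension[of f g] counit_L_mono_extension[of f g] A.iso_mono A.iso_epi by metis+
  then show "Cod A f \<in> essential_image C A L" using A.mono_epi_iso D by (simp add: L_image_iff)
qed

lemma R_image_extension_closed: "extension_closed A (essential_image C A R)"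
  using ff_adjoint_triple.L_image_extension_closed[OF ff_op] A.preadditive_category_axioms
  by (simp add: extension_closed_op essential_image_op)

end


section \<open>The intermediate functor\<close>

text \<open>Diagonal filler of a square. The epi \<open>e\<close> is a cokernel of some
  \<open>k\<close>; as \<open>m\<close> is mono, commutativity forces \<open>g\<close> to kill
  \<open>k\<close>, and so \<open>g\<close> factors through \<open>e\<close>.\<close>

lemma (in abelian_category) epi_mono_lift:
  assumes e: "epimorphism C e" and m: "monomorphism C m" and sq: "m \<cdot> g = h \<cdot> e"
    and ty: "g \<in> Arr C" "h \<in> Arr C" "Dom C g = Dom C e" "Cod C g = Dom C m" "Dom C h = Cod C e" "Cod C h = Cod C m"
  obtains v where "v \<in> Arr C" "Dom C v = Cod C e" "Cod C v = Dom C m" "v \<cdot> e = g" "m \<cdot> v = h"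
proof -
  note eA = epi_arr[OF e] and mA = mono_arr[OF m]
  obtain k where k: "is_cokernel C e k" using epi_normal[OF e] by blast
  note kD = cokernelD[OF k]
  have "m \<cdot> (g \<cdot> k) = h \<cdot> (e \<cdot> k)" by (rule reassoc[OF sq]) (use ty eA mA kD in simp_all)
  also have "\<dots> = m \<cdot> Zer C (Dom C k) (Dom C m)" using ty mA kD by simp
  finally have "g \<cdot> k = Zer C (Dom C k) (Dom C m)"
    by (rule mono_cancel[OF m]) (use ty mA kD in simp_all)
  then obtain v where v: "v \<in> Arr C" "Dom C v = Cod C e" "Cod C v = Dom C m" "v \<cdot> e = g"
    using cokernel_factor[OF k, of g] ty kD by auto
  have "(m \<cdot> v) \<cdot> e = h \<cdot> e" using v sq eA mA by simp
  then have "m \<cdot> v = h" by (rule epi_cancel[OF e]) (use v ty eA mA in simp_all)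
  then show ?thesis using that v by blast
qed

context ff_adjoint_triple
begin

text \<open>Arrows from \<open>L x\<close> to \<open>R y\<close> correspond to arrows from
  \<open>x\<close> to \<open>y\<close>: both adjunctions are applied, with \<open>E (L x)\<close>
  identified with \<open>x\<close>.\<close>

lemma L_R_eqI:
  assumes "\<kappa> y \<cdot>\<^bsub>C\<^esub> (FArr E v \<cdot>\<^bsub>C\<^esub> \<eta> x) = \<kappa> y \<cdot>\<^bsub>C\<^esub> (FArr E w \<cdot>\<^bsub>C\<^esub> \<eta> x)"
    and ty: "x \<in> Obj C" "y \<in> Obj C" "v \<in> Arr A" "w \<in> Arr A" "Dom A v = FObj L x" "Dom A w = FObj L x"
      "Cod A v = FObj R y" "Cod A w = FObj R y"
  shows "v = w"
proof (rule unit_eqI[OF _ ty(1)])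
  show "FArr E v \<cdot>\<^bsub>C\<^esub> \<eta> x = FArr E w \<cdot>\<^bsub>C\<^esub> \<eta> x"
    by (rule C.mono_cancel[OF C.iso_mono[OF counit_inv[OF ty(2)]] assms(1)]) (use ty in simp_all)
qed (use ty in simp_all)

end

text \<open>
  \<open>M x\<close> is the image of the arrow \<open>L x \<rightarrow> R x\<close> that corresponds to the identity of \<open>x\<close> under both
  adjunctions; the axiom \<open>image\<close> characterises this arrow.
\<close>

locale intermediate = ff_adjoint_triple A C E L R \<eta> \<kappa> \<eta>' \<kappa>'
  for A :: "('o, 'm, 'y) addcat_scheme" (structure) and C :: "('p, 'n, 'z) addcat_scheme" (structure)
    and E :: "('o, 'm, 'p, 'n) fctr" and L R :: "('p, 'n, 'o, 'm) fctr"
    and \<eta> \<kappa> \<eta>' \<kappa>' :: "'p \<Rightarrow> 'n" +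
  fixes M :: "('p, 'n, 'o, 'm) fctr" and e m :: "'p \<Rightarrow> 'm"
  assumes e_epi: "x \<in> Obj C \<Longrightarrow> epimorphism A (e x)"
    and m_mono: "x \<in> Obj C \<Longrightarrow> monomorphism A (m x)"
    and e_hom: "x \<in> Obj C \<Longrightarrow> e x \<in> homset A (FObj L x) (FObj M x)"
    and m_hom: "x \<in> Obj C \<Longrightarrow> m x \<in> homset A (FObj M x) (FObj R x)"
    and image: "x \<in> Obj C \<Longrightarrow> \<kappa> x \<cdot>\<^bsub>C\<^esub> (FArr E (m x \<cdot> e x) \<cdot>\<^bsub>C\<^esub> \<eta> x) = Idn C x"
    and M_hom: "u \<in> Arr C \<Longrightarrow> FArr M u \<in> homset A (FObj M (Dom C u)) (FObj M (Cod C u))"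
    and e_nat: "u \<in> Arr C \<Longrightarrow> FArr M u \<cdot> e (Dom C u) = e (Cod C u) \<cdot> FArr L u"
    and m_nat: "u \<in> Arr C \<Longrightarrow> m (Cod C u) \<cdot> FArr M u = FArr R u \<cdot> m (Dom C u)"

lemma (in ff_adjoint_triple) ex_intermediate:
  "\<exists>M e m. intermediate A C E L R \<eta> \<kappa> \<eta>' \<kappa>' M e m"
proof -
  have "\<exists>t. t \<in> Arr A \<and> Dom A t = FObj L x \<and> Cod A t = FObj R x \<and>
      \<kappa> x \<cdot>\<^bsub>C\<^esub> (FArr E t \<cdot>\<^bsub>C\<^esub> \<eta> x) = Idn C x" if x: "x \<in> Obj C" for x
  proof -
    have "FObj L x \<in> Obj A" using x by simp
    \<comment> \<open>The canonical arrow is the transpose under the right adjunction of the inverse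
      of the unit.\<close>
    then obtain t where t: "t \<in> Arr A" "Dom A t = FObj L x" "Cod A t = FObj R x" "\<kappa> x \<cdot>\<^bsub>C\<^esub> FArr E t = \<eta>' x"
      using counit_lift[OF inv_simps(1-3)[OF x]] by blast
    then have "\<kappa> x \<cdot>\<^bsub>C\<^esub> (FArr E t \<cdot>\<^bsub>C\<^esub> \<eta> x) = Idn C x"
      using C.reassoc1[OF t(4), of "\<eta> x"] x by simp
    then show ?thesis using t by blast
  qed
  then obtain t where t: "\<And>x. x \<in> Obj C \<Longrightarrow> t x \<in> Arr A" "\<And>x. x \<in> Obj C \<Longrightarrow> Dom A (t x) = FObj L x"
    "\<And>x. x \<in> Obj C \<Longrightarrow> Cod A (t x) = FObj R x"
    "\<And>x. x \<in> Obj C \<Longrightarrow> \<kappa> x \<cdot>\<^bsub>C\<^esub> (FArr E (t x) \<cdot>\<^bsub>C\<^esub> \<eta> x) = Idn C x"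
    by metis
  \<comment> \<open>Both composites correspond to \<open>u\<close> itself.\<close>
  have t_nat: "t (Cod C u) \<cdot> FArr L u = FArr R u \<cdot> t (Dom C u)" if u: "u \<in> Arr C" for u
  proof (rule L_R_eqI[of "Cod C u" _ "Dom C u"])
    let ?x = "Dom C u" and ?y = "Cod C u"
    have xy: "?x \<in> Obj C" "?y \<in> Obj C" using u by simp_all
    have "\<kappa> ?y \<cdot>\<^bsub>C\<^esub> (FArr E (t ?y \<cdot> FArr L u) \<cdot>\<^bsub>C\<^esub> \<eta> ?x) = (\<kappa> ?y \<cdot>\<^bsub>C\<^esub> (FArr E (t ?y) \<cdot>\<^bsub>C\<^esub> \<eta> ?y)) \<cdot>\<^bsub>C\<^esub> u"
      using t(1-3) xy u by (simp add: unit_nat)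
    also have "\<dots> = u \<cdot>\<^bsub>C\<^esub> (\<kappa> ?x \<cdot>\<^bsub>C\<^esub> (FArr E (t ?x) \<cdot>\<^bsub>C\<^esub> \<eta> ?x))"
      using t(4)[OF xy(1)] t(4)[OF xy(2)] u by simp
    also have "\<dots> = \<kappa> ?y \<cdot>\<^bsub>C\<^esub> (FArr E (FArr R u \<cdot> t ?x) \<cdot>\<^bsub>C\<^esub> \<eta> ?x)"
      using C.reassoc[OF counit_nat[OF u], of "FArr E (t ?x) \<cdot>\<^bsub>C\<^esub> \<eta> ?x"] t(1-3) xy u by simp
    finally show "\<kappa> ?y \<cdot>\<^bsub>C\<^esub> (FArr E (t ?y \<cdot> FArr L u) \<cdot>\<^bsub>C\<^esub> \<eta> ?x) =
        \<kappa> ?y \<cdot>\<^bsub>C\<^esub> (FArr E (FArr R u \<cdot> t ?x) \<cdot>\<^bsub>C\<^esub> \<eta> ?x)" .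
  qed (use t u in simp_all)
  have "\<forall>x\<in>Obj C. \<exists>p. epimorphism A (fst p) \<and> monomorphism A (snd p) \<and> Dom A (fst p) = FObj L x \<and>
      Cod A (fst p) = Dom A (snd p) \<and> Cod A (snd p) = FObj R x \<and> snd p \<cdot> fst p = t x"
    using A.epi_mono_factorization[OF t(1)] t(2,3) by (metis fst_conv snd_conv)
  from bchoice[OF this] obtain p where p: "\<forall>x\<in>Obj C. epimorphism A (fst (p x)) \<and>
      monomorphism A (snd (p x)) \<and> Dom A (fst (p x)) = FObj L x \<and>
      Cod A (fst (p x)) = Dom A (snd (p x)) \<and> Cod A (snd (p x)) = FObj R x \<and>
      snd (p x) \<cdot> fst (p x) = t x" by blast
  define e m where "e x = fst (p x)" and "m x = snd (p x)" for x
  have em: "\<And>x. x \<in> Obj C \<Longrightarrow> epimorphism A (e x)" "\<And>x. x \<in> Obj C \<Longrightarrow> monomorphism A (m x)"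
    "\<And>x. x \<in> Obj C \<Longrightarrow> Dom A (e x) = FObj L x" "\<And>x. x \<in> Obj C \<Longrightarrow> Cod A (e x) = Dom A (m x)"
    "\<And>x. x \<in> Obj C \<Longrightarrow> Cod A (m x) = FObj R x" "\<And>x. x \<in> Obj C \<Longrightarrow> m x \<cdot> e x = t x"
    using p by (simp_all add: e_def m_def)
  note eA = A.epi_arr[OF em(1)] and mA = A.mono_arr[OF em(2)]
  have "\<exists>v. v \<in> Arr A \<and> Dom A v = Dom A (m (Dom C u)) \<and> Cod A v = Dom A (m (Cod C u)) \<and>
      v \<cdot> e (Dom C u) = e (Cod C u) \<cdot> FArr L u \<and> m (Cod C u) \<cdot> v = FArr R u \<cdot> m (Dom C u)"
    if u: "u \<in> Arr C" for u
  proof -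
    let ?x = "Dom C u" and ?y = "Cod C u"
    have xy: "?x \<in> Obj C" "?y \<in> Obj C" using u by simp_all
    have "m ?y \<cdot> (e ?y \<cdot> FArr L u) = t ?y \<cdot> FArr L u"
      using A.reassoc1[OF em(6)[OF xy(2)], of "FArr L u"] em(3,4) eA mA xy u by simp
    also have "\<dots> = (FArr R u \<cdot> m ?x) \<cdot> e ?x"
      using t_nat[OF u] em(3-5) em(6)[OF xy(1)] eA mA xy u by simp
    finally have "m ?y \<cdot> (e ?y \<cdot> FArr L u) = (FArr R u \<cdot> m ?x) \<cdot> e ?x" .
    \<comment> \<open>The value of \<open>M\<close> at \<open>u\<close> is the diagonal between the
      two image factorisations.\<close>
    from A.epi_mono_lift[OF em(1)[OF xy(1)] em(2)[OF xy(2)] this] show ?thesis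
      using em(3-5) eA mA xy u by (smt (verit) A.comp_simps L.arr_simps R.arr_simps)
  qed
  then have "\<forall>u\<in>Arr C. \<exists>v. v \<in> Arr A \<and> Dom A v = Dom A (m (Dom C u)) \<and> Cod A v = Dom A (m (Cod C u)) \<and>
      v \<cdot> e (Dom C u) = e (Cod C u) \<cdot> FArr L u \<and> m (Cod C u) \<cdot> v = FArr R u \<cdot> m (Dom C u)"
    by blast
  from bchoice[OF this] obtain v where v: "\<And>u. u \<in> Arr C \<Longrightarrow> v u \<in> Arr A"
    "\<And>u. u \<in> Arr C \<Longrightarrow> Dom A (v u) = Dom A (m (Dom C u))"
    "\<And>u. u \<in> Arr C \<Longrightarrow> Cod A (v u) = Dom A (m (Cod C u))"
    "\<And>u. u \<in> Arr C \<Longrightarrow> v u \<cdot> e (Dom C u) = e (Cod C u) \<cdot> FArr L u"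
    "\<And>u. u \<in> Arr C \<Longrightarrow> m (Cod C u) \<cdot> v u = FArr R u \<cdot> m (Dom C u)"
    by blast
  have "intermediate A C E L R \<eta> \<kappa> \<eta>' \<kappa>' \<lparr>FObj = \<lambda>x. Dom A (m x), FArr = v\<rparr> e m"
    by unfold_locales (simp_all add: em eA mA t v)
  then show ?thesis by blast
qed

section \<open>Full faithfulness of \<open>M\<close> and its effect on monomorphisms and
  epimorphisms\<close>

context intermediate
begin

lemma factor_simps [simp]:
  assumes "x \<in> Obj C"
  shows "e x \<in> Arr A" "Dom A (e x) = FObj L x" "Cod A (e x) = FObj M x"
    "m x \<in> Arr A" "Dom A (m x) = FObj M x" "Cod A (m x) = FObj R x"
  using e_hom[OF assms] m_hom[OF assms] by simp_all

lemma M_obj [simp]: "x \<in> Obj C \<Longrightarrow> FObj M x \<in> Obj A"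
  using A.obj_simps(2)[OF factor_simps(1), of x] by simp

lemma M_simps [simp]:
  assumes "u \<in> Arr C"
  shows "FArr M u \<in> Arr A" "Dom A (FArr M u) = FObj M (Dom C u)" "Cod A (FArr M u) = FObj M (Cod C u)"
  using M_hom[OF assms] by simp_all

lemma image' [simp]: "x \<in> Obj C \<Longrightarrow> \<kappa> x \<cdot>\<^bsub>C\<^esub> (FArr E (m x) \<cdot>\<^bsub>C\<^esub> (FArr E (e x) \<cdot>\<^bsub>C\<^esub> \<eta> x)) = Idn C x"
  using image[of x] by simp

text \<open>An image is also a coimage: \<open>M\<close> is its own dual, and only the two factors
  change places.\<close>

lemma intermediate_op: "intermediate (op_cat A) (op_cat C) E R L \<kappa> \<eta> \<kappa>' \<eta>' M m e"
  by (intro intermediate.intro ff_op intermediate_axioms.intro)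
    (simp_all add: e_epi m_mono e_nat m_nat)

lemma M_functor: "is_functor C A M"
  unfolding is_functor_def
proof (intro conjI ballI impI)
  fix x assume x: "x \<in> Obj C"
  show "FArr M (Idn C x) = Idn A (FObj M x)"
    by (rule A.mono_cancel[OF m_mono[OF x]]) (use m_nat[of "Idn C x"] x in simp_all)
next
  fix u v assume u: "u \<in> Arr C" and v: "v \<in> Arr C" and uv: "Cod C u = Dom C v"
  have "m (Cod C v) \<cdot> FArr M (v \<cdot>\<^bsub>C\<^esub> u) = FArr R v \<cdot> (FArr R u \<cdot> m (Dom C u))"
    using m_nat[of "v \<cdot>\<^bsub>C\<^esub> u"] u v uv by simp
  also have "\<dots> = FArr R v \<cdot> (m (Dom C v) \<cdot> FArr M u)" using m_nat[OF u] uv by simp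
  also have "\<dots> = m (Cod C v) \<cdot> (FArr M v \<cdot> FArr M u)"
    by (rule A.reassoc[OF m_nat[OF v, symmetric]]) (use u v uv in simp_all)
  finally show "FArr M (v \<cdot>\<^bsub>C\<^esub> u) = FArr M v \<cdot> FArr M u"
    by (rule A.mono_cancel[OF m_mono, rotated]) (use u v uv in simp_all)
qed simp_all

sublocale M: functor_between C A M
  by unfold_locales (rule M_functor)

text \<open>\<open>E\<close> preserves the mono \<open>m x\<close>, so the second arrow is mono;
  \<open>image\<close> provides its right inverse. This is the isomorphism between
  \<open>E (M x)\<close> and \<open>x\<close>.\<close>

lemma section_inverse:
  assumes x: "x \<in> Obj C"
  shows "inverse_arrows C (FArr E (e x) \<cdot>\<^bsub>C\<^esub> \<eta> x) (\<kappa> x \<cdot>\<^bsub>C\<^esub> FArr E (m x))"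
proof (rule inverse_arrows_sym, rule C.mono_split_iso)
  show "monomorphism C (\<kappa> x \<cdot>\<^bsub>C\<^esub> FArr E (m x))"
    by (rule C.mono_comp[OF E_mono[OF m_mono[OF x]] C.iso_mono[OF counit_inv[OF x]]]) (use x in simp)
qed (use x in simp_all)

lemma section_nat:
  assumes u: "u \<in> Arr C"
  shows "(FArr E (e (Cod C u)) \<cdot>\<^bsub>C\<^esub> \<eta> (Cod C u)) \<cdot>\<^bsub>C\<^esub> u =
    FArr E (FArr M u) \<cdot>\<^bsub>C\<^esub> (FArr E (e (Dom C u)) \<cdot>\<^bsub>C\<^esub> \<eta> (Dom C u))"
proof -
  have "(FArr E (e (Cod C u)) \<cdot>\<^bsub>C\<^esub> \<eta> (Cod C u)) \<cdot>\<^bsub>C\<^esub> u =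
      FArr E (e (Cod C u) \<cdot> FArr L u) \<cdot>\<^bsub>C\<^esub> \<eta> (Dom C u)"
    using u by (simp add: unit_nat)
  also have "\<dots> = FArr E (FArr M u) \<cdot>\<^bsub>C\<^esub> (FArr E (e (Dom C u)) \<cdot>\<^bsub>C\<^esub> \<eta> (Dom C u))"
    unfolding e_nat[OF u, symmetric] using u by simp
  finally show ?thesis .
qed

text \<open>Naturality along \<open>e x\<close> moves the question to \<open>L x\<close>, where the
  counit is invertible.\<close>

lemma counit_L_M_epi:
  assumes x: "x \<in> Obj C"
  shows "epimorphism A (counit_L (FObj M x))"
proof (rule A.epi_of_comp)
  have "epimorphism A (e x \<cdot> counit_L (FObj L x))"
    by (rule A.epi_comp[OF A.iso_epi[OF counit_L_L_inverse[OF x]] e_epi[OF x]]) (use x in simp)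
  then show "epimorphism A (counit_L (FObj M x) \<cdot> FArr L (FArr E (e x)))"
    using counit_L_nat[of "e x"] x by simp
qed (use x in simp_all)

lemma unit_R_M_mono: "x \<in> Obj C \<Longrightarrow> monomorphism A (unit_R (FObj M x))"
  using intermediate.counit_L_M_epi[OF intermediate_op, of x] by (simp add: counit_L_op)

lemma M_ff: "fully_faithful C A M"
proof (rule section_ff[OF M_functor section_inverse])
  fix v w x y assume "x \<in> Obj C" "y \<in> Obj C" "v \<in> homset A (FObj M x) (FObj M y)"
    "w \<in> homset A (FObj M x) (FObj M y)" "FArr E v = FArr E w"
  then show "v = w" by (intro E_faithful_from) (simp_all add: counit_L_M_epi)
next
  show "Dom C (FArr E (e x) \<cdot>\<^bsub>C\<^esub> \<eta> x) = x \<and> Cod C (FArr E (e x) \<cdot>\<^bsub>C\<^esub> \<eta> x) = FObj E (FObj M x)"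
    if "x \<in> Obj C" for x
    using that by simp
qed (assumption | erule section_nat)+

sublocale M: ff_additive C A M
  by unfold_locales (rule M_ff)

text \<open>\<open>E (M u)\<close> is conjugate to \<open>u\<close>, hence mono, and
  \<open>E\<close> is faithful on arrows into \<open>M x\<close>, so it detects equality of the two
  test arrows.\<close>

lemma M_mono:
  assumes "monomorphism C u"
  shows "monomorphism A (FArr M u)"
proof (rule A.monoI)
  note u = C.mono_arr[OF assms]
  let ?x = "Dom C u" and ?y = "Cod C u"
  let ?s = "\<lambda>x. FArr E (e x) \<cdot>\<^bsub>C\<^esub> \<eta> x" and ?r = "\<lambda>x. \<kappa> x \<cdot>\<^bsub>C\<^esub> FArr E (m x)"
  have xy: "?x \<in> Obj C" "?y \<in> Obj C" using u by simp_all
  have inv: "inverse_arrows C (?s ?x) (?r ?x)" "inverse_arrows C (?s ?y) (?r ?y)"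
    using section_inverse xy by blast+
  have s: "?s ?x \<in> Arr C" "Dom C (?s ?x) = ?x" "Cod C (?s ?x) = FObj E (FObj M ?x)" "?s ?y \<in> Arr C"
    "Dom C (?s ?y) = ?y" "Cod C (?s ?y) = FObj E (FObj M ?y)" "?r ?x \<in> Arr C"
    "Dom C (?r ?x) = FObj E (FObj M ?x)" "Cod C (?r ?x) = ?x"
    using xy by simp_all
  have "monomorphism C ((?s ?y \<cdot>\<^bsub>C\<^esub> u) \<cdot>\<^bsub>C\<^esub> ?r ?x)"
    by (rule C.mono_comp[OF C.iso_mono[OF inverse_arrows_sym[OF inv(1)]]
          C.mono_comp[OF assms C.iso_mono[OF inv(2)]]]) (use s u in simp_all)
  also have "(?s ?y \<cdot>\<^bsub>C\<^esub> u) \<cdot>\<^bsub>C\<^esub> ?r ?x = FArr E (FArr M u) \<cdot>\<^bsub>C\<^esub> (?s ?x \<cdot>\<^bsub>C\<^esub> ?r ?x)"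
    unfolding section_nat[OF u] by (rule C.assoc) (use s u in simp_all)
  also have "\<dots> = FArr E (FArr M u)" using inv(1) s(3) u by (simp add: inverse_arrows_def)
  finally have mono: "monomorphism C (FArr E (FArr M u))" .
  fix g h assume gh: "g \<in> Arr A" "h \<in> Arr A" "Dom A g = Dom A h" "Cod A g = Dom A (FArr M u)"
    "Cod A h = Dom A (FArr M u)" "FArr M u \<cdot> g = FArr M u \<cdot> h"
  have cod: "Cod A g = FObj M ?x" "Cod A h = FObj M ?x" using gh u by simp_all
  have "FArr E (FArr M u) \<cdot>\<^bsub>C\<^esub> FArr E g = FArr E (FArr M u) \<cdot>\<^bsub>C\<^esub> FArr E h"
    using arg_cong[OF gh(6), of "FArr E"] gh(1,2) cod u by simp
  then have "FArr E g = FArr E h"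
    by (rule C.mono_cancel[OF mono]) (use gh(1-3) cod u in simp_all)
  then show "g = h"
    by (rule E_faithful_to[rotated]) (use gh(1-3) cod xy unit_R_M_mono in simp_all)
qed (use C.mono_arr[OF assms] in simp)

lemma M_epi: "epimorphism C u \<Longrightarrow> epimorphism A (FArr M u)"
  using intermediate.M_mono[OF intermediate_op, of u] by simp

text \<open>Both sides are the canonical arrow from \<open>L (E a)\<close> to
  \<open>R (E a)\<close>: each corresponds to the identity of \<open>E a\<close>.\<close>

lemma unit_R_counit_L:
  assumes a: "a \<in> Obj A"
  shows "unit_R a \<cdot> counit_L a = m (FObj E a) \<cdot> e (FObj E a)"
proof (rule L_R_eqI[of "FObj E a" _ "FObj E a"])
  show "\<kappa> (FObj E a) \<cdot>\<^bsub>C\<^esub> (FArr E (unit_R a \<cdot> counit_L a) \<cdot>\<^bsub>C\<^esub> \<eta> (FObj E a)) =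
      \<kappa> (FObj E a) \<cdot>\<^bsub>C\<^esub> (FArr E (m (FObj E a) \<cdot> e (FObj E a)) \<cdot>\<^bsub>C\<^esub> \<eta> (FObj E a))"
    using a by simp
qed (use a in simp_all)

text \<open>The canonical arrow factors both through \<open>a\<close> and through
  \<open>M (E a)\<close>. A mono second factor at \<open>a\<close> gives a comparison into
  \<open>a\<close>; dually, \<open>tau\<close> uses an epi first factor for a comparison out of
  \<open>a\<close>.\<close>

lemma sigma:
  assumes a: "a \<in> Obj A" and d: "monomorphism A (unit_R a)"
  obtains s where "s \<in> Arr A" "Dom A s = FObj M (FObj E a)" "Cod A s = a"
    "s \<cdot> e (FObj E a) = counit_L a" "unit_R a \<cdot> s = m (FObj E a)"
proof -
  have Ea: "FObj E a \<in> Obj C" using a by simp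
  obtain s where "s \<in> Arr A" "Dom A s = Cod A (e (FObj E a))" "Cod A s = Dom A (unit_R a)"
    "s \<cdot> e (FObj E a) = counit_L a" "unit_R a \<cdot> s = m (FObj E a)"
    by (rule A.epi_mono_lift[OF e_epi[OF Ea] d unit_R_counit_L[OF a]]) (use a in simp_all)
  then show ?thesis using that[of s] a by simp
qed

lemma tau:
  assumes a: "a \<in> Obj A" and d: "epimorphism A (counit_L a)"
  obtains t where "t \<in> Arr A" "Dom A t = a" "Cod A t = FObj M (FObj E a)"
    "t \<cdot> counit_L a = e (FObj E a)" "m (FObj E a) \<cdot> t = unit_R a"
proof -
  have Ea: "FObj E a \<in> Obj C" using a by simp
  obtain t where "t \<in> Arr A" "Dom A t = Cod A (counit_L a)" "Cod A t = Dom A (m (FObj E a))"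
    "t \<cdot> counit_L a = e (FObj E a)" "m (FObj E a) \<cdot> t = unit_R a"
    by (rule A.epi_mono_lift[OF d m_mono[OF Ea] unit_R_counit_L[OF a, symmetric]]) (use a in simp_all)
  then show ?thesis using that[of t] a by simp
qed

text \<open>Under both conditions \<open>a\<close> itself is an image of the canonical arrow, and
  two image factorisations agree.\<close>

lemma sigma_tau:
  assumes a: "a \<in> Obj A" and ep: "epimorphism A (counit_L a)" and mo: "monomorphism A (unit_R a)"
  obtains s t where "inverse_arrows A s t" "s \<in> Arr A" "Dom A s = FObj M (FObj E a)" "Cod A s = a"
    "s \<cdot> e (FObj E a) = counit_L a" "unit_R a \<cdot> s = m (FObj E a)"
    "t \<in> Arr A" "Dom A t = a" "Cod A t = FObj M (FObj E a)"
    "t \<cdot> counit_L a = e (FObj E a)" "m (FObj E a) \<cdot> t = unit_R a"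
proof -
  have Ea: "FObj E a \<in> Obj C" using a by simp
  obtain s where s: "s \<in> Arr A" "Dom A s = FObj M (FObj E a)" "Cod A s = a"
    "s \<cdot> e (FObj E a) = counit_L a" "unit_R a \<cdot> s = m (FObj E a)"
    using sigma[OF a mo] .
  obtain t where t: "t \<in> Arr A" "Dom A t = a" "Cod A t = FObj M (FObj E a)"
    "t \<cdot> counit_L a = e (FObj E a)" "m (FObj E a) \<cdot> t = unit_R a"
    using tau[OF a ep] .
  have "m (FObj E a) \<cdot> (t \<cdot> s) = m (FObj E a) \<cdot> Idn A (FObj M (FObj E a))"
    using A.reassoc1[OF t(5), of s] s t Ea by simp
  then have ts: "t \<cdot> s = Idn A (FObj M (FObj E a))"
    by (rule A.mono_cancel[OF m_mono[OF Ea]]) (use s t Ea in simp_all)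
  have "(s \<cdot> t) \<cdot> counit_L a = Idn A a \<cdot> counit_L a" using s t a by simp
  then have st: "s \<cdot> t = Idn A a" by (rule A.epi_cancel[OF ep]) (use s t a in simp_all)
  have "inverse_arrows A s t" using st ts s t by (simp add: inverse_arrows_def)
  then show ?thesis using that s t by blast
qed

lemma M_image_iff:
  assumes a: "a \<in> Obj A"
  shows "a \<in> essential_image C A M \<longleftrightarrow> epimorphism A (counit_L a) \<and> monomorphism A (unit_R a)"
proof
  assume "a \<in> essential_image C A M"
  then obtain x where x: "x \<in> Obj C" and "isomorphic A (FObj M x) a"
    unfolding essential_image_def by blast
  then obtain f g where f: "inverse_arrows A f g" "Dom A f = FObj M x" "Cod A f = a"
    using A.isomorphicE by metis
  show "epimorphism A (counit_L a) \<and> monomorphism A (unit_R a)"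
    using counit_L_iso_image[OF f(1)] unit_R_iso_image[OF f(1)] counit_L_M_epi[OF x] unit_R_M_mono[OF x] f(2,3) by simp
next
  assume "epimorphism A (counit_L a) \<and> monomorphism A (unit_R a)"
  then obtain s t where "inverse_arrows A s t" "Dom A s = FObj M (FObj E a)" "Cod A s = a"
    using sigma_tau[OF a] by metis
  from A.isomorphicI[OF this(1)] this have "isomorphic A (FObj M (FObj E a)) a" by simp
  moreover have "FObj E a \<in> Obj C" using a by simp
  ultimately show "a \<in> essential_image C A M" using a unfolding essential_image_def by blast
qed

lemma M_image_extension_closed: "extension_closed A (essential_image C A M)"
  unfolding extension_closed_def
proof (intro allI impI)
  fix f g assume *: "short_exact A f g \<and> Dom A f \<in> essential_image C A M \<and> Cod A g \<in> essential_image C A M"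
  then have "f \<in> Arr A" "g \<in> Arr A" by (simp_all add: short_exact_def is_kernel_def)
  then show "Cod A f \<in> essential_image C A M"
    using * counit_L_epi_extension[of f g] unit_R_mono_extension[of f g] by (simp add: M_image_iff)
qed

section \<open>Exactness of \<open>M\<close> and the Serre condition\<close>

text \<open>
  The arrow \<open>\<sigma> : M (E a) \<rightarrow> a\<close> is a monomorphism, and exactness of \<open>M (E f), M (E g)\<close> makes \<open>f\<close> factor
  through \<open>f \<sigma>\<close>, so that \<open>\<sigma>\<close> splits.
\<close>

lemma counit_L_epi_subobject:
  assumes fg: "short_exact A f g" and b: "epimorphism A (counit_L (Cod A f))" "monomorphism A (unit_R (Cod A f))"
    and ex: "short_exact A (FArr M (FArr E f)) (FArr M (FArr E g))"
  shows "epimorphism A (counit_L (Dom A f))"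
proof -
  note fK = fg[unfolded short_exact_def, THEN conjunct1] and gC = fg[unfolded short_exact_def, THEN conjunct2]
  note MK = ex[unfolded short_exact_def, THEN conjunct1]
  note D = A.kernelD(1-3)[OF fK]
  obtain a b c where abc: "Dom A f = a" "Cod A f = b" "Dom A g = b" "Cod A g = c" using D by auto
  have O: "a \<in> Obj A" "b \<in> Obj A" "c \<in> Obj A" using D abc by auto
  note ty = D(1,2) abc O
  have mf: "monomorphism A f" using A.kernel_mono[OF fK] .
  have b_ep: "epimorphism A (counit_L b)" and b_mo: "monomorphism A (unit_R b)" using b abc by simp_all
  have "monomorphism A (FArr R (FArr E f) \<cdot> unit_R a)"
    using A.mono_comp[OF mf b_mo] unit_R_nat[OF D(1)] ty by simp
  then have a_mo: "monomorphism A (unit_R a)" by (rule A.mono_of_comp) (use ty in simp_all)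
  have "epimorphism A (counit_L c \<cdot> FArr L (FArr E g))"
    using A.epi_comp[OF b_ep A.cokernel_epi[OF gC]] counit_L_nat[OF D(2)] ty by simp
  then have c_ep: "epimorphism A (counit_L c)" by (rule A.epi_of_comp) (use ty in simp_all)
  obtain sa where sa: "sa \<in> Arr A" "Dom A sa = FObj M (FObj E a)" "Cod A sa = a"
    "sa \<cdot> e (FObj E a) = counit_L a" "unit_R a \<cdot> sa = m (FObj E a)"
    using sigma[OF O(1) a_mo] .
  obtain tc where tc: "tc \<in> Arr A" "Dom A tc = c" "Cod A tc = FObj M (FObj E c)"
    "tc \<cdot> counit_L c = e (FObj E c)"
    using tau[OF O(3) c_ep] by blast
  obtain sb tb where i: "inverse_arrows A sb tb" and sb: "sb \<in> Arr A" "Dom A sb = FObj M (FObj E b)" "Cod A sb = b"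
    "unit_R b \<cdot> sb = m (FObj E b)"
    and tb: "tb \<in> Arr A" "Dom A tb = b" "Cod A tb = FObj M (FObj E b)" "tb \<cdot> counit_L b = e (FObj E b)"
    using sigma_tau[OF O(2) b_ep b_mo] by blast
  let ?f = "FArr M (FArr E f)" and ?g = "FArr M (FArr E g)"
  have Mty: "?f \<in> Arr A" "Dom A ?f = FObj M (FObj E a)" "Cod A ?f = FObj M (FObj E b)"
    "?g \<in> Arr A" "Dom A ?g = FObj M (FObj E b)" "Cod A ?g = FObj M (FObj E c)"
    using ty by simp_all
  have s_nat: "f \<cdot> sa = sb \<cdot> ?f"
  proof (rule A.mono_cancel[OF b_mo])
    have "unit_R b \<cdot> (f \<cdot> sa) = FArr R (FArr E f) \<cdot> (unit_R a \<cdot> sa)"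
      by (rule A.reassoc) (use unit_R_nat[OF D(1)] ty sa(1-3) in simp_all)
    also have "\<dots> = m (FObj E b) \<cdot> ?f" unfolding sa(5) using m_nat[of "FArr E f"] ty by simp
    also have "\<dots> = unit_R b \<cdot> (sb \<cdot> ?f)"
      by (rule A.reassoc1[symmetric, OF sb(4)]) (use ty sb(1-3) Mty in simp_all)
    finally show "unit_R b \<cdot> (f \<cdot> sa) = unit_R b \<cdot> (sb \<cdot> ?f)" .
  qed (use ty sa(1-3) sb(1-3) Mty in simp_all)
  have t_nat: "tc \<cdot> g = ?g \<cdot> tb"
  proof (rule A.epi_cancel[OF b_ep])
    have "(tc \<cdot> g) \<cdot> counit_L b = tc \<cdot> (counit_L c \<cdot> FArr L (FArr E g))"
      using counit_L_nat[OF D(2)] ty tc(1-3) by simp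
    also have "\<dots> = e (FObj E c) \<cdot> FArr L (FArr E g)"
      by (rule A.reassoc1[OF tc(4)]) (use ty tc(1-3) in simp_all)
    also have "\<dots> = ?g \<cdot> e (FObj E b)" using e_nat[of "FArr E g"] ty by simp
    also have "\<dots> = (?g \<cdot> tb) \<cdot> counit_L b" using tb ty Mty by simp
    finally show "(tc \<cdot> g) \<cdot> counit_L b = (?g \<cdot> tb) \<cdot> counit_L b" .
  qed (use ty tc(1-3) tb(1-3) Mty in simp_all)
  have "?g \<cdot> (tb \<cdot> f) = tc \<cdot> (g \<cdot> f)"
    by (rule A.reassoc[OF t_nat[symmetric]]) (use ty tc(1-3) tb(1-3) Mty in simp_all)
  also have "\<dots> = Zer A a (FObj M (FObj E c))" using A.kernelD(4)[OF fK] ty tc(1-3) by simp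
  finally obtain r where r: "r \<in> Arr A" "Dom A r = a" "Cod A r = FObj M (FObj E a)" "?f \<cdot> r = tb \<cdot> f"
    using A.kernel_factor[OF MK, of "tb \<cdot> f"] ty tb(1-3) Mty by auto
  have "f \<cdot> (sa \<cdot> r) = sb \<cdot> (?f \<cdot> r)"
    by (rule A.reassoc[OF s_nat]) (use ty sa(1-3) sb(1-3) Mty r(1-3) in simp_all)
  also have "\<dots> = f \<cdot> Idn A a" unfolding r(4) using A.inverse_cancel'[OF i, of f] ty tb(2) by simp
  finally have sar: "sa \<cdot> r = Idn A a"
    by (rule A.mono_cancel[OF mf]) (use ty sa(1-3) r(1-3) in simp_all)
  have "monomorphism A (unit_R a \<cdot> sa)" unfolding sa(5) by (rule m_mono) (use O in simp)
  then have "monomorphism A sa" by (rule A.mono_of_comp) (use O sa(1-3) in simp_all)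
  then have "inverse_arrows A sa r" by (rule A.mono_split_iso) (use sar sa(1-3) r(1-3) in simp_all)
  then have "epimorphism A (sa \<cdot> e (FObj E a))"
    by (intro A.epi_comp e_epi A.iso_epi[of sa r]) (use O sa(1-3) in simp_all)
  then show ?thesis using sa(4) abc(1) by simp
qed

lemma unit_R_mono_quotient:
  assumes "short_exact A f g" "epimorphism A (counit_L (Cod A f))" "monomorphism A (unit_R (Cod A f))"
    and "short_exact A (FArr M (FArr E f)) (FArr M (FArr E g))"
  shows "monomorphism A (unit_R (Cod A g))"
proof -
  have "Dom A g = Cod A f" using assms(1) by (simp add: short_exact_def is_kernel_def)
  then show ?thesis
    using intermediate.counit_L_epi_subobject[OF intermediate_op, of g f] assms by (simp add: counit_L_op unit_R_op)
qed

text \<open>Subobjects inherit a mono \<open>unit_R\<close> and quotients an epi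
  \<open>counit_L\<close> by naturality alone. The two remaining conditions, an epi counit on the
  subobject and a mono unit on the quotient, use that \<open>M\<close> keeps the exact sequence
  \<open>E f\<close>, \<open>E g\<close> exact.\<close>

lemma serre_if_exact:
  assumes ex: "exact_functor C A M"
  shows "serre_subcategory A (essential_image C A M)"
  unfolding serre_subcategory_def
proof (intro conjI allI impI)
  show "essential_image C A M \<subseteq> Obj A" by (rule essential_image_subset)
  obtain z where "zero_object C z" using C.ex_zero_object by blast
  then have "z \<in> Obj C" by (simp add: zero_object_def)
  then show "essential_image C A M \<noteq> {}" using M.essential_image_obj by blast
  fix f g assume fg: "short_exact A f g"
  note fK = fg[unfolded short_exact_def, THEN conjunct1] and gC = fg[unfolded short_exact_def, THEN conjunct2]
  from fg have D: "f \<in> Arr A" "g \<in> Arr A" "Dom A g = Cod A f" by (simp_all add: short_exact_def is_kernel_def)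
  show "Cod A f \<in> essential_image C A M \<longleftrightarrow>
      Dom A f \<in> essential_image C A M \<and> Cod A g \<in> essential_image C A M"
  proof
    assume "Dom A f \<in> essential_image C A M \<and> Cod A g \<in> essential_image C A M"
    then show "Cod A f \<in> essential_image C A M"
      using M_image_extension_closed fg unfolding extension_closed_def by blast
  next
    assume "Cod A f \<in> essential_image C A M"
    then have b: "epimorphism A (counit_L (Cod A f))" "monomorphism A (unit_R (Cod A f))"
      using D by (simp_all add: M_image_iff)
    have "short_exact C (FArr E f) (FArr E g)"
      using fg E_kernel E_cokernel by (simp add: short_exact_def)
    then have ME: "short_exact A (FArr M (FArr E f)) (FArr M (FArr E g))"
      using ex by (simp add: exact_functor_def)
    have "monomorphism A (FArr R (FArr E f) \<cdot> unit_R (Dom A f))"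
      using A.mono_comp[OF A.kernel_mono[OF fK] b(2)] unit_R_nat[OF D(1)] D by simp
    then have "monomorphism A (unit_R (Dom A f))" by (rule A.mono_of_comp) (use D in simp_all)
    moreover have "epimorphism A (counit_L (Cod A g) \<cdot> FArr L (FArr E g))"
      using A.epi_comp[OF b(1) A.cokernel_epi[OF gC]] counit_L_nat[OF D(2)] D by simp
    then have "epimorphism A (counit_L (Cod A g))" by (rule A.epi_of_comp) (use D in simp_all)
    ultimately show "Dom A f \<in> essential_image C A M \<and> Cod A g \<in> essential_image C A M"
      using counit_L_epi_subobject[OF fg b ME] unit_R_mono_quotient[OF fg b ME] D by (simp add: M_image_iff)
  qed
qed

text \<open>The cokernel \<open>p\<close> of \<open>M f\<close> is a quotient of an object in the
  image, so by the Serre condition its target lies there too and \<open>p\<close> lifts to an arrow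
  \<open>q\<close> of \<open>C\<close>. Faithfulness gives that \<open>q\<close> kills
  \<open>f\<close>, so \<open>q\<close> factors through \<open>g\<close> and \<open>p\<close>
  through \<open>M g\<close>. Whatever kills \<open>M f\<close> thus factors through
  \<open>M g\<close>, uniquely because \<open>M g\<close> is epi.\<close>

lemma exact_if_serre:
  assumes S: "serre_subcategory A (essential_image C A M)"
  shows "exact_functor C A M"
  unfolding exact_functor_def
proof (intro conjI allI impI)
  show "additive_functor C A M" by (rule M.additive)
  fix f g assume fg: "short_exact C f g"
  note fK = fg[unfolded short_exact_def, THEN conjunct1] and gC = fg[unfolded short_exact_def, THEN conjunct2]
  note D = C.cokernelD[OF gC]
  have Mf: "monomorphism A (FArr M f)" using M_mono C.kernel_mono[OF fK] .
  obtain p where p: "is_cokernel A p (FArr M f)" using A.ex_cokernel[of "FArr M f"] D by auto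
  note pD = A.cokernelD[OF p]
  have pd: "Dom A p = FObj M (Cod C f)" using pD D by simp
  have "short_exact A (FArr M f) p"
    using A.mono_kernel_of_cokernel[OF Mf p] p by (simp add: short_exact_def)
  moreover have "Cod A (FArr M f) \<in> essential_image C A M" using D M.essential_image_obj by simp
  ultimately have "Cod A p \<in> essential_image C A M"
    using S unfolding serre_subcategory_def by blast
  then obtain w where w: "w \<in> Obj C" "isomorphic A (FObj M w) (Cod A p)"
    unfolding essential_image_def by blast
  obtain b b' where b: "inverse_arrows A b b'" "b \<in> Arr A" "b' \<in> Arr A" "Dom A b = FObj M w"
    "Cod A b = Cod A p" "Dom A b' = Cod A p" "Cod A b' = FObj M w"
    using A.isomorphicE[OF w(2)] by metis
  obtain q where q: "q \<in> Arr C" "Dom C q = Cod C f" "Cod C q = w" "FArr M q = b' \<cdot> p"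
    using M.full[of "b' \<cdot> p" "Cod C f" w] b pD(1) pd w(1) D by auto
  have "q \<cdot>\<^bsub>C\<^esub> f = Zer C (Dom C f) w"
  proof (rule M.faithful)
    have "FArr M (q \<cdot>\<^bsub>C\<^esub> f) = b' \<cdot> (p \<cdot> FArr M f)" using q b pD(1) pd D by simp
    also have "\<dots> = FArr M (Zer C (Dom C f) w)" using pD(4) pD(1) pd b D w(1) by simp
    finally show "FArr M (q \<cdot>\<^bsub>C\<^esub> f) = FArr M (Zer C (Dom C f) w)" .
  qed (use q D w(1) in simp_all)
  then obtain r where r: "r \<in> Arr C" "Dom C r = Cod C g" "Cod C r = w" "r \<cdot>\<^bsub>C\<^esub> g = q"
    using C.cokernel_factor[OF gC, of q] q by auto
  have pr: "p = b \<cdot> (FArr M r \<cdot> FArr M g)"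
    using A.inverse_cancel'[OF b(1), of p] pD(1) b(6) q(4) r D unfolding r(4)[symmetric] by simp
  have "is_cokernel A (FArr M g) (FArr M f)"
  proof (rule A.cokernelI)
    show "epimorphism A (FArr M g)" using M_epi C.cokernel_epi[OF gC] .
    show "FArr M g \<cdot> FArr M f = Zer A (Dom A (FArr M f)) (Cod A (FArr M g))"
      using arg_cong[OF D(4), of "FArr M"] D(1-3) by simp
    fix h assume h: "h \<in> Arr A" "Dom A h = Cod A (FArr M f)"
      "h \<cdot> FArr M f = Zer A (Dom A (FArr M f)) (Cod A h)"
    obtain t where t: "t \<in> Arr A" "Dom A t = Cod A p" "Cod A t = Cod A h" "t \<cdot> p = h"
      using A.cokernel_factor[OF p h] .
    have "(t \<cdot> (b \<cdot> FArr M r)) \<cdot> FArr M g = h"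
      using t(1-3) b r(1-3) D(1-3) unfolding t(4)[symmetric] by (subst pr) simp
    then show "\<exists>u\<in>Arr A. Dom A u = Cod A (FArr M g) \<and> Cod A u = Cod A h \<and> u \<cdot> FArr M g = h"
      using t(1-3) b(2-5) r(1-3) D(1-3) by (intro bexI[of _ "t \<cdot> (b \<cdot> FArr M r)"]) simp_all
  qed (use D in simp_all)
  then show "short_exact A (FArr M f) (FArr M g)"
    using A.mono_kernel_of_cokernel[OF Mf] by (simp add: short_exact_def)
qed

end


section \<open>Essential images in a triangulated category\<close>

text \<open>A triangle with terms in the image has its terms in \<open>S\<close>, where it is short
  exact, and short exactness restricts to the smaller full subcategory. Closure under isomorphisms
  of \<open>T\<close> uses that \<open>S\<close> is closed, so that the isomorphism already lies in
  the full subcategory on \<open>S\<close>.\<close>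

lemma essential_image_codistinguished:
  assumes T: "category T" and S: "codistinguished_abelian_subcategory T S"
    and F: "ff_additive C (full_subcat T S) F" and C: "abelian_category C"
  shows "codistinguished_abelian_subcategory T (essential_image C (full_subcat T S) F)"
proof -
  let ?I = "essential_image C (full_subcat T S) F"
  interpret T: category T by fact
  interpret F: ff_additive C "full_subcat T S" F by fact
  have S': "S \<subseteq> Obj T" "closed_under_iso T S"
    using S by (simp_all add: codistinguished_abelian_subcategory_def abelian_subcategory_def
        additive_subcategory_def)
  have I: "?I \<subseteq> S" using essential_image_subset[of C "full_subcat T S" F] by simp
  have ab: "abelian_category (full_subcat T ?I)"
    using F.essential_image_abelian[OF C] by (simp add: full_subcat_full_subcat[OF I])
  then have ad: "additive_category (full_subcat T ?I)" by (rule abelian_category.axioms(1))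
  have iso: "closed_under_iso T ?I"
    unfolding closed_under_iso_def
  proof (intro ballI impI)
    fix x y assume x: "x \<in> ?I" and y: "y \<in> Obj T" and xy: "isomorphic T x y"
    have "x \<in> S" using x I by blast
    then have "y \<in> S" using S'(2) y xy unfolding closed_under_iso_def by blast
    then have "isomorphic (full_subcat T S) x y"
      using \<open>x \<in> S\<close> xy by (simp add: T.isomorphic_full_subcat[OF S'(1)])
    then show "y \<in> ?I" by (rule F.essential_image_iso[OF x])
  qed
  have "short_exact (full_subcat T ?I) f g"
    if "(f, g, h) \<in> Dist T" "Dom T f \<in> ?I" "Cod T f \<in> ?I" "Cod T g \<in> ?I" for f g h
  proof -
    have "short_exact (full_subcat T S) f g"
      using S that I unfolding codistinguished_abelian_subcategory_def by blast
    then show ?thesis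
      using short_exact_full_subcat[of "full_subcat T S" f g ?I] that
      by (simp add: full_subcat_full_subcat[OF I])
  qed
  then show ?thesis
    using ab ad iso I S'(1) unfolding codistinguished_abelian_subcategory_def
      abelian_subcategory_def additive_subcategory_def by blast
qed

text \<open>Whichever of \<open>L\<close> and \<open>R\<close> is given as fully faithful, both the
  unit and the counit become invertible; their inverses are chosen objectwise.\<close>

lemma ff_adjunction_triple_ex:
  assumes A: "abelian_category A" and C: "additive_category C" and LER: "ff_adjunction_triple A C L E R"
  obtains \<eta> \<kappa> \<eta>' \<kappa>' where "ff_adjoint_triple A C E L R \<eta> \<kappa> \<eta>' \<kappa>'"
proof -
  interpret A: abelian_category A by fact
  interpret C: additive_category C by fact
  have L: "left_adjoint C A L E" and R: "left_adjoint A C E R"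
    and ff: "fully_faithful C A L \<or> fully_faithful C A R"
    using LER by (simp_all add: ff_adjunction_triple_def adjunction_triple_def)
  obtain \<eta> where \<eta>: "\<And>x. x \<in> Obj C \<Longrightarrow> \<eta> x \<in> homset C x (FObj E (FObj L x))"
    "\<And>u. u \<in> Arr C \<Longrightarrow> \<eta> (Cod C u) \<cdot>\<^bsub>C\<^esub> u = FArr E (FArr L u) \<cdot>\<^bsub>C\<^esub> \<eta> (Dom C u)"
    "\<And>x a h. x \<in> Obj C \<Longrightarrow> a \<in> Obj A \<Longrightarrow> h \<in> homset C x (FObj E a) \<Longrightarrow>
      \<exists>!v. v \<in> homset A (FObj L x) a \<and> FArr E v \<cdot>\<^bsub>C\<^esub> \<eta> x = h"
    using left_adjoint_unit[OF C.category_axioms A.category_axioms L] by blast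
  obtain \<kappa> where \<kappa>: "\<And>x. x \<in> Obj C \<Longrightarrow> \<kappa> x \<in> homset C (FObj E (FObj R x)) x"
    "\<And>u. u \<in> Arr C \<Longrightarrow> \<kappa> (Cod C u) \<cdot>\<^bsub>C\<^esub> FArr E (FArr R u) = u \<cdot>\<^bsub>C\<^esub> \<kappa> (Dom C u)"
    "\<And>x a h. x \<in> Obj C \<Longrightarrow> a \<in> Obj A \<Longrightarrow> h \<in> homset C (FObj E a) x \<Longrightarrow>
      \<exists>!v. v \<in> homset A a (FObj R x) \<and> \<kappa> x \<cdot>\<^bsub>C\<^esub> FArr E v = h"
    using left_adjoint_counit[OF C.category_axioms A.category_axioms R] by blast
  interpret adjoint_triple A C E L R \<eta> \<kappa>
    by (intro adjoint_triple.intro functor_between.intro functor_between_axioms.intro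
        adjoint_triple_axioms.intro A.preadditive_category_axioms C.preadditive_category_axioms
        A.category_axioms C.category_axioms \<eta> \<kappa>)
      (use L R in \<open>simp_all add: left_adjoint_def\<close>)
  have "\<forall>x\<in>Obj C. \<exists>i. inverse_arrows C (\<eta> x) i" "\<forall>x\<in>Obj C. \<exists>i. inverse_arrows C (\<kappa> x) i"
    using unit_counit_iso[OF ff] unfolding isomorphism_iff by blast+
  then obtain \<eta>' \<kappa>' where "\<forall>x\<in>Obj C. inverse_arrows C (\<eta> x) (\<eta>' x)"
    "\<forall>x\<in>Obj C. inverse_arrows C (\<kappa> x) (\<kappa>' x)"
    unfolding bchoice_iff by blast
  then have "ff_adjoint_triple A C E L R \<eta> \<kappa> \<eta>' \<kappa>'"
    by unfold_locales simp_all
  then show ?thesis by (rule that)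
qed

theorem theoremC:
  fixes \<T> :: "('o, 'm) tricat" and \<A> :: "'o set" and \<C> :: "('p, 'n) addcat"
    and L :: "('p, 'n, 'o, 'm) fctr" and E :: "('o, 'm, 'p, 'n) fctr" and R :: "('p, 'n, 'o, 'm) fctr"
  assumes "triangulated_category \<T>"
    and "abelian_subcategory \<T> \<A>"
    and "additive_category \<C>"
    and "ff_adjunction_triple (full_subcat \<T> \<A>) \<C> L E R"
  shows "\<exists>C :: ('p, 'n, 'o, 'm) fctr.
    is_functor \<C> (full_subcat \<T> \<A>) C \<and>
    (fully_faithful \<C> (full_subcat \<T> \<A>) C \<and>
     preserves_monos \<C> (full_subcat \<T> \<A>) C \<and>
     preserves_epis \<C> (full_subcat \<T> \<A>) C \<and>
     reflects_short_exact \<C> (full_subcat \<T> \<A>) C \<and>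
     (exact_functor \<C> (full_subcat \<T> \<A>) C \<longleftrightarrow>
      serre_subcategory (full_subcat \<T> \<A>) (essential_image \<C> (full_subcat \<T> \<A>) C))) \<and>
    (extension_closed (full_subcat \<T> \<A>) (essential_image \<C> (full_subcat \<T> \<A>) L) \<and>
     extension_closed (full_subcat \<T> \<A>) (essential_image \<C> (full_subcat \<T> \<A>) R) \<and>
     extension_closed (full_subcat \<T> \<A>) (essential_image \<C> (full_subcat \<T> \<A>) C)) \<and>
    (codistinguished_abelian_subcategory \<T> \<A> \<longrightarrow>
     codistinguished_abelian_subcategory \<T> (essential_image \<C> (full_subcat \<T> \<A>) L) \<and>
     codistinguished_abelian_subcategory \<T> (essential_image \<C> (full_subcat \<T> \<A>) R) \<and>
     codistinguished_abelian_subcategory \<T> (essential_image \<C> (full_subcat \<T> \<A>) C))"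
proof -
  let ?A = "full_subcat \<T> \<A>"
  interpret T: triangulated_category \<T> by fact
  have A: "abelian_category ?A" using assms(2) by (simp add: abelian_subcategory_def)
  obtain \<eta> \<kappa> \<eta>' \<kappa>' where "ff_adjoint_triple ?A \<C> E L R \<eta> \<kappa> \<eta>' \<kappa>'"
    using ff_adjunction_triple_ex[OF A assms(3,4)] .
  then obtain M e m where "intermediate ?A \<C> E L R \<eta> \<kappa> \<eta>' \<kappa>' M e m"
    using ff_adjoint_triple.ex_intermediate by blast
  then interpret intermediate ?A \<C> E L R \<eta> \<kappa> \<eta>' \<kappa>' M e m .
  have L: "ff_additive \<C> ?A L" by unfold_locales (rule L_ff)
  have R: "ff_additive \<C> ?A R" by unfold_locales (rule R_ff)
  have M: "ff_additive \<C> ?A M" by unfold_locales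
  note cod = essential_image_codistinguished[OF T.category_axioms _ _ abelian_C, rotated]
  show ?thesis
  proof (intro exI[of _ M] conjI impI)
    show "preserves_monos \<C> ?A M" by (simp add: preserves_monos_def M_mono)
    show "preserves_epis \<C> ?A M" by (simp add: preserves_epis_def M_epi)
    show "exact_functor \<C> ?A M \<longleftrightarrow> serre_subcategory ?A (essential_image \<C> ?A M)"
      using serre_if_exact exact_if_serre by blast
  qed (fact M_functor M_ff M.reflects_short_exact L_image_extension_closed R_image_extension_closed
      M_image_extension_closed | (rule cod[OF L] cod[OF R] cod[OF M], assumption))+
qed

end
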